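(* Let $F$ be a rooted labeled forest with $n$ vertices $v_1,\dots,v_n$, and let $F'=\Delta F$, with vertices denoted $v_1',\dots,v_n'$. Then: 1. $v_{j_1},\dots,v_{j_p}$ are the projective vertices of $F$ if and only if $v'_{n-j_1+1},\dots,v'_{n-j_p+1}$ are the roots of $\Delta F$. 2. $v_{k_1},\dots,v_{k_r}$ are the roots of $F$ if and only if $v'_{n-k_1+1},\dots,v'_{n-k_r+1}$ are the injective vertices of $\Delta F$.
   Context: Let $K$ be a field, $Q: 1\to 2\to\cdots\to n$, $\Lambda=KQ$; modules are finite-dimensional representations of $Q$ over $K$. A complete exceptional sequence is a sequence $E_*=(E_1,\dots,E_n)$ of rigid indecomposable modules (up to isomorphism) such that $\mathrm{Hom}(E_j,E_i)=0=\mathrm{Ext}^1(E_j,E_i)$ for all $i<j$. A rooted labeled forest with $n$ vertices is a forest with vertices $v_1,\dots,v_n$ and a chosen root in each component. The forest of $E_*$ is the Hasse diagram (roots = maximal elements) of the order $v_i\le v_j$ iff $\mathrm{supp}\,E_i\subseteq \mathrm{supp}\,E_j$; this gives a bijection between complete exceptional sequences and rooted labeled forests with $n$ vertices. The braid group $B_n$ (generators $\sigma_1,\dots,\sigma_{n-1}$) acts on complete exceptional sequences by $\sigma_i(E_* )=(E_1,\dots,E_{i-1},E_i',E_i,E_{i+2},\dots,E_n)$, where $E_i'$ is the unique module making this a complete exceptional sequence, and hence acts on rooted labeled forests through the bijection. Products act as compositions of operators (rightmost factor first). The Garside element is $\Delta=\delta_{n-1}\delta_{n-2}\cdots\delta_2\delta_1$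 with $\delta_k=\sigma_1\sigma_2\cdots\sigma_k$. The projective vertices $v_{j_1},\dots,v_{j_p}$ of $F$ (equivalently, the vertices $v_j$ such that $E_j$ is a projective module) are given by: $v_{j_p}$ is the root of $F$ with the largest label; $v_{j_i}$ is the child of $v_{j_{i+1}}$ with largest label among those children whose label is less than $j_{i+1}$; the process stops at $v_{j_1}$, which has no child with smaller label. The injective vertices $v_{k_1},\dots,v_{k_q}$ of $F$ (equivalently, those with $E_k$ an injective module) are given by: $v_{k_1}$ is the root of $F$ with the smallest label; $v_{k_{i+1}}$ is the child of $v_{k_i}$ with smallest label among those children whose label is greater than $k_i$; the process stops at $v_{k_q}$, which has no child with larger label. *)

theory Defs
  imports "Jordan_Normal_Form.Matrix_Kernel"
begin

(* A finite-dimensional representation of 1 -> 2 -> ... -> n over K, with the space K^(vdim M i)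
   at vertex i and the matrix vmap M i of the map along the arrow i -> i+1.  Every
   finite-dimensional representation is isomorphic to one of this form.  Only the values
   vdim M i (1 <= i <= n) and vmap M i (1 <= i < n) carry meaning. *)
record 'k qrep =
  vdim :: "nat \<Rightarrow> nat"
  vmap :: "nat \<Rightarrow> 'k mat"

definition is_rep :: "nat \<Rightarrow> 'k::field qrep \<Rightarrow> bool" where
  "is_rep n M \<longleftrightarrow> (\<forall>i\<in>{1..<n}. vmap M i \<in> carrier_mat (vdim M (Suc i)) (vdim M i))"

definition is_zero_rep :: "nat \<Rightarrow> 'k::field qrep \<Rightarrow> bool" where
  "is_zero_rep n M \<longleftrightarrow> (\<forall>i\<in>{1..n}. vdim M i = 0)"

definition is_hom :: "nat \<Rightarrow> 'k::field qrep \<Rightarrow> 'k qrep \<Rightarrow> (nat \<Rightarrow> 'k mat) \<Rightarrow> bool" where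
  "is_hom n M N f \<longleftrightarrow>
     (\<forall>i\<in>{1..n}. f i \<in> carrier_mat (vdim N i) (vdim M i)) \<and>
     (\<forall>i\<in>{1..<n}. f (Suc i) * vmap M i = vmap N i * f i)"

definition iso_rep :: "nat \<Rightarrow> 'k::field qrep \<Rightarrow> 'k qrep \<Rightarrow> bool" where
  "iso_rep n M N \<longleftrightarrow> (\<exists>f g. is_hom n M N f \<and> is_hom n N M g \<and>
     (\<forall>i\<in>{1..n}. g i * f i = 1\<^sub>m (vdim M i) \<and> f i * g i = 1\<^sub>m (vdim N i)))"

definition Hom_zero :: "nat \<Rightarrow> 'k::field qrep \<Rightarrow> 'k qrep \<Rightarrow> bool" where
  "Hom_zero n M N \<longleftrightarrow>
     (\<forall>f. is_hom n M N f \<longrightarrow> (\<forall>i\<in>{1..n}. f i = 0\<^sub>m (vdim N i) (vdim M i)))"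

definition short_exact ::
  "nat \<Rightarrow> 'k::field qrep \<Rightarrow> (nat \<Rightarrow> 'k mat) \<Rightarrow> 'k qrep \<Rightarrow> (nat \<Rightarrow> 'k mat) \<Rightarrow> 'k qrep \<Rightarrow> bool" where
  "short_exact n N f X g M \<longleftrightarrow> is_hom n N X f \<and> is_hom n X M g \<and>
     (\<forall>i\<in>{1..n}.
        inj_on (\<lambda>v. f i *\<^sub>v v) (carrier_vec (vdim N i)) \<and>
        (\<lambda>v. f i *\<^sub>v v) ` carrier_vec (vdim N i) = mat_kernel (g i) \<and>
        (\<lambda>v. g i *\<^sub>v v) ` carrier_vec (vdim X i) = carrier_vec (vdim M i))"

(* Ext^1(M,N) = 0 in the sense of Yoneda: every extension 0 -> N -> X -> M -> 0 splits. *)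
definition Ext1_zero :: "nat \<Rightarrow> 'k::field qrep \<Rightarrow> 'k qrep \<Rightarrow> bool" where
  "Ext1_zero n M N \<longleftrightarrow>
     (\<forall>X f g. is_rep n X \<and> short_exact n N f X g M \<longrightarrow>
        (\<exists>s. is_hom n M X s \<and> (\<forall>i\<in>{1..n}. g i * s i = 1\<^sub>m (vdim M i))))"

definition direct_sum_rep :: "'k::field qrep \<Rightarrow> 'k qrep \<Rightarrow> 'k qrep" where
  "direct_sum_rep A B =
     \<lparr> vdim = (\<lambda>i. vdim A i + vdim B i),
       vmap = (\<lambda>i. four_block_mat
                 (vmap A i) (0\<^sub>m (vdim A (Suc i)) (vdim B i))
                 (0\<^sub>m (vdim B (Suc i)) (vdim A i)) (vmap B i)) \<rparr>"

definition indecomposable_rep :: "nat \<Rightarrow> 'k::field qrep \<Rightarrow> bool" where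
  "indecomposable_rep n M \<longleftrightarrow> is_rep n M \<and> \<not> is_zero_rep n M \<and>
     (\<forall>A B. is_rep n A \<and> is_rep n B \<and> iso_rep n M (direct_sum_rep A B) \<longrightarrow>
        is_zero_rep n A \<or> is_zero_rep n B)"

definition rigid_rep :: "nat \<Rightarrow> 'k::field qrep \<Rightarrow> bool" where
  "rigid_rep n M \<longleftrightarrow> Ext1_zero n M M"

definition supp_rep :: "nat \<Rightarrow> 'k::field qrep \<Rightarrow> nat set" where
  "supp_rep n M = {i\<in>{1..n}. vdim M i \<noteq> 0}"

(* Sequences (E_1,...,E_n) are functions on nat whose values outside {1..n} carry no meaning. *)
definition complete_exceptional :: "nat \<Rightarrow> (nat \<Rightarrow> 'k::field qrep) \<Rightarrow> bool" where
  "complete_exceptional n E \<longleftrightarrow>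
     (\<forall>i\<in>{1..n}. is_rep n (E i) \<and> rigid_rep n (E i) \<and> indecomposable_rep n (E i)) \<and>
     (\<forall>i\<in>{1..n}. \<forall>j\<in>{1..n}. i < j \<longrightarrow> Hom_zero n (E j) (E i) \<and> Ext1_zero n (E j) (E i))"

(* The module E_i' is unique only up to isomorphism; SOME picks a representative. *)
definition braid_seq :: "nat \<Rightarrow> nat \<Rightarrow> (nat \<Rightarrow> 'k::field qrep) \<Rightarrow> (nat \<Rightarrow> 'k qrep)" where
  "braid_seq n i E =
     (let X = (SOME X. complete_exceptional n (E(i := X, Suc i := E i)))
      in E(i := X, Suc i := E i))"

(* A rooted labeled forest on v_1,...,v_n is given by its edges, each directed from a child to its
   parent (that is, towards the root of its component): (a,b) means that v_b is the parent of v_a. *)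
definition rooted_forest :: "nat \<Rightarrow> (nat \<times> nat) set \<Rightarrow> bool" where
  "rooted_forest n F \<longleftrightarrow> F \<subseteq> {1..n} \<times> {1..n} \<and> single_valued F \<and> acyclic F"

definition forest_roots :: "nat \<Rightarrow> (nat \<times> nat) set \<Rightarrow> nat set" where
  "forest_roots n F = {1..n} - Domain F"

definition forest_children :: "(nat \<times> nat) set \<Rightarrow> nat \<Rightarrow> nat set" where
  "forest_children F v = {w. (w, v) \<in> F}"

(* The Hasse diagram of the order given by inclusion of supports. *)
definition forest_of :: "nat \<Rightarrow> (nat \<Rightarrow> 'k::field qrep) \<Rightarrow> (nat \<times> nat) set" where
  "forest_of n E = {(i, j). i \<in> {1..n} \<and> j \<in> {1..n} \<and>
     supp_rep n (E i) \<subset> supp_rep n (E j) \<and>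
     \<not> (\<exists>k\<in>{1..n}. supp_rep n (E i) \<subset> supp_rep n (E k) \<and> supp_rep n (E k) \<subset> supp_rep n (E j))}"

(* forest_of is a bijection from complete exceptional sequences up to isomorphism onto rooted
   forests, so inv_into yields a representative of the isomorphism class belonging to F. *)
definition seq_of_forest :: "nat \<Rightarrow> (nat \<times> nat) set \<Rightarrow> (nat \<Rightarrow> 'k::field qrep)" where
  "seq_of_forest n F = inv_into {E. complete_exceptional n E} (forest_of n) F"

definition braid_forest ::
  "'k::field itself \<Rightarrow> nat \<Rightarrow> nat \<Rightarrow> (nat \<times> nat) set \<Rightarrow> (nat \<times> nat) set" where
  "braid_forest K n i F = forest_of n (braid_seq n i (seq_of_forest n F :: nat \<Rightarrow> 'k qrep))"

(* sigma_1 o sigma_2 o ... o sigma_k: the factor sigma_k acts first. *)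
definition delta_forest ::
  "'k::field itself \<Rightarrow> nat \<Rightarrow> nat \<Rightarrow> (nat \<times> nat) set \<Rightarrow> (nat \<times> nat) set" where
  "delta_forest K n k = foldr (\<circ>) (map (braid_forest K n) [1..<Suc k]) id"

(* delta_(n-1) o ... o delta_2 o delta_1: the factor delta_1 acts first. *)
definition garside_forest ::
  "'k::field itself \<Rightarrow> nat \<Rightarrow> (nat \<times> nat) set \<Rightarrow> (nat \<times> nat) set" where
  "garside_forest K n = foldr (\<circ>) (map (delta_forest K n) (rev [1..<n])) id"

inductive_set projective_vertices :: "nat \<Rightarrow> (nat \<times> nat) set \<Rightarrow> nat set"
  for n :: nat and F :: "(nat \<times> nat) set" where
  proj_root: "forest_roots n F \<noteq> {} \<Longrightarrow> Max (forest_roots n F) \<in> projective_vertices n F"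
| proj_child: "\<lbrakk>v \<in> projective_vertices n F; {w \<in> forest_children F v. w < v} \<noteq> {}\<rbrakk> \<Longrightarrow>
    Max {w \<in> forest_children F v. w < v} \<in> projective_vertices n F"

inductive_set injective_vertices :: "nat \<Rightarrow> (nat \<times> nat) set \<Rightarrow> nat set"
  for n :: nat and F :: "(nat \<times> nat) set" where
  inj_root: "forest_roots n F \<noteq> {} \<Longrightarrow> Min (forest_roots n F) \<in> injective_vertices n F"
| inj_child: "\<lbrakk>v \<in> injective_vertices n F; {w \<in> forest_children F v. v < w} \<noteq> {}\<rbrakk> \<Longrightarrow>
    Min {w \<in> forest_children F v. v < w} \<in> injective_vertices n F"

end

(* The indecomposable modules are the interval modules [a, b], and Hom and Ext^1 between them vanish
   according to simple inequalities, so a complete exceptional sequence is a sequence of n intervals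
   which pairwise satisfy exc_pair.  The Euler form is <[a, b], z> = z a - z (b + 1), i.e. it tests
   whether the chord (a, b + 1) crosses a set of points.

   Let S_j be the member of Delta E at position n + 1 - j.  It lies in front of all S_i with i < j and
   of all E_i with i > j, and S_1, ..., S_(j-1) span the same lattice as E_1, ..., E_(j-1); hence
   <E_i, S_j> vanishes exactly for i \<noteq> j, i.e. S_j is dual to E_j.  Reading intervals as chords, S_j is
   crossed by the chord of E_j only.  The supports of the roots of a complete exceptional sequence
   tile {1..n}; comparing the tilings for E and for Delta E with this crossing property shows that E_j
   is projective iff S_j is a root, and that E_j is a root iff S_j is injective. *)
theory Submission
  imports Defs
begin

text \<open>The action on forests is hidden behind two choices, \<open>inv_into\<close> in
  \<open>seq_of_forest\<close> and \<open>SOME\<close> in \<open>braid_seq\<close>. The first is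
  controlled by showing that a forest and its intervals determine each other. A virtual root with
  interval [1, n + 1] yields n + 1 labels, and each interval has exactly one point outside its
  proper subintervals. So labels match points, an interval has as many points as its subtree has
  vertices, and a child lies left or right of the own point of its parent according as its label is
  larger or smaller. Read as a traversal order, this both recovers the intervals and realizes every
  forest. The second choice is controlled by recording only which entries a braid generator shifts
  or keeps: no formula for the new modules is carried along. In an exceptional sequence Hom and
  Ext^1 from later to earlier members both vanish, hence so does the Euler form; as a complete
  sequence spans the whole lattice Z^n, integral linear algebra then recovers what the later
  arguments need about the new members.\<close>

section \<open>Exceptional sequences of intervals\<close>

text \<open>\<open>[a, b]\<close> may precede \<open>[c, d]\<close> in an exceptional sequence: the first conjunct expresses
  \<open>Hom([c, d], [a, b]) = 0\<close>, the second \<open>Ext\<^sup>1([c, d], [a, b]) = 0\<close>.\<close>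

definition exc_pair :: "nat \<Rightarrow> nat \<Rightarrow> nat \<Rightarrow> nat \<Rightarrow> bool" where
  "exc_pair a b c d \<longleftrightarrow> \<not> (a \<le> c \<and> c \<le> b \<and> b \<le> d) \<and> \<not> (c < a \<and> a \<le> Suc d \<and> Suc d \<le> b)"

definition exc_intervals :: "nat \<Rightarrow> (nat \<Rightarrow> nat) \<Rightarrow> (nat \<Rightarrow> nat) \<Rightarrow> bool" where
  "exc_intervals n a b \<longleftrightarrow>
     (\<forall>i\<in>{1..n}. 1 \<le> a i \<and> a i \<le> b i \<and> b i \<le> n) \<and>
     (\<forall>i\<in>{1..n}. \<forall>j\<in>{1..n}. i < j \<longrightarrow> exc_pair (a i) (b i) (a j) (b j))"

text \<open>If the chords (a, b + 1) and (c, d + 1) share an endpoint, the new chord is the third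
  side of their triangle; otherwise it is the second chord itself. In module terms it is the middle
  term of an extension, a kernel or a cokernel formed from the two modules, which is why
  orthogonality to both passes to it.\<close>

lemma exc_pair_mutation:
  assumes "exc_pair a b c d" "1 \<le> a" "a \<le> b" "b \<le> n" "1 \<le> c" "c \<le> d" "d \<le> n"
  obtains x y where "1 \<le> x" "x \<le> y" "y \<le> n" "exc_pair x y a b"
    "\<And>e f. \<lbrakk>e \<le> f; exc_pair e f a b; exc_pair e f c d\<rbrakk> \<Longrightarrow> exc_pair e f x y"
    "\<And>e f. \<lbrakk>e \<le> f; exc_pair a b e f; exc_pair c d e f\<rbrakk> \<Longrightarrow> exc_pair x y e f"
proof -
  \<comment> \<open>Ext^1([a, b], [c, d]) is nonzero in the first case, Hom([a, b], [c, d]) in the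
    next two, and both vanish in the last.\<close>
  consider "Suc b = c" | "a = c" "d < b" | "b = d" "c < a" | "Suc b \<noteq> c" "a \<noteq> c" "b \<noteq> d"
    using assms unfolding exc_pair_def by linarith
  then show thesis
  proof cases
    case 1
    show thesis by (rule that[of a d]) (use 1 assms in \<open>unfold exc_pair_def, (linarith | presburger)+\<close>)
  next
    case 2
    show thesis by (rule that[of "Suc d" b]) (use 2 assms in \<open>unfold exc_pair_def, (linarith | presburger)+\<close>)
  next
    case 3
    show thesis by (rule that[of c "a - 1"]) (use 3 assms in \<open>unfold exc_pair_def, (linarith | presburger)+\<close>)
  next
    case 4
    show thesis by (rule that[of c d]) (use 4 assms in \<open>unfold exc_pair_def, (linarith | presburger)+\<close>)
  qed
qed

text \<open>Supplies the witness behind the \<open>SOME\<close> in \<open>braid_seq\<close>.\<close>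

lemma mutation_exists:
  assumes E: "exc_intervals n a b" and i: "1 \<le> i" "i < n"
  obtains x y where "exc_intervals n (a(i := x, Suc i := a i)) (b(i := y, Suc i := b i))"
proof -
  have B: "1 \<le> a k \<and> a k \<le> b k \<and> b k \<le> n" if "k \<in> {1..n}" for k
    using E that unfolding exc_intervals_def by blast
  have P: "exc_pair (a k) (b k) (a l) (b l)" if "k \<in> {1..n}" "l \<in> {1..n}" "k < l" for k l
    using E that unfolding exc_intervals_def by blast
  have ii: "i \<in> {1..n}" "Suc i \<in> {1..n}" using i by auto
  obtain x y where xy: "1 \<le> x" "x \<le> y" "y \<le> n" "exc_pair x y (a i) (b i)"
    "\<And>e f. \<lbrakk>e \<le> f; exc_pair e f (a i) (b i); exc_pair e f (a (Suc i)) (b (Suc i))\<rbrakk> \<Longrightarrow> exc_pair e f x y"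
    "\<And>e f. \<lbrakk>e \<le> f; exc_pair (a i) (b i) e f; exc_pair (a (Suc i)) (b (Suc i)) e f\<rbrakk> \<Longrightarrow> exc_pair x y e f"
    by (rule exc_pair_mutation[of "a i" "b i" "a (Suc i)" "b (Suc i)" n]) (use P[OF ii] B[OF ii(1)] B[OF ii(2)] in auto)
  have "exc_intervals n (a(i := x, Suc i := a i)) (b(i := y, Suc i := b i))"
    unfolding exc_intervals_def
  proof (intro conjI ballI impI)
    fix k assume k: "k \<in> {1..n}"
    show "1 \<le> (a(i := x, Suc i := a i)) k" "(a(i := x, Suc i := a i)) k \<le> (b(i := y, Suc i := b i)) k"
      "(b(i := y, Suc i := b i)) k \<le> n"
      using B[OF k] B[OF ii(1)] xy(1-3) by auto
  next
    fix k l assume kl: "k \<in> {1..n}" "l \<in> {1..n}" "k < l"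
    consider "k = i" "l = Suc i" | "k = i" "l > Suc i" | "k = Suc i" "l > Suc i"
      | "k < i" "l = i" | "k < i" "l = Suc i" | "k \<notin> {i, Suc i}" "l \<notin> {i, Suc i}"
      using kl(3) by force
    then show "exc_pair ((a(i := x, Suc i := a i)) k) ((b(i := y, Suc i := b i)) k)
      ((a(i := x, Suc i := a i)) l) ((b(i := y, Suc i := b i)) l)"
    proof cases
      case 2
      then show ?thesis using xy(6) P[OF ii(1) kl(2)] P[OF ii(2) kl(2)] B[OF kl(2)] by auto
    next
      case 4
      then show ?thesis using xy(5) P[OF kl(1) ii(1)] P[OF kl(1) ii(2)] B[OF kl(1)] by auto
    qed (use xy kl P ii in auto)
  qed
  then show thesis by (rule that)
qed

text \<open>The label \<open>0\<close> is a virtual root joining the components of the forest; its interval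
  sticks out by one point on the right, which keeps all pairs exceptional.\<close>

locale interval_tree =
  fixes n :: nat and a b :: "nat \<Rightarrow> nat"
  assumes bounds: "i \<le> n \<Longrightarrow> 1 \<le> a i \<and> a i \<le> b i \<and> b i \<le> Suc n"
    and pairs: "\<lbrakk>i < j; j \<le> n\<rbrakk> \<Longrightarrow> exc_pair (a i) (b i) (a j) (b j)"
    and root: "a 0 = 1" "b 0 = Suc n"
begin

text \<open>Weak inequalities between distinct labels: that equal intervals cannot occur is a
  consequence of \<open>pairs\<close>, not part of the definition.\<close>

definition sub :: "nat \<Rightarrow> nat \<Rightarrow> bool" where
  "sub i j \<longleftrightarrow> i \<le> n \<and> j \<le> n \<and> i \<noteq> j \<and> a j \<le> a i \<and> b i \<le> b j"

definition child :: "nat \<Rightarrow> nat \<Rightarrow> bool" where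
  "child c p \<longleftrightarrow> sub c p \<and> \<not> (\<exists>m. sub c m \<and> sub m p)"

section \<open>Laminarity and the inclusion tree\<close>

lemma either_pair:
  assumes "i \<le> n" "j \<le> n" "i \<noteq> j"
  obtains "i < j" "exc_pair (a i) (b i) (a j) (b j)" | "j < i" "exc_pair (a j) (b j) (a i) (b i)"
  using assms pairs by (metis linorder_neqE_nat)

text \<open>An interval module surjects onto every shorter one with the same left end, so the longer
  one must come first.\<close>

lemma same_left: "\<lbrakk>sub i j; a i = a j\<rbrakk> \<Longrightarrow> j < i"
  unfolding sub_def using bounds[of i] bounds[of j]
  by (auto elim!: either_pair[of i j] simp: exc_pair_def)

text \<open>A shorter interval with the same right end is a submodule of the longer one, so it must
  come first.\<close>

lemma same_right: "\<lbrakk>sub i j; b i = b j\<rbrakk> \<Longrightarrow> i < j"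
  unfolding sub_def using bounds[of i] bounds[of j]
  by (auto elim!: either_pair[of i j] simp: exc_pair_def)

text \<open>The left one of two abutting intervals has a nonsplit extension by the right one, so it
  must come first.\<close>

lemma adjacent: "\<lbrakk>i \<le> n; j \<le> n; Suc (b i) = a j\<rbrakk> \<Longrightarrow> i < j"
  using bounds[of i] bounds[of j]
  by (cases "i = j") (auto elim!: either_pair[of i j] simp: exc_pair_def)

lemma sub_antisym: "sub i j \<Longrightarrow> \<not> sub j i"
  using same_left[of i j] same_left[of j i] by (auto simp: sub_def)

lemma sub_trans: "\<lbrakk>sub i j; sub j k\<rbrakk> \<Longrightarrow> sub i k"
  using sub_antisym[of i j] unfolding sub_def by auto

text \<open>Properly overlapping intervals are impossible: one order of the labels violates the Hom
  condition, the other the Ext condition.\<close>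

lemma laminar:
  assumes "i \<le> n" "j \<le> n"
  obtains "i = j" | "sub i j" | "sub j i" | "b i < a j" | "b j < a i"
proof (cases "i = j")
  case False
  have "sub i j \<or> sub j i \<or> b i < a j \<or> b j < a i"
    using False assms(1,2) bounds[OF assms(1)] bounds[OF assms(2)]
    by (cases rule: either_pair[OF assms(1,2) False]) (auto simp: exc_pair_def sub_def)
  then show ?thesis using that by blast
qed

lemma sub_size: "sub i j \<Longrightarrow> b i - a i < b j - a j"
  using sub_antisym[of i j] bounds[of i] bounds[of j] unfolding sub_def by auto

lemma sub_root: "\<lbrakk>i \<le> n; i \<noteq> 0\<rbrakk> \<Longrightarrow> sub i 0"
  using bounds[of i] root by (auto simp: sub_def)

lemma child_above:
  assumes "sub i p"
  obtains c where "child c p" "c = i \<or> sub i c"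
  using assms
proof (induction "b p - a p - (b i - a i)" arbitrary: i thesis rule: less_induct)
  case less
  show ?case
  proof (cases "child i p")
    case False
    then obtain m where m: "sub i m" "sub m p" using less.prems(2) by (auto simp: child_def)
    have "b p - a p - (b m - a m) < b p - a p - (b i - a i)"
      using sub_size[OF m(1)] sub_size[OF m(2)] by linarith
    from less.hyps[OF this _ m(2)] obtain c where "child c p" "c = m \<or> sub m c" by blast
    then show ?thesis using less.prems(1) m(1) sub_trans by blast
  qed (use less.prems in blast)
qed

lemma parent_exists:
  assumes "sub i j"
  obtains p where "child i p"
  using assms
proof (induction "b j - a j" arbitrary: j thesis rule: less_induct)
  case less
  show ?case
  proof (cases "child i j")
    case False
    then obtain m where "sub i m" "sub m j" using less.prems(2) by (auto simp: child_def)
    then show ?thesis using less.hyps[of m] less.prems(1) sub_size[of m j] by blast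
  qed (use less.prems in blast)
qed

lemma children_disjoint:
  assumes "child c p" "child d p" "c \<noteq> d"
  shows "b c < a d \<or> b d < a c"
proof -
  have "c \<le> n" "d \<le> n" using assms by (auto simp: child_def sub_def)
  then show ?thesis using assms by (cases rule: laminar) (auto simp: child_def)
qed

section \<open>Own points: a bijection between labels and points\<close>

text \<open>Otherwise the maximal proper subintervals would tile the interval of \<open>i\<close>; adjacency makes
  their labels increase from a value above \<open>i\<close> (at the left end) to one below \<open>i\<close>.\<close>

lemma own_exists:
  assumes i: "i \<le> n"
  shows "\<exists>x. a i \<le> x \<and> x \<le> b i \<and> (\<forall>m. sub m i \<longrightarrow> \<not> (a m \<le> x \<and> x \<le> b m))"
proof (rule ccontr)
  assume neg: "\<not> ?thesis"
  have cov: "\<exists>m. child m i \<and> a m \<le> x \<and> x \<le> b m" if x: "a i \<le> x" "x \<le> b i" for x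
  proof -
    obtain m where m: "sub m i" "a m \<le> x" "x \<le> b m" using neg x by blast
    obtain c where "child c i" "c = m \<or> sub m c" using child_above[OF m(1)] by blast
    then show ?thesis using m unfolding sub_def by force
  qed
  have right: "\<exists>m. child m i \<and> a m \<le> x \<and> x \<le> b m \<and> i < m" if "a i \<le> x" "x \<le> b i" for x
    using that
  proof (induction x rule: dec_induct)
    case base
    then obtain m where m: "child m i" "a m \<le> a i" "a i \<le> b m" using cov[of "a i"] by auto
    then have "sub m i" "a m = a i" by (auto simp: child_def sub_def)
    then show ?case using m same_left by auto
  next
    case (step x)
    then obtain m where m: "child m i" "a m \<le> x" "x \<le> b m" "i < m" by auto
    show ?case
    proof (cases "Suc x \<le> b m")
      case False
      obtain m' where m': "child m' i" "a m' \<le> Suc x" "Suc x \<le> b m'" using cov[of "Suc x"] step by auto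
      have "m \<noteq> m'" using False m'(3) by auto
      then have "b m < a m'" using children_disjoint[OF m(1) m'(1)] m m' False by linarith
      then have "Suc (b m) = a m'" using m m' by linarith
      then have "m < m'" using adjacent m m' by (auto simp: child_def sub_def)
      then show ?thesis using m' m(4) by (meson less_trans)
    qed (use m in \<open>auto intro!: exI[of _ m]\<close>)
  qed
  obtain m where m: "child m i" "a m \<le> b i" "b i \<le> b m" "i < m" using right[of "b i"] bounds[OF i] by auto
  then have "sub m i" "b m = b i" by (auto simp: child_def sub_def)
  then show False using same_right[of m i] m by auto
qed

text \<open>The choice turns out to be forced, since the own points exhaust all n + 1
  points.\<close>

definition own :: "nat \<Rightarrow> nat" where
  "own i = (SOME x. a i \<le> x \<and> x \<le> b i \<and> (\<forall>m. sub m i \<longrightarrow> \<not> (a m \<le> x \<and> x \<le> b m)))"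

lemma own:
  assumes "i \<le> n"
  shows "a i \<le> own i" "own i \<le> b i" "sub m i \<Longrightarrow> \<not> (a m \<le> own i \<and> own i \<le> b m)"
  using someI_ex[OF own_exists[OF assms], folded own_def] by auto

lemma own_in_sub:
  assumes "i \<le> n" "m \<le> n" "a i \<le> own m" "own m \<le> b i" "m \<noteq> i"
  shows "sub m i"
  using assms own[OF assms(2)] by (cases rule: laminar[OF assms(1,2)]) auto

text \<open>Two labels with a common own point would each lie below the other.\<close>

lemma own_inj: "inj_on own {..n}"
proof (rule inj_onI)
  fix i j assume ij: "i \<in> {..n}" "j \<in> {..n}" "own i = own j"
  then show "i = j"
    using own_in_sub[of i j] own_in_sub[of j i] own[of i] own[of j] sub_antisym by auto
qed

text \<open>Pigeonhole: n + 1 labels and n + 1 points.\<close>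

lemma own_bij: "bij_betw own {..n} {1..Suc n}"
proof -
  have "own ` {..n} \<subseteq> {1..Suc n}" using own bounds by fastforce
  moreover have "card (own ` {..n}) = Suc n" using card_image[OF own_inj] by simp
  ultimately have "own ` {..n} = {1..Suc n}" by (intro card_subset_eq) auto
  then show ?thesis using own_inj by (simp add: bij_betw_def)
qed

lemma own_surj:
  assumes "1 \<le> x" "x \<le> Suc n"
  obtains m where "m \<le> n" "own m = x"
  using own_bij assms unfolding bij_betw_def by (metis atLeastAtMost_iff atMost_iff imageE)

lemma own_root: "own 0 = Suc n" if "\<And>i. \<lbrakk>i \<noteq> 0; i \<le> n\<rbrakk> \<Longrightarrow> b i \<le> n"
proof -
  obtain m where "m \<le> n" "own m = Suc n" using own_surj[of "Suc n"] by auto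
  then show ?thesis using that[of m] own(2)[of m] by (cases "m = 0") auto
qed

text \<open>The point is the own point of some label below \<open>p\<close>, and the child of
  \<open>p\<close> above that label contains it.\<close>

lemma cover:
  assumes p: "p \<le> n" and x: "a p \<le> x" "x \<le> b p" "x \<noteq> own p"
  obtains c where "child c p" "a c \<le> x" "x \<le> b c"
proof -
  have "1 \<le> x" "x \<le> Suc n" using x bounds[OF p] by linarith+
  then obtain m where m: "m \<le> n" "own m = x" by (rule own_surj)
  then have "m \<noteq> p" using x by auto
  have "sub m p" by (rule own_in_sub) (use p m x \<open>m \<noteq> p\<close> in auto)
  then obtain c where c: "child c p" "c = m \<or> sub m c" by (rule child_above)
  have "a c \<le> x" "x \<le> b c" using c(2) m own(1,2)[OF m(1)] unfolding sub_def by auto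
  then show thesis using that c(1) by blast
qed

text \<open>\<open>own\<close> matches the subtree of \<open>p\<close> with the points of its
  interval. Hence the tree alone determines the length of every interval.\<close>

lemma card_sub:
  assumes p: "p \<le> n"
  shows "card {m. m = p \<or> sub m p} = Suc (b p) - a p"
proof -
  have "own ` {m. m = p \<or> sub m p} = {a p..b p}"
  proof (intro equalityI subsetI)
    fix x assume "x \<in> own ` {m. m = p \<or> sub m p}"
    then obtain m where m: "x = own m" "m = p \<or> sub m p" by blast
    then have "m \<le> n" using p by (auto simp: sub_def)
    then show "x \<in> {a p..b p}" using own(1,2)[of m] m unfolding sub_def by auto
  next
    fix x assume x: "x \<in> {a p..b p}"
    then have "1 \<le> x" "x \<le> Suc n" using bounds[OF p] by auto
    then obtain m where "m \<le> n" "own m = x" by (rule own_surj)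
    then show "x \<in> own ` {m. m = p \<or> sub m p}" using own_in_sub[OF p, of m] x by auto
  qed
  moreover have "inj_on own {m. m = p \<or> sub m p}"
    by (rule inj_on_subset[OF own_inj]) (use p in \<open>auto simp: sub_def\<close>)
  ultimately show ?thesis using card_image[of own "{m. m = p \<or> sub m p}"] by simp
qed

section \<open>Siblings: labels against positions\<close>

lemma child_sub: "child c p \<Longrightarrow> sub c p"
  by (simp add: child_def)

lemma childD:
  assumes "child c p"
  shows "c \<le> n" "p \<le> n" "c \<noteq> p" "a p \<le> a c" "b c \<le> b p" "a c \<le> b c"
  using assms bounds[of c] unfolding child_def sub_def by auto

lemma child_own: "child c p \<Longrightarrow> b c < own p \<or> own p < a c"
  using own(3)[of p c] by (meson child_sub childD(2) not_le)

text \<open>Siblings on the same side of the own point leave no gap between them, because every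
  other point of \<open>p\<close> is covered by a child; so \<open>adjacent\<close> applies from one
  to the next.\<close>

lemma ascending:
  assumes c: "child c p" and d: "child d p" and cd: "b c < a d"
    and own: "own p < a c \<or> b d < own p"
  shows "c < d"
  using c cd own
proof (induction "a d - b c" arbitrary: c rule: less_induct)
  case less
  have p: "p \<le> n" by (rule childD(2)[OF d])
  have "Suc (b c) \<noteq> own p" using less.prems d childD(6)[OF less.prems(1)] childD(6)[OF d] by auto
  moreover have "a p \<le> Suc (b c)" "Suc (b c) \<le> b p"
    using childD[OF d] childD[OF less.prems(1)] less.prems(2) by linarith+
  ultimately obtain e where e: "child e p" "a e \<le> Suc (b c)" "Suc (b c) \<le> b e"
    using cover[OF p] by blast
  have ce: "Suc (b c) = a e"
    using children_disjoint[OF less.prems(1) e(1)] childD(6)[OF less.prems(1)] e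
    by (cases "c = e") auto
  have "c < e" using adjacent[OF childD(1)[OF less.prems(1)] childD(1)[OF e(1)] ce] .
  show ?case
  proof (cases "e = d")
    case False
    have "b e < a d" using children_disjoint[OF e(1) d False] less.prems ce childD(6)[OF d] by linarith
    then have "e < d"
      by (intro less.hyps) (use e ce less.prems childD(6)[OF less.prems(1)] in auto)
    then show ?thesis using \<open>c < e\<close> by simp
  qed (use \<open>c < e\<close> in simp)
qed

text \<open>The last child on this side shares its right end with \<open>p\<close>, so its label is
  below \<open>p\<close> by \<open>same_right\<close>; the labels of the siblings between the own
  point and it are even smaller.\<close>

lemma right_child:
  assumes c: "child c p" and own: "own p < a c"
  shows "c < p"
proof -
  have p: "p \<le> n" by (rule childD(2)[OF c])
  have "own p \<noteq> b p" using childD[OF c] own by auto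
  then obtain d where d: "child d p" "a d \<le> b p" "b p \<le> b d"
    using cover[OF p, of "b p"] bounds[OF p] by auto
  then have "d < p" using same_right[OF child_sub[OF d(1)]] childD[OF d(1)] by auto
  show ?thesis
  proof (cases "c = d")
    case False
    then have "b c < a d" using children_disjoint[OF c d(1)] childD[OF c] d by linarith
    then show ?thesis using ascending[OF c d(1)] own \<open>d < p\<close> by (meson less_trans)
  qed (use \<open>d < p\<close> in simp)
qed

lemma left_child:
  assumes c: "child c p" and own: "b c < own p"
  shows "p < c"
proof -
  have p: "p \<le> n" by (rule childD(2)[OF c])
  have "own p \<noteq> a p" using childD[OF c] own by auto
  then obtain d where d: "child d p" "a d \<le> a p" "a p \<le> b d"
    using cover[OF p, of "a p"] bounds[OF p] by auto
  then have "p < d" using same_left[OF child_sub[OF d(1)]] childD[OF d(1)] by auto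
  show ?thesis
  proof (cases "c = d")
    case False
    then have "b d < a c" using children_disjoint[OF c d(1)] childD[OF c] d by linarith
    then show ?thesis using ascending[OF d(1) c] own \<open>p < d\<close> by (meson less_trans)
  qed (use \<open>p < d\<close> in simp)
qed

lemma child_gt: "child c p \<Longrightarrow> p < c \<longleftrightarrow> b c < own p"
  using left_child right_child child_own by (meson less_asym)

lemma child_lt: "child c p \<Longrightarrow> c < p \<longleftrightarrow> own p < a c"
  using left_child right_child child_own by (meson less_asym)

text \<open>Recursion step for recovering intervals from the tree: \<open>Max C\<close> is the left
  neighbour of \<open>v\<close>, and a child without one starts where \<open>p\<close> does.\<close>

lemma left_end_child:
  assumes v: "child v p" and pv: "p < v"
  defines "C \<equiv> {c. child c p \<and> p < c \<and> c < v}"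
  shows "a v = (if C = {} then a p else Suc (b (Max C)))"
proof -
  have p: "p \<le> n" by (rule childD(2)[OF v])
  have fin: "finite C" by (rule finite_subset[of _ "{..v}"]) (auto simp: C_def)
  have left: "b c < a v" if "c \<in> C" for c
    using that children_disjoint[of c p v] ascending[OF v, of c] child_gt[of c p] v
    unfolding C_def by auto
  have L: "\<exists>c\<in>C. Suc (b c) = a v" if "a v \<noteq> a p"
  proof -
    have ow: "b v < own p" using child_gt v pv by blast
    have "a v - 1 \<noteq> own p" "a p \<le> a v - 1" "a v - 1 \<le> b p" using ow childD[OF v] that by auto
    then obtain c where c: "child c p" "a c \<le> a v - 1" "a v - 1 \<le> b c" using cover[OF p] by blast
    have "1 \<le> a v" using bounds[OF childD(1)[OF v]] by simp
    then have "c \<noteq> v" using c by auto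
    then have bc: "Suc (b c) = a v"
      using children_disjoint[OF c(1) v] c \<open>1 \<le> a v\<close> childD[OF v] by linarith
    have "c < v" using adjacent[OF _ _ bc] childD(1)[OF c(1)] childD(1)[OF v] by simp
    moreover have "p < c" using child_gt[OF c(1)] ow bc childD(6)[OF v] by simp
    ultimately show ?thesis using c bc by (auto simp: C_def)
  qed
  show ?thesis
  proof (cases "C = {}")
    case False
    then obtain d where "d \<in> C" by auto
    then have "a v \<noteq> a p" using left[of d] childD[of d p] by (auto simp: C_def)
    then obtain c where c: "c \<in> C" "Suc (b c) = a v" using L by auto
    have "Max C = c"
    proof (rule Max_eqI[OF fin _ c(1)])
      fix e assume e: "e \<in> C"
      show "e \<le> c"
      proof (rule ccontr)
        assume "\<not> e \<le> c"
        moreover have "b e \<le> b c" using left[OF e] c by simp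
        ultimately have "b e < a c" using children_disjoint[of e p c] e c childD[of e p] unfolding C_def
          by auto
        then have "e < c" using ascending[of e p c] e c child_gt[of c p] unfolding C_def by auto
        then show False using \<open>\<not> e \<le> c\<close> by simp
      qed
    qed
    then show ?thesis using c False by simp
  next
    case True
    have "a v = a p"
    proof (rule ccontr)
      assume "a v \<noteq> a p"
      from L[OF this] obtain c where "c \<in> C" by auto
      then show False using True by simp
    qed
    then show ?thesis using True by simp
  qed
qed

text \<open>Mirror image beyond the own point: the recursion is anchored at the right end of
  \<open>p\<close>, and \<open>Min C\<close> is the right neighbour.\<close>

lemma right_end_child:
  assumes v: "child v p" and pv: "v < p"
  defines "C \<equiv> {c. child c p \<and> v < c \<and> c < p}"
  shows "Suc (b v) = (if C = {} then Suc (b p) else a (Min C))"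
proof -
  have p: "p \<le> n" by (rule childD(2)[OF v])
  have fin: "finite C" by (rule finite_subset[of _ "{..p}"]) (auto simp: C_def)
  have right: "b v < a c" if "c \<in> C" for c
    using that children_disjoint[of c p v] ascending[of c p v] child_lt[of c p] v
    unfolding C_def by (metis (no_types, lifting) mem_Collect_eq less_asym)
  have L: "\<exists>c\<in>C. Suc (b v) = a c" if "b v \<noteq> b p"
  proof -
    have ow: "own p < a v" using child_lt v pv by blast
    have "Suc (b v) \<noteq> own p" "a p \<le> Suc (b v)" "Suc (b v) \<le> b p" using ow childD[OF v] that by auto
    then obtain c where c: "child c p" "a c \<le> Suc (b v)" "Suc (b v) \<le> b c" using cover[OF p] by blast
    then have "c \<noteq> v" by auto
    then have bc: "Suc (b v) = a c"
      using children_disjoint[OF c(1) v] c childD[OF v] by linarith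
    have "v < c" using adjacent[OF _ _ bc] childD(1)[OF c(1)] childD(1)[OF v] by simp
    moreover have "c < p" using child_lt[OF c(1)] ow bc childD(6)[OF v] by simp
    ultimately show ?thesis using c bc by (auto simp: C_def)
  qed
  show ?thesis
  proof (cases "C = {}")
    case False
    then obtain d where "d \<in> C" by auto
    then have "b v \<noteq> b p" using right[of d] childD[of d p] by (auto simp: C_def)
    then obtain c where c: "c \<in> C" "Suc (b v) = a c" using L by auto
    have "Min C = c"
    proof (rule Min_eqI[OF fin _ c(1)])
      fix e assume e: "e \<in> C"
      show "c \<le> e"
      proof (rule ccontr)
        assume "\<not> c \<le> e"
        moreover have "a c \<le> a e" using right[OF e] c by simp
        ultimately have "b c < a e" using children_disjoint[of e p c] e c childD[of e p] unfolding C_def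
          by auto
        then have "c < e" using ascending[of c p e] e c child_lt[of c p] unfolding C_def by auto
        then show False using \<open>\<not> c \<le> e\<close> by simp
      qed
    qed
    then show ?thesis using c False by simp
  next
    case True
    have "b v = b p"
    proof (rule ccontr)
      assume "b v \<noteq> b p"
      from L[OF this] obtain c where "c \<in> C" by auto
      then show False using True by simp
    qed
    then show ?thesis using True by simp
  qed
qed

lemma sub_tranclp: "sub i j \<longleftrightarrow> child\<^sup>+\<^sup>+ i j"
proof
  show "child\<^sup>+\<^sup>+ i j \<Longrightarrow> sub i j"
    by (induction rule: tranclp_induct) (auto intro: child_sub sub_trans)
  show "sub i j \<Longrightarrow> child\<^sup>+\<^sup>+ i j"
  proof (induction "b j - a j" arbitrary: j rule: less_induct)
    case less
    then obtain c where c: "child c j" "c = i \<or> sub i c" using child_above by blast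
    then show ?case using less.hyps[OF sub_size[OF child_sub[OF c(1)]]] by (meson tranclp.simps)
  qed
qed

text \<open>The step down in \<open>projective_vertices\<close> thus selects the child that shares
  the right end of its parent.\<close>

lemma Max_left_of_own:
  assumes d: "child d p" "b d = b p"
  shows "Max {w. child w p \<and> w < p} = d" "d < p"
proof -
  show dp: "d < p" using same_right[OF child_sub] d by blast
  have le: "w \<le> d" if w: "child w p" "w < p" for w
  proof (cases "w = d")
    case False
    then have "b w < a d" using children_disjoint[OF w(1) d(1)] childD[OF w(1)] d(2) by linarith
    then show ?thesis using ascending[OF w(1) d(1)] child_lt[OF w(1)] w(2) by simp
  qed simp
  show "Max {w. child w p \<and> w < p} = d"
    by (rule Max_eqI) (use le d(1) dp in auto)
qed

text \<open>The corresponding fact for \<open>injective_vertices\<close>, with left ends.\<close>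

lemma Min_right_of_own:
  assumes d: "child d p" "a d = a p"
  shows "Min {w. child w p \<and> p < w} = d" "p < d"
proof -
  show dp: "p < d" using same_left[OF child_sub] d by blast
  have ge: "d \<le> w" if w: "child w p" "p < w" for w
  proof (cases "w = d")
    case False
    then have "b d < a w" using children_disjoint[OF w(1) d(1)] childD[OF w(1)] d(2) by linarith
    then show ?thesis using ascending[OF d(1) w(1)] child_gt[OF w(1)] w(2) by simp
  qed simp
  have "finite {w. child w p \<and> p < w}"
    by (rule finite_subset[of _ "{..n}"]) (auto dest: childD(1))
  then show "Min {w. child w p \<and> p < w} = d"
    by (rule Min_eqI) (use ge d(1) dp in auto)
qed

lemma right_end_covered:
  assumes "child w p" "w < p"
  obtains d where "child d p" "b d = b p"
proof -
  have p: "p \<le> n" using childD(2)[OF assms(1)] .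
  have "own p < a w" using child_lt assms by blast
  then have "b p \<noteq> own p" using childD[OF assms(1)] by linarith
  then obtain d where "child d p" "b p \<le> b d" using cover[OF p, of "b p"] bounds[OF p] by blast
  then show thesis using that childD(5) by (metis le_antisym)
qed

lemma left_end_covered:
  assumes "child w p" "p < w"
  obtains d where "child d p" "a d = a p"
proof -
  have p: "p \<le> n" using childD(2)[OF assms(1)] .
  have "b w < own p" using child_gt assms by blast
  then have "a p \<noteq> own p" using childD[OF assms(1)] by linarith
  then obtain d where "child d p" "a d \<le> a p" using cover[OF p, of "a p"] bounds[OF p] by blast
  then show thesis using that childD(4) by (metis le_antisym)
qed

end

text \<open>Lengths are subtree sizes, so one end of each interval suffices. Below a known parent,
  the left end of a child with larger label and the right end of one with smaller label follow from
  the neighbour towards the outer end of the parent.\<close>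

lemma interval_tree_unique:
  assumes T: "interval_tree n a b" and T': "interval_tree n a' b'"
    and sub: "\<And>i j. interval_tree.sub n a b i j \<longleftrightarrow> interval_tree.sub n a' b' i j"
    and v: "v \<le> n"
  shows "a v = a' v \<and> b v = b' v"
proof -
  interpret T: interval_tree n a b by (rule T)
  interpret T': interval_tree n a' b' by (rule T')
  have child: "T'.child = T.child" using sub by (intro ext) (simp add: T.child_def T'.child_def)
  have size: "Suc (b v) - a v = Suc (b' v) - a' v" if "v \<le> n" for v
    using T.card_sub[OF that] T'.card_sub[OF that] sub by simp
  have sizeD: "a v = a' v \<longleftrightarrow> b v = b' v" if "v \<le> n" for v
    using size[OF that] T.bounds[OF that] T'.bounds[OF that] by linarith
  have gt: "a v = a' v" if p: "a p = a' p" "b p = b' p" and "T.child v p" "p < v" for v p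
    using that(3,4)
  proof (induction v rule: less_induct)
    case (less v)
    let ?C = "{c. T.child c p \<and> p < c \<and> c < v}"
    have "b (Max ?C) = b' (Max ?C)" if "?C \<noteq> {}"
    proof -
      have "finite ?C" by (rule finite_subset[of _ "{..v}"]) auto
      then have "Max ?C \<in> ?C" using that by (rule Max_in)
      then have "a (Max ?C) = a' (Max ?C)" "Max ?C \<le> n" using less.IH[of "Max ?C"] T.childD(1) by blast+
      then show ?thesis using sizeD by simp
    qed
    then show ?case
      using T.left_end_child[OF less.prems] T'.left_end_child[of v p, unfolded child, OF less.prems] p
      by (cases "?C = {}") (simp_all only: if_True if_False simp_thms)
  qed
  have lt: "b v = b' v" if p: "a p = a' p" "b p = b' p" and "T.child v p" "v < p" for v p
    using that(3,4)
  proof (induction "p - v" arbitrary: v rule: less_induct)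
    case less
    let ?C = "{c. T.child c p \<and> v < c \<and> c < p}"
    have "a (Min ?C) = a' (Min ?C)" if "?C \<noteq> {}"
    proof -
      have "finite ?C" by (rule finite_subset[of _ "{..p}"]) auto
      then have "Min ?C \<in> ?C" using that by (rule Min_in)
      then have "Min ?C \<le> n" "b (Min ?C) = b' (Min ?C)"
        using less.hyps[of "Min ?C"] less.prems T.childD(1) by auto
      then show ?thesis using sizeD by simp
    qed
    then have "Suc (b v) = Suc (b' v)"
      using T.right_end_child[OF less.prems] T'.right_end_child[of v p, unfolded child, OF less.prems] p
      by (cases "?C = {}") (simp_all only: if_True if_False simp_thms)
    then show ?case by simp
  qed
  show ?thesis using v
  \<comment> \<open>Longer intervals come first, so a parent is settled before its children; the
    virtual root has measure 0.\<close>
  proof (induction "n - (b v - a v)" arbitrary: v rule: less_induct)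
    case less
    show ?case
    proof (cases "v = 0")
      case True
      then show ?thesis using T.root T'.root by simp
    next
      case False
      then obtain p where p: "T.child v p" using T.parent_exists T.sub_root less.prems by blast
      have pn: "p \<le> n" using p T.childD by simp
      have "n - (b p - a p) < n - (b v - a v)"
        using T.sub_size[OF T.child_sub[OF p]] T.bounds[OF pn] by linarith
      then have IH: "a p = a' p" "b p = b' p" using less.hyps pn by auto
      have "a v = a' v \<or> b v = b' v"
        using gt[OF IH p] lt[OF IH p] T.childD(3)[OF p] by linarith
      then show ?thesis using sizeD[OF less.prems] by simp
    qed
  qed
qed

section \<open>Intervals of a rooted labeled forest\<close>

definition interval_forest :: "nat \<Rightarrow> (nat \<Rightarrow> nat) \<Rightarrow> (nat \<Rightarrow> nat) \<Rightarrow> (nat \<times> nat) set" where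
  "interval_forest n a b = {(i, j). i \<in> {1..n} \<and> j \<in> {1..n} \<and> {a i..b i} \<subset> {a j..b j} \<and>
     \<not> (\<exists>k\<in>{1..n}. {a i..b i} \<subset> {a k..b k} \<and> {a k..b k} \<subset> {a j..b j})}"

text \<open>The intervals of a given forest: each vertex \<open>p\<close> contributes one point of its own, which
  separates its children with larger labels from those with smaller labels; on either side the
  labels increase from left to right.\<close>

locale labeled_forest =
  fixes n :: nat and F :: "(nat \<times> nat) set"
  assumes forest: "rooted_forest n F"
begin

definition tree :: "(nat \<times> nat) set" where
  "tree = F \<union> forest_roots n F \<times> {0}"

definition desc :: "nat \<Rightarrow> nat set" where
  "desc v = {w. (w, v) \<in> tree\<^sup>*}"

text \<open>Sort key for \<open>p\<close> and its children. Labels are at most n, so the values Suc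
  n and n + 2 + x put \<open>p\<close> after its larger children and before its smaller
  ones.\<close>

definition pos :: "nat \<Rightarrow> nat \<Rightarrow> nat" where
  "pos p x = (if p < x then x else if x = p then Suc n else n + 2 + x)"

definition before :: "nat \<Rightarrow> nat set" where
  "before v = {u. \<exists>p x. (v, p) \<in> tree \<and> (x = p \<or> (x, p) \<in> tree) \<and> pos p x < pos p v \<and>
     u \<in> (if x = p then {p} else desc x)}"

text \<open>The vertices whose own points precede the whole subtree of \<open>v\<close>, collected
  along the path to the root. Counting them turns vertices into points.\<close>

definition left_of :: "nat \<Rightarrow> nat set" where
  "left_of v = (\<Union>q\<in>{q. (v, q) \<in> tree\<^sup>*}. before q)"

definition lft :: "nat \<Rightarrow> nat" where
  "lft v = Suc (card (left_of v))"

definition rgt :: "nat \<Rightarrow> nat" where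
  "rgt v = card (left_of v \<union> desc v)"

lemma F_range: "(v, p) \<in> F \<Longrightarrow> v \<in> {1..n} \<and> p \<in> {1..n}"
  using forest unfolding rooted_forest_def by blast

lemma tree_range: "(v, p) \<in> tree \<Longrightarrow> v \<in> {1..n} \<and> p \<le> n"
  using F_range unfolding tree_def forest_roots_def by fastforce

lemma tree_unique: "\<lbrakk>(v, p) \<in> tree; (v, q) \<in> tree\<rbrakk> \<Longrightarrow> p = q"
  using forest unfolding tree_def forest_roots_def rooted_forest_def single_valued_def by blast

lemma tree_trancl: "(x, y) \<in> tree\<^sup>+ \<Longrightarrow> y \<noteq> 0 \<Longrightarrow> (x, y) \<in> F\<^sup>+"
proof (induction rule: trancl_induct)
  case (base y)
  then show ?case by (auto simp: tree_def)
next
  case (step y z)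
  then have "y \<noteq> 0" using tree_range by fastforce
  then show ?case using step by (auto simp: tree_def)
qed

lemma tree_acyclic: "(x, x) \<notin> tree\<^sup>+"
proof
  assume x: "(x, x) \<in> tree\<^sup>+"
  then obtain y where "(x, y) \<in> tree" by (meson tranclD)
  then have "x \<noteq> 0" using tree_range by fastforce
  then have "(x, x) \<in> F\<^sup>+" using tree_trancl x by blast
  then show False using forest by (simp add: rooted_forest_def acyclic_def)
qed

lemma to_root: "v \<le> n \<Longrightarrow> (v, 0) \<in> tree\<^sup>*"
proof -
  have "tree \<subseteq> {..n} \<times> {..n}" using tree_range by fastforce
  then have "finite tree" by (rule finite_subset) simp
  then have "wf (tree\<inverse>)" using tree_acyclic by (intro finite_acyclic_wf_converse) (auto simp: acyclic_def)
  then show "v \<le> n \<Longrightarrow> (v, 0) \<in> tree\<^sup>*"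
  proof (induction v rule: wf_induct_rule)
    case (less v)
    show ?case
    proof (cases "v = 0")
      case False
      then have "v \<in> Domain F \<or> (v, 0) \<in> tree" using less.prems by (auto simp: tree_def forest_roots_def)
      then obtain p where p: "(v, p) \<in> tree" by (auto simp: tree_def)
      then show ?thesis using less.IH[of p] tree_range[OF p] by (auto intro: converse_rtrancl_into_rtrancl)
    qed simp
  qed
qed

lemma ancestor_induct [consumes 1, case_names root step]:
  assumes "v \<le> n" "P 0" "\<And>v p. \<lbrakk>(v, p) \<in> tree; v \<le> n; p \<le> n; P p\<rbrakk> \<Longrightarrow> P v"
  shows "P v"
  using to_root[OF assms(1)]
  by (induction rule: converse_rtrancl_induct) (use assms(2,3) tree_range in force)+

lemma comparable: "\<lbrakk>(u, x) \<in> tree\<^sup>*; (u, y) \<in> tree\<^sup>*\<rbrakk> \<Longrightarrow> (x, y) \<in> tree\<^sup>* \<or> (y, x) \<in> tree\<^sup>*"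
proof (induction rule: converse_rtrancl_induct)
  case (step u v)
  show ?case
  proof (cases "u = y")
    case True
    then show ?thesis using step by (meson converse_rtrancl_into_rtrancl)
  next
    case False
    then obtain w where "(u, w) \<in> tree" "(w, y) \<in> tree\<^sup>*" using step.prems by (meson converse_rtranclE)
    then show ?thesis using step tree_unique by blast
  qed
qed simp

lemma child_ancestor: "\<lbrakk>(x, p) \<in> tree; (x, y) \<in> tree\<^sup>*; x \<noteq> y\<rbrakk> \<Longrightarrow> (p, y) \<in> tree\<^sup>*"
  by (metis converse_rtranclE tree_unique)

lemma sibling_desc_disjoint:
  assumes "(x, p) \<in> tree" "(y, p) \<in> tree" "x \<noteq> y"
  shows "desc x \<inter> desc y = {}"
proof -
  have *: "(x, y) \<notin> tree\<^sup>*" if "(x, p) \<in> tree" "(y, p) \<in> tree" "x \<noteq> y" for x y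
    using child_ancestor[OF that(1) _ that(3)] that(2) tree_acyclic by (meson rtrancl_into_trancl1)
  show ?thesis using *[OF assms] *[OF assms(2,1)] assms(3) comparable unfolding desc_def by blast
qed

lemma not_desc_child: "(v, p) \<in> tree \<Longrightarrow> p \<notin> desc v"
  using tree_acyclic unfolding desc_def by (meson mem_Collect_eq rtrancl_into_trancl1)

lemma desc_mono: "(v, p) \<in> tree\<^sup>* \<Longrightarrow> desc v \<subseteq> desc p"
  unfolding desc_def by (auto intro: rtrancl_trans)

lemma desc_refl: "v \<in> desc v"
  by (simp add: desc_def)

lemma left_of_step: "(v, p) \<in> tree \<Longrightarrow> left_of v = left_of p \<union> before v"
proof -
  assume v: "(v, p) \<in> tree"
  have "{q. (v, q) \<in> tree\<^sup>*} = insert v {q. (p, q) \<in> tree\<^sup>*}"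
    using v child_ancestor[OF v] by (auto intro: converse_rtrancl_into_rtrancl)
  then show ?thesis unfolding left_of_def by auto
qed

lemma left_of_root: "left_of 0 = {}"
proof -
  have "q = 0" if "(0, q) \<in> tree\<^sup>*" for q
    using that tree_range by (metis atLeastAtMost_iff converse_rtranclE not_one_le_zero)
  moreover have "before 0 = {}" unfolding before_def using tree_range by fastforce
  ultimately show ?thesis unfolding left_of_def by blast
qed

lemma beforeE:
  assumes "u \<in> before v" "(v, p) \<in> tree"
  obtains x where "x = p \<or> (x, p) \<in> tree" "pos p x < pos p v" "u \<in> (if x = p then {p} else desc x)"
proof -
  from assms(1) obtain q x where q: "(v, q) \<in> tree" "x = q \<or> (x, q) \<in> tree" "pos q x < pos q v"
    "u \<in> (if x = q then {q} else desc x)" unfolding before_def by blast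
  moreover have "q = p" using tree_unique[OF q(1) assms(2)] .
  ultimately show thesis using that by blast
qed

lemma before_subset:
  assumes "(v, p) \<in> tree"
  shows "before v \<subseteq> desc p"
proof
  fix u assume "u \<in> before v"
  then obtain x where x: "x = p \<or> (x, p) \<in> tree" "pos p x < pos p v" "u \<in> (if x = p then {p} else desc x)"
    by (rule beforeE[OF _ assms])
  then show "u \<in> desc p" using desc_mono[of x p] desc_refl by (auto split: if_splits)
qed

lemma before_desc_disjoint:
  assumes v: "(v, p) \<in> tree"
  shows "before v \<inter> desc v = {}"
proof -
  have False if u: "u \<in> before v" "u \<in> desc v" for u
  proof -
    obtain x where x: "x = p \<or> (x, p) \<in> tree" "pos p x < pos p v" "u \<in> (if x = p then {p} else desc x)"
      by (rule beforeE[OF u(1) v])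
    show False
    proof (cases "x = p")
      case True
      then show False using x u(2) not_desc_child[OF v] by simp
    next
      case False
      have "x \<noteq> v" using x(2) by blast
      then have "desc x \<inter> desc v = {}" using False x(1) v sibling_desc_disjoint by simp
      then show False using x(3) False u(2) by auto
    qed
  qed
  then show ?thesis by blast
qed

lemma left_desc_disjoint: "v \<le> n \<Longrightarrow> left_of v \<inter> desc v = {}"
proof (induction v rule: ancestor_induct)
  case (step v p)
  then show ?case using left_of_step before_desc_disjoint desc_mono[of v p] by blast
qed (simp add: left_of_root)

lemma desc_range: "v \<le> n \<Longrightarrow> desc v \<subseteq> {..n}"
  unfolding desc_def using tree_range by (auto elim: converse_rtranclE)

lemma left_range: "v \<le> n \<Longrightarrow> left_of v \<subseteq> {..n}"
proof (induction v rule: ancestor_induct)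
  case (step v p)
  then show ?case using left_of_step before_subset desc_range by blast
qed (simp add: left_of_root)

lemma fin: "v \<le> n \<Longrightarrow> finite (left_of v) \<and> finite (desc v)"
  using left_range desc_range finite_subset by (metis finite_atMost)

lemma lft_le_rgt: "v \<le> n \<Longrightarrow> lft v \<le> rgt v"
proof -
  assume v: "v \<le> n"
  have "left_of v \<subset> left_of v \<union> desc v" using left_desc_disjoint[OF v] desc_refl by blast
  then have "card (left_of v) < card (left_of v \<union> desc v)" using fin[OF v] by (intro psubset_card_mono) auto
  then show ?thesis by (simp add: lft_def rgt_def)
qed

lemma nested:
  assumes "(w, v) \<in> tree\<^sup>*" "v \<le> n"
  shows "lft v \<le> lft w \<and> rgt w \<le> rgt v"
  using assms
proof (induction rule: converse_rtrancl_induct)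
  case (step w p)
  have n: "w \<le> n" "p \<le> n" using tree_range[OF step(1)] by auto
  have "left_of p \<subseteq> left_of w" using left_of_step[OF step(1)] by auto
  moreover have "left_of w \<union> desc w \<subseteq> left_of p \<union> desc p"
    using left_of_step[OF step(1)] before_subset[OF step(1)] desc_mono[of w p] step(1) by auto
  ultimately have "lft p \<le> lft w \<and> rgt w \<le> rgt p"
    unfolding lft_def rgt_def using fin n by (auto intro!: card_mono)
  then show ?case using step by auto
qed simp

text \<open>The own point of \<open>p\<close> lies on the side of \<open>w\<close> dictated by the
  labels and makes the inequality of the ends on that side strict.\<close>

lemma nested_child:
  assumes w: "(w, p) \<in> tree"
  shows "w < p \<Longrightarrow> lft p < lft w" "p < w \<Longrightarrow> rgt w < rgt p"
proof -
  have n: "w \<le> n" "p \<le> n" "w \<ge> 1" using tree_range[OF w] by auto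
  have p: "p \<notin> left_of p" using left_desc_disjoint[OF n(2)] desc_refl by blast
  show "lft p < lft w" if "w < p"
  proof -
    have "p \<in> before w" unfolding before_def using w that by (auto simp: pos_def intro!: exI[of _ p])
    then have "left_of p \<subset> left_of w" using left_of_step[OF w] p by blast
    then show ?thesis unfolding lft_def using psubset_card_mono fin n by auto
  qed
  show "rgt w < rgt p" if "p < w"
  proof -
    have "p \<notin> before w"
    proof
      assume "p \<in> before w"
      then obtain x where x: "x = p \<or> (x, p) \<in> tree" "pos p x < pos p w" "p \<in> (if x = p then {p} else desc x)"
        by (rule beforeE[OF _ w])
      then have "x \<noteq> p" using that n by (auto simp: pos_def)
      then show False using x not_desc_child by auto
    qed
    then have "p \<notin> left_of w \<union> desc w" using left_of_step[OF w] p not_desc_child[OF w] by blast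
    moreover have "left_of w \<union> desc w \<subseteq> left_of p \<union> desc p"
      using left_of_step[OF w] before_subset[OF w] desc_mono[of w p] w by auto
    ultimately have "left_of w \<union> desc w \<subset> left_of p \<union> desc p" using desc_refl by blast
    then show ?thesis unfolding rgt_def using psubset_card_mono fin n by (metis finite_UnI)
  qed
qed

text \<open>If w < v, then w < p or p < v for every intermediate \<open>p\<close>, and one strict
  step suffices; dually for v < w.\<close>

lemma nested_strict:
  assumes "(w, v) \<in> tree\<^sup>+" "v \<le> n"
  shows "(w < v \<longrightarrow> lft v < lft w) \<and> (v < w \<longrightarrow> rgt w < rgt v)"
  using assms
proof (induction rule: converse_trancl_induct)
  case (base w)
  then show ?case using nested_child by blast
next
  case (step w p)
  have "lft v \<le> lft p \<and> rgt p \<le> rgt v" using nested step by (meson trancl_into_rtrancl)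
  moreover have "lft p \<le> lft w \<and> rgt w \<le> rgt p" using nested[of w p] step(1) tree_range by blast
  moreover have "p \<noteq> v" using step(2) tree_acyclic by blast
  moreover have "w \<noteq> p" using step(1) tree_acyclic by blast
  ultimately show ?case using step(3,4) nested_child[OF step(1)] by linarith
qed

text \<open>When the sibling placed later has the smaller label, the two lie on different sides of
  \<open>p\<close>, whose own point opens the gap of the second claim.\<close>

lemma siblings:
  assumes v: "(v, p) \<in> tree" and w: "(w, p) \<in> tree" and pos: "pos p v < pos p w"
  shows "rgt v < lft w" "w < v \<Longrightarrow> Suc (rgt v) < lft w"
proof -
  have n: "v \<in> {1..n}" "w \<in> {1..n}" "p \<le> n" using tree_range[OF v] tree_range[OF w] by auto
  have "before v \<subseteq> before w"
  proof
    fix u assume "u \<in> before v"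
    then obtain x where "x = p \<or> (x, p) \<in> tree" "pos p x < pos p v" "u \<in> (if x = p then {p} else desc x)"
      by (rule beforeE[OF _ v])
    then show "u \<in> before w" unfolding before_def using w pos less_trans by blast
  qed
  moreover have "desc v \<subseteq> before w"
  proof -
    have "v \<noteq> p" using v tree_acyclic by blast
    then show ?thesis using v w pos unfolding before_def by fastforce
  qed
  ultimately have sub: "left_of v \<union> desc v \<subseteq> left_of w"
    using left_of_step[OF v] left_of_step[OF w] by blast
  then show "rgt v < lft w" unfolding lft_def rgt_def using card_mono[OF _ sub] fin n by (simp add: less_Suc_eq_le)
  show "Suc (rgt v) < lft w" if "w < v"
  proof -
    have vp: "p < v" "w < p" using pos that n tree_acyclic v w by (auto simp: pos_def split: if_splits)
    have "p \<notin> before v"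
    proof
      assume "p \<in> before v"
      then obtain x where x: "x = p \<or> (x, p) \<in> tree" "pos p x < pos p v" "p \<in> (if x = p then {p} else desc x)"
        by (rule beforeE[OF _ v])
      then have "x \<noteq> p" using vp n by (auto simp: pos_def)
      then show False using x not_desc_child by auto
    qed
    moreover have "p \<notin> left_of p" using left_desc_disjoint[OF n(3)] desc_refl by blast
    ultimately have "p \<notin> left_of v \<union> desc v" using left_of_step[OF v] not_desc_child[OF v] by blast
    moreover have "p \<in> before w" unfolding before_def using w vp by (auto simp: pos_def intro!: exI[of _ p])
    ultimately have "left_of v \<union> desc v \<subset> left_of w" using sub left_of_step[OF w] by blast
    then show ?thesis unfolding lft_def rgt_def using psubset_card_mono fin n by auto
  qed
qed

lemma meet:
  assumes "i \<le> n" "j \<le> n" "(i, j) \<notin> tree\<^sup>*" "(j, i) \<notin> tree\<^sup>*"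
  obtains x y p where "(i, x) \<in> tree\<^sup>*" "(j, y) \<in> tree\<^sup>*" "(x, p) \<in> tree" "(y, p) \<in> tree" "x \<noteq> y"
proof -
  have "\<exists>x y p. (i, x) \<in> tree\<^sup>* \<and> (j, y) \<in> tree\<^sup>* \<and> (x, p) \<in> tree \<and> (y, p) \<in> tree \<and> x \<noteq> y"
    using assms
  proof (induction i rule: ancestor_induct)
    case root
    then show ?case using to_root by blast
  next
    case (step i p)
    show ?case
    proof (cases "(j, p) \<in> tree\<^sup>*")
      case True
      have "j \<noteq> p" using step by blast
      then obtain y where "(j, y) \<in> tree\<^sup>*" "(y, p) \<in> tree" using True by (meson rtranclE)
      then show ?thesis using step by blast
    next
      case False
      moreover have "(p, j) \<notin> tree\<^sup>*" using step by (meson converse_rtrancl_into_rtrancl)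
      ultimately show ?thesis using step by (meson converse_rtrancl_into_rtrancl)
    qed
  qed
  then show thesis using that by blast
qed

lemma trancl_cases:
  assumes "i \<le> n" "j \<le> n" "i \<noteq> j"
  obtains "(i, j) \<in> tree\<^sup>+" | "(j, i) \<in> tree\<^sup>+" |
    x y p where "(i, x) \<in> tree\<^sup>*" "(j, y) \<in> tree\<^sup>*" "(x, p) \<in> tree" "(y, p) \<in> tree" "pos p x < pos p y" |
    x y p where "(i, x) \<in> tree\<^sup>*" "(j, y) \<in> tree\<^sup>*" "(x, p) \<in> tree" "(y, p) \<in> tree" "pos p y < pos p x"
proof (cases "(i, j) \<in> tree\<^sup>* \<or> (j, i) \<in> tree\<^sup>*")
  case True
  then show ?thesis using assms(3) that(1,2) by (metis rtranclD)
next
  case False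
  then obtain x y p where xy: "(i, x) \<in> tree\<^sup>*" "(j, y) \<in> tree\<^sup>*" "(x, p) \<in> tree" "(y, p) \<in> tree" "x \<noteq> y"
    using meet[OF assms(1,2)] by blast
  then have "x \<noteq> p" "y \<noteq> p" using tree_acyclic by blast+
  then have "pos p x \<noteq> pos p y" using xy(5) tree_range[OF xy(3)] tree_range[OF xy(4)]
    by (auto simp: pos_def)
  then show ?thesis using that(3)[OF xy(1-4)] that(4)[OF xy(1-4)] by linarith
qed

lemma exc_pair_lft_rgt:
  assumes "i < j" "j \<le> n"
  shows "exc_pair (lft i) (rgt i) (lft j) (rgt j)"
proof -
  have n: "i \<le> n" "j \<le> n" "i \<noteq> j" using assms by auto
  note le = lft_le_rgt[OF n(1)] lft_le_rgt[OF n(2)]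
  from n show ?thesis
  proof (cases rule: trancl_cases)
    case 1
    then show ?thesis using nested_strict[OF 1] nested[OF trancl_into_rtrancl[OF 1]] assms le by (auto simp: exc_pair_def)
  next
    case 2
    then show ?thesis using nested_strict[OF 2] nested[OF trancl_into_rtrancl[OF 2]] assms le by (auto simp: exc_pair_def)
  next
    case (3 x y p)
    then have "rgt i \<le> rgt x" "rgt x < lft y" "lft y \<le> lft j"
      using nested siblings(1) tree_range[OF 3(3)] tree_range[OF 3(4)] by auto
    then show ?thesis using le by (auto simp: exc_pair_def)
  next
    case (4 x y p)
    have xy: "x \<le> n" "y \<le> n" using tree_range[OF 4(3)] tree_range[OF 4(4)] by auto
    have i: "lft x \<le> lft i" "i < x \<Longrightarrow> lft x < lft i"
      using nested[OF 4(1) xy(1)] nested_strict[of i x] 4(1) xy by (auto simp: rtrancl_eq_or_trancl)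
    have j: "rgt j \<le> rgt y" "y < j \<Longrightarrow> rgt j < rgt y"
      using nested[OF 4(2) xy(2)] nested_strict[of j y] 4(2) xy by (auto simp: rtrancl_eq_or_trancl)
    have "rgt y < lft x" "x < y \<Longrightarrow> Suc (rgt y) < lft x" using siblings[OF 4(4,3,5)] by auto
    note gap = this
    \<comment> \<open>The critical configuration: \<open>j\<close> lies to the left of
      \<open>i\<close> although i < j, so abutting would create a forbidden extension. Abutting
      forces j \<le> y \<le> x \<le> i, because any strict inequality the other way leaves a
      gap.\<close>
    have "Suc (rgt j) \<noteq> lft i"
    proof
      assume eq: "Suc (rgt j) = lft i"
      have "\<not> i < x" "\<not> y < j" "\<not> x < y" using eq gap i j by auto
      then show False using assms(1) 4(5) by simp
    qed
    then show ?thesis using gap(1) i(1) j(1) le by (auto simp: exc_pair_def)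
  qed
qed

lemma psubset_iff:
  assumes "i \<le> n" "j \<le> n"
  shows "{lft i..rgt i} \<subset> {lft j..rgt j} \<longleftrightarrow> (i, j) \<in> tree\<^sup>+"
proof (cases "i = j")
  case True
  then show ?thesis using tree_acyclic by auto
next
  case False
  note le = lft_le_rgt[OF assms(1)] lft_le_rgt[OF assms(2)]
  have iff: "{lft i..rgt i} \<subset> {lft j..rgt j} \<longleftrightarrow>
    lft j \<le> lft i \<and> rgt i \<le> rgt j \<and> (lft j < lft i \<or> rgt i < rgt j)"
    using le by (auto simp: psubset_eq)
  from assms False show ?thesis
  proof (cases rule: trancl_cases)
    case 1
    then show ?thesis unfolding iff using nested_strict[OF 1] nested[OF trancl_into_rtrancl[OF 1]] assms False
      by (auto simp: trancl_into_rtrancl)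
  next
    case 2
    then have "(i, j) \<notin> tree\<^sup>+" using tree_acyclic by (meson trancl_trans)
    then show ?thesis unfolding iff using nested_strict[OF 2] nested[OF trancl_into_rtrancl[OF 2]] 2 assms False
      by (auto simp: trancl_into_rtrancl)
  next
    case (3 x y p)
    then have *: "rgt i \<le> rgt x" "rgt x < lft y" "lft y \<le> lft j"
      using nested siblings(1) tree_range[OF 3(3)] tree_range[OF 3(4)] by auto
    then have "(i, j) \<notin> tree\<^sup>+" using nested[of i j] assms le by (fastforce dest: trancl_into_rtrancl)
    then show ?thesis unfolding iff using * le by auto
  next
    case (4 x y p)
    then have *: "rgt j \<le> rgt y" "rgt y < lft x" "lft x \<le> lft i"
      using nested siblings(1) tree_range[OF 4(3)] tree_range[OF 4(4)] by auto
    then have "(i, j) \<notin> tree\<^sup>+" using nested[of i j] assms le by (fastforce dest: trancl_into_rtrancl)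
    then show ?thesis unfolding iff using * le by auto
  qed
qed

lemma exc_intervals_lft_rgt: "exc_intervals n lft rgt"
  unfolding exc_intervals_def
proof (intro conjI ballI impI)
  fix i assume i: "i \<in> {1..n}"
  then show "1 \<le> lft i" "lft i \<le> rgt i" using lft_le_rgt by (auto simp: lft_def)
  \<comment> \<open>The virtual root owns a point to the right of all other vertices; this turns the
    bound n + 1 into n.\<close>
  have "(i, 0) \<in> tree\<^sup>+" using to_root[of i] i by (auto simp: rtrancl_eq_or_trancl)
  then have "rgt i < rgt 0" using nested_strict i by auto
  also have "rgt 0 \<le> card {..n}"
    unfolding rgt_def by (rule card_mono) (use desc_range[of 0] left_of_root in auto)
  finally show "rgt i \<le> n" by simp
qed (use exc_pair_lft_rgt in auto)

text \<open>With \<open>exc_intervals_lft_rgt\<close>, this is surjectivity of the passage from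
  exceptional sequences to rooted forests.\<close>

lemma interval_forest_lft_rgt: "interval_forest n lft rgt = F"
proof -
  have "(i, j) \<in> interval_forest n lft rgt \<longleftrightarrow> (i, j) \<in> F" for i j
  proof
    assume "(i, j) \<in> interval_forest n lft rgt"
    then have ij: "i \<in> {1..n}" "j \<in> {1..n}" "(i, j) \<in> tree\<^sup>+"
      and no: "\<And>k. \<lbrakk>k \<in> {1..n}; (i, k) \<in> tree\<^sup>+; (k, j) \<in> tree\<^sup>+\<rbrakk> \<Longrightarrow> False"
      using psubset_iff by (auto simp: interval_forest_def)
    obtain k where k: "(i, k) \<in> tree" "(k, j) \<in> tree\<^sup>*" using ij(3) by (meson tranclD)
    have "k = j"
    proof (rule ccontr)
      assume "k \<noteq> j"
      then have "(k, j) \<in> tree\<^sup>+" using k(2) by (simp add: rtrancl_eq_or_trancl)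
      moreover from this have "k \<in> {1..n}" using tree_range by (meson tranclD)
      ultimately show False using no k(1) by blast
    qed
    then show "(i, j) \<in> F" using k ij by (auto simp: tree_def)
  next
    assume ij: "(i, j) \<in> F"
    then have t: "(i, j) \<in> tree" "i \<in> {1..n}" "j \<in> {1..n}" using F_range by (auto simp: tree_def)
    have False if ik: "(i, k) \<in> tree\<^sup>+" "(k, j) \<in> tree\<^sup>+" for k
    proof -
      obtain l where "(i, l) \<in> tree" "(l, k) \<in> tree\<^sup>*" using tranclD[OF ik(1)] by blast
      then have "(j, k) \<in> tree\<^sup>*" using tree_unique t(1) by blast
      then show False using ik(2) tree_acyclic by (meson rtrancl_trancl_trancl)
    qed
    then show "(i, j) \<in> interval_forest n lft rgt"
      using t psubset_iff by (auto simp: interval_forest_def)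
  qed
  then show ?thesis by auto
qed

end

section \<open>The forest of a complete exceptional sequence of intervals\<close>

locale exceptional =
  fixes n :: nat and a b :: "nat \<Rightarrow> nat"
  assumes exc: "exc_intervals n a b"
begin

lemma interval: "i \<in> {1..n} \<Longrightarrow> 1 \<le> a i \<and> a i \<le> b i \<and> b i \<le> n"
  using exc unfolding exc_intervals_def by blast

lemma pair: "\<lbrakk>i \<in> {1..n}; j \<in> {1..n}; i < j\<rbrakk> \<Longrightarrow> exc_pair (a i) (b i) (a j) (b j)"
  using exc unfolding exc_intervals_def by blast

text \<open>Position 0 carries no meaning in a sequence and is free to hold the virtual
  root.\<close>

sublocale T: interval_tree n "a(0 := Suc 0)" "b(0 := Suc n)"
proof
  fix i assume "i \<le> n"
  then show "1 \<le> (a(0 := Suc 0)) i \<and> (a(0 := Suc 0)) i \<le> (b(0 := Suc n)) i \<and> (b(0 := Suc n)) i \<le> Suc n"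
    using interval[of i] by (cases "i = 0") auto
next
  fix i j assume ij: "i < j" "j \<le> n"
  then show "exc_pair ((a(0 := Suc 0)) i) ((b(0 := Suc n)) i) ((a(0 := Suc 0)) j) ((b(0 := Suc n)) j)"
    using pair[of i j] interval[of j] by (cases "i = 0") (auto simp: exc_pair_def)
qed auto

lemma sub_iff:
  assumes "i \<in> {1..n}" "j \<in> {1..n}"
  shows "T.sub i j \<longleftrightarrow> {a i..b i} \<subset> {a j..b j}"
  using interval[OF assms(1)] interval[OF assms(2)] T.same_left[of i j] T.same_right[of i j]
    T.same_left[of j i] T.same_right[of j i] assms
  by (auto simp: T.sub_def psubset_eq)

lemma sub_nonzero:
  assumes "T.sub i j"
  shows "i \<in> {1..n}"
proof -
  have "i \<le> n" "j \<le> n" "i \<noteq> j" using assms by (auto simp: T.sub_def)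
  moreover have "i \<noteq> 0"
  proof
    assume "i = 0"
    then have "T.sub j i" using T.sub_root[of j] \<open>j \<le> n\<close> \<open>i \<noteq> j\<close> by simp
    then show False using T.sub_antisym assms by blast
  qed
  ultimately show ?thesis by simp
qed

lemma forest_iff: "(c, p) \<in> interval_forest n a b \<longleftrightarrow> p \<noteq> 0 \<and> T.child c p"
proof (cases "p \<in> {1..n} \<and> c \<in> {1..n}")
  case True
  have "(\<exists>m. T.sub c m \<and> T.sub m p) \<longleftrightarrow> (\<exists>k\<in>{1..n}. {a c..b c} \<subset> {a k..b k} \<and> {a k..b k} \<subset> {a p..b p})"
    using sub_iff True sub_nonzero by metis
  then show ?thesis using True sub_iff by (auto simp: interval_forest_def T.child_def)
next
  case False
  then have "\<not> (p \<noteq> 0 \<and> T.child c p)" using sub_nonzero[OF T.child_sub] T.childD(2) by auto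
  then show ?thesis using False by (auto simp: interval_forest_def)
qed

lemma roots_iff: "c \<in> forest_roots n (interval_forest n a b) \<longleftrightarrow> T.child c 0"
proof
  assume c: "c \<in> forest_roots n (interval_forest n a b)"
  then have "T.sub c 0" by (intro T.sub_root) (auto simp: forest_roots_def)
  then obtain p where p: "T.child c p" by (rule T.parent_exists)
  then show "T.child c 0" using c forest_iff unfolding forest_roots_def by (cases "p = 0") auto
next
  assume c: "T.child c 0"
  have "False" if "(c, p) \<in> interval_forest n a b" for p
  proof -
    have p: "p \<noteq> 0" "T.child c p" using that forest_iff by auto
    then have "T.sub c p" "T.sub p 0" using T.child_sub T.sub_root T.childD(2) by auto
    then show False using c by (auto simp: T.child_def)
  qed
  then show "c \<in> forest_roots n (interval_forest n a b)"
    using sub_nonzero[OF T.child_sub[OF c]] unfolding forest_roots_def by blast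
qed

text \<open>Only the virtual root reaches n + 1. All of {1..n} is therefore left to its children,
  which is why the roots tile it.\<close>

lemma own_0: "T.own 0 = Suc n"
  by (rule T.own_root) (use interval in auto)

lemma child_0: "T.child c 0 \<Longrightarrow> 0 < c \<and> b c < Suc n"
  using sub_nonzero[OF T.child_sub] interval by fastforce

lemma root_cover:
  assumes "x \<in> {1..n}"
  obtains r where "T.child r 0" "a r \<le> x" "x \<le> b r"
proof -
  obtain r where r: "T.child r 0" "(a(0 := Suc 0)) r \<le> x" "x \<le> (b(0 := Suc n)) r"
    by (rule T.cover[of 0 x]) (use assms own_0 in auto)
  then show thesis using that[of r] child_0[OF r(1)] by simp
qed

lemma roots_disjoint:
  assumes "T.child r 0" "T.child s 0" "r \<noteq> s"
  shows "b r < a s \<or> b s < a r"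
  using T.children_disjoint[OF assms] child_0[OF assms(1)] child_0[OF assms(2)] by simp

lemma roots_ascending:
  assumes "T.child r 0" "T.child s 0" "b r < a s"
  shows "r < s"
  using T.ascending[OF assms(1,2)] child_0[OF assms(1)] child_0[OF assms(2)] assms(3) own_0 by simp

lemma roots_set: "forest_roots n (interval_forest n a b) = {r. T.child r 0}"
  using roots_iff by blast

text \<open>All roots lie left of the virtual own point, so their labels increase from left to right
  and the last tile has the largest one.\<close>

lemma Max_roots:
  assumes d: "T.child d 0" "b d = n"
  shows "Max {r. T.child r 0} = d"
proof (rule Max_eqI)
  show "finite {r. T.child r 0}"
    by (rule finite_subset[of _ "{..n}"]) (use T.childD(1) in blast)+
  fix r assume "r \<in> {r. T.child r 0}"
  then have r: "T.child r 0" by simp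
  then have "a r \<le> n" using interval sub_nonzero[OF T.child_sub[OF r]] by fastforce
  then show "r \<le> d"
    using roots_disjoint[OF r d(1)] roots_ascending[OF r d(1)] d(2) by fastforce
qed (use d in simp)

lemma Min_roots:
  assumes d: "T.child d 0" "a d = 1"
  shows "Min {r. T.child r 0} = d"
proof -
  have "{r. T.child r 0} = {r. T.child r 0 \<and> 0 < r}" using child_0 by blast
  then show ?thesis using T.Min_right_of_own(1)[OF d(1)] d(2) child_0[OF d(1)] by simp
qed

lemma children_eq: "p \<noteq> 0 \<Longrightarrow> forest_children (interval_forest n a b) p = {c. T.child c p}"
  using forest_iff by (auto simp: forest_children_def)

text \<open>[i, n] is the indecomposable projective at i. The recursion starts at the root ending in
  n and descends through children with the same right end; conversely, the parent of an interval
  ending in n ends in n too, unless it is virtual.\<close>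

lemma projective_eq: "projective_vertices n (interval_forest n a b) = {j \<in> {1..n}. b j = n}"
proof (intro equalityI subsetI)
  fix j assume "j \<in> projective_vertices n (interval_forest n a b)"
  then show "j \<in> {j \<in> {1..n}. b j = n}"
  proof (induction rule: projective_vertices.induct)
    case proj_root
    then have "n \<in> {1..n}" by (auto simp: forest_roots_def)
    then obtain r where r: "T.child r 0" "n \<le> b r" by (rule root_cover)
    then have "r \<in> {1..n}" "b r = n" using interval sub_nonzero[OF T.child_sub[OF r(1)]] by force+
    then show ?case using Max_roots[OF r(1)] roots_set by simp
  next
    case (proj_child v)
    then have v: "v \<noteq> 0" "b v = n" by auto
    obtain w where w: "T.child w v" "w < v" using proj_child children_eq[OF v(1)] by auto
    obtain d where d: "T.child d v" "(b(0 := Suc n)) d = (b(0 := Suc n)) v"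
      by (rule T.right_end_covered[OF w])
    then have "d \<in> {1..n}" "b d = n" using sub_nonzero[OF T.child_sub[OF d(1)]] v by auto
    then show ?case using T.Max_left_of_own(1)[OF d] children_eq[OF v(1)] by simp
  qed
next
  fix j assume "j \<in> {j \<in> {1..n}. b j = n}"
  then have "1 \<le> j" "j \<le> n" "b j = n" by auto
  then show "j \<in> projective_vertices n (interval_forest n a b)"
  proof (induction "n - (b j - a j)" arbitrary: j rule: less_induct)
    case less
    have "T.sub j 0" using less.prems by (intro T.sub_root) auto
    then obtain p where p: "T.child j p" by (rule T.parent_exists)
    show ?case
    proof (cases "p = 0")
      case True
      then have "Max (forest_roots n (interval_forest n a b)) = j" using Max_roots p less.prems roots_set by simp
      then show ?thesis using projective_vertices.proj_root[of n "interval_forest n a b"] roots_iff p True by auto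
    next
      case False
      have pn: "p \<in> {1..n}" using False T.childD(2)[OF p] by auto
      have bp: "b p = n" using T.childD(5)[OF p] less.prems False interval[OF pn] by auto
      have lt: "b j - a j < b p - a p" using T.sub_size[OF T.child_sub[OF p]] False less.prems by auto
      have "n - (b p - a p) < n - (b j - a j)" using lt interval[OF pn] by linarith
      then have IH: "p \<in> projective_vertices n (interval_forest n a b)"
        using less.hyps pn bp by simp
      have "(b(0 := Suc n)) j = (b(0 := Suc n)) p" using bp False less.prems by auto
      note M = T.Max_left_of_own[OF p this]
      have eq: "{w \<in> forest_children (interval_forest n a b) p. w < p} = {w. T.child w p \<and> w < p}"
        using children_eq[OF False] by auto
      have "Max {w \<in> forest_children (interval_forest n a b) p. w < p} \<in> projective_vertices n (interval_forest n a b)"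
        by (rule projective_vertices.proj_child[OF IH])
          (use M(2) p children_eq[OF False] in \<open>auto simp: fun_eq_iff\<close>)
      then show ?thesis using M(1) by (simp add: eq)
    qed
  qed
qed

text \<open>[1, i] is the indecomposable injective at i; the argument mirrors the projective
  one.\<close>

lemma injective_eq: "injective_vertices n (interval_forest n a b) = {j \<in> {1..n}. a j = 1}"
proof (intro equalityI subsetI)
  fix j assume "j \<in> injective_vertices n (interval_forest n a b)"
  then show "j \<in> {j \<in> {1..n}. a j = 1}"
  proof (induction rule: injective_vertices.induct)
    case inj_root
    then have "1 \<in> {1..n}" by (auto simp: forest_roots_def)
    then obtain r where r: "T.child r 0" "a r \<le> 1" by (rule root_cover)
    then have "r \<in> {1..n}" "a r = 1" using interval sub_nonzero[OF T.child_sub[OF r(1)]] by force+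
    then show ?case using Min_roots[OF r(1)] roots_set by simp
  next
    case (inj_child v)
    then have v: "v \<noteq> 0" "a v = 1" by auto
    obtain w where w: "T.child w v" "v < w" using inj_child children_eq[OF v(1)] by auto
    obtain d where d: "T.child d v" "(a(0 := Suc 0)) d = (a(0 := Suc 0)) v"
      by (rule T.left_end_covered[OF w])
    then have "d \<in> {1..n}" "a d = 1" using sub_nonzero[OF T.child_sub[OF d(1)]] v by auto
    then show ?case using T.Min_right_of_own(1)[OF d] children_eq[OF v(1)] by simp
  qed
next
  fix j assume "j \<in> {j \<in> {1..n}. a j = 1}"
  then have "1 \<le> j" "j \<le> n" "a j = 1" by auto
  then show "j \<in> injective_vertices n (interval_forest n a b)"
  proof (induction "n - (b j - a j)" arbitrary: j rule: less_induct)
    case less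
    have "T.sub j 0" using less.prems by (intro T.sub_root) auto
    then obtain p where p: "T.child j p" by (rule T.parent_exists)
    show ?case
    proof (cases "p = 0")
      case True
      then have "Min (forest_roots n (interval_forest n a b)) = j" using Min_roots p less.prems roots_set by simp
      then show ?thesis using injective_vertices.inj_root[of n "interval_forest n a b"] roots_iff p True by auto
    next
      case False
      have pn: "p \<in> {1..n}" using False T.childD(2)[OF p] by auto
      have ap: "a p = 1" using T.childD(4)[OF p] less.prems False interval[OF pn] by auto
      have lt: "b j - a j < b p - a p" using T.sub_size[OF T.child_sub[OF p]] False less.prems by auto
      have "n - (b p - a p) < n - (b j - a j)" using lt interval[OF pn] by linarith
      then have IH: "p \<in> injective_vertices n (interval_forest n a b)"
        using less.hyps pn ap by simp
      have "(a(0 := Suc 0)) j = (a(0 := Suc 0)) p" using ap False less.prems by auto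
      note M = T.Min_right_of_own[OF p this]
      have eq: "{w \<in> forest_children (interval_forest n a b) p. p < w} = {w. T.child w p \<and> p < w}"
        using children_eq[OF False] by auto
      have "Min {w \<in> forest_children (interval_forest n a b) p. p < w} \<in> injective_vertices n (interval_forest n a b)"
        by (rule injective_vertices.inj_child[OF IH])
          (use M(2) p children_eq[OF False] in \<open>auto simp: fun_eq_iff\<close>)
      then show ?thesis using M(1) by (simp add: eq)
    qed
  qed
qed

end

text \<open>The forest and its roots give the child relation of the extended tree, whose transitive
  closure is inclusion, and inclusion determines the intervals. This makes the choice in
  \<open>inv_into\<close> harmless.\<close>

lemma interval_forest_inj:
  assumes "exc_intervals n a b" "exc_intervals n a' b'"
    and "interval_forest n a b = interval_forest n a' b'" and "v \<in> {1..n}"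
  shows "a v = a' v \<and> b v = b' v"
proof -
  interpret E: exceptional n a b by unfold_locales (rule assms(1))
  interpret E': exceptional n a' b' by unfold_locales (rule assms(2))
  have "E.T.child c p \<longleftrightarrow> E'.T.child c p" for c p
    using E.forest_iff[of c p] E'.forest_iff[of c p] E.roots_iff[of c] E'.roots_iff[of c] assms(3)
    by (cases "p = 0") auto
  then have "E.T.child = E'.T.child" by (intro ext) blast
  then have "E.T.sub i j \<longleftrightarrow> E'.T.sub i j" for i j
    using E.T.sub_tranclp E'.T.sub_tranclp by simp
  then have "(a(0 := Suc 0)) v = (a'(0 := Suc 0)) v \<and> (b(0 := Suc n)) v = (b'(0 := Suc n)) v"
    using assms(4) by (intro interval_tree_unique[OF E.T.interval_tree_axioms E'.T.interval_tree_axioms]) auto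
  then show ?thesis using assms(4) by simp
qed

section \<open>Duality under the Garside element\<close>

definition ind :: "nat \<Rightarrow> nat \<Rightarrow> nat \<Rightarrow> int" where
  "ind s t x = (if s \<le> x \<and> x \<le> t then 1 else 0)"

text \<open>For a dimension vector \<open>z\<close> with \<open>z (n + 1) = 0\<close>, the Euler form of the interval
  \<open>[s, t]\<close> with \<open>z\<close> is \<open>z s - z (t + 1)\<close>.\<close>

lemma exc_pair_euler:
  assumes "exc_pair a b c d" "a \<le> b" "c \<le> d"
  shows "ind a b c = ind a b (Suc d)"
  using assms by (auto simp: exc_pair_def ind_def)

section \<open>The lattice spanned by an exceptional sequence\<close>

context exceptional
begin

definition spanned :: "(nat \<Rightarrow> int) \<Rightarrow> bool" where
  "spanned z \<longleftrightarrow> (\<exists>c. \<forall>x. z x = (\<Sum>q\<in>{1..n}. c q * ind (a q) (b q) x))"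

lemma spanned_diff: "\<lbrakk>spanned y; spanned z\<rbrakk> \<Longrightarrow> spanned (\<lambda>x. y x - z x)"
  unfolding spanned_def
proof (elim exE)
  fix c d
  assume "\<forall>x. y x = (\<Sum>q\<in>{1..n}. c q * ind (a q) (b q) x)" "\<forall>x. z x = (\<Sum>q\<in>{1..n}. d q * ind (a q) (b q) x)"
  then show "\<exists>c. \<forall>x. y x - z x = (\<Sum>q\<in>{1..n}. c q * ind (a q) (b q) x)"
    by (intro exI[of _ "\<lambda>q. c q - d q"]) (simp add: left_diff_distrib sum_subtractf)
qed

lemma spanned_0: "spanned (\<lambda>x. 0)"
  unfolding spanned_def by (rule exI[of _ "\<lambda>_. 0"]) simp

lemma spanned_add: "\<lbrakk>spanned y; spanned z\<rbrakk> \<Longrightarrow> spanned (\<lambda>x. y x + z x)"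
  using spanned_diff[OF _ spanned_diff[OF spanned_0], of y z] by simp

lemma spanned_sum: "(\<And>i. i \<in> I \<Longrightarrow> spanned (f i)) \<Longrightarrow> spanned (\<lambda>x. \<Sum>i\<in>I. f i x)"
  by (induction I rule: infinite_finite_induct) (auto simp: spanned_0 intro!: spanned_add)

lemma spanned_interval: "q \<in> {1..n} \<Longrightarrow> spanned (ind (a q) (b q))"
  unfolding spanned_def by (rule exI[of _ "\<lambda>r. if r = q then 1 else 0"]) (simp add: if_distrib[of "\<lambda>c. c * _"] cong: if_cong)

lemma own_point:
  assumes "x \<in> {1..n}"
  obtains m where "m \<in> {1..n}" "T.own m = x"
proof -
  obtain m where m: "m \<le> n" "T.own m = x" by (rule T.own_surj[of x]) (use assms in auto)
  have "m \<noteq> 0"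
  proof
    assume "m = 0"
    then show False using m own_0 assms by simp
  qed
  then show thesis using that[of m] m by simp
qed

text \<open>Removing from the interval of \<open>m\<close> every point but its own leaves a unit
  vector, and the removed points are own points of shorter subintervals. So a complete sequence
  generates Z^n.\<close>

lemma spanned_point: "m \<in> {1..n} \<Longrightarrow> spanned (\<lambda>x. if x = T.own m then 1 else 0)"
proof (induction "b m - a m" arbitrary: m rule: less_induct)
  case less
  let ?S = "{a m..b m} - {T.own m}"
  have m: "m \<le> n" "m \<noteq> 0" using less.prems by auto
  have own: "a m \<le> T.own m" "T.own m \<le> b m" using T.own(1,2)[OF m(1)] m(2) by auto
  have "spanned (\<lambda>x. if x = y then 1 else 0)" if y: "y \<in> ?S" for y
  proof -
    obtain k where k: "k \<in> {1..n}" "T.own k = y" by (rule own_point[of y]) (use y interval[OF less.prems] in auto)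
    have "T.sub k m" by (rule T.own_in_sub) (use k m y in auto)
    then have "b k - a k < b m - a m" using T.sub_size[of k m] k(1) m by simp
    then show ?thesis using less.hyps k by blast
  qed
  then have "spanned (\<lambda>x. \<Sum>y\<in>?S. if x = y then 1 else 0)" by (rule spanned_sum)
  then have "spanned (\<lambda>x. ind (a m) (b m) x - (\<Sum>y\<in>?S. if x = y then 1 else 0))"
    by (rule spanned_diff[OF spanned_interval[OF less.prems]])
  moreover have "ind (a m) (b m) x - (\<Sum>y\<in>?S. if x = y then 1 else 0) = (if x = T.own m then 1 else 0)" for x
    using own by (auto simp: ind_def)
  ultimately show ?case by simp
qed

lemma spanned_ind:
  assumes "1 \<le> s" "t \<le> n"
  shows "spanned (ind s t)"
proof -
  have "spanned (\<lambda>x. \<Sum>y\<in>{s..t}. if x = y then 1 else 0)"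
  proof (rule spanned_sum)
    fix y assume "y \<in> {s..t}"
    then obtain k where "k \<in> {1..n}" "T.own k = y" using assms by (metis own_point atLeastAtMost_iff order_trans)
    then show "spanned (\<lambda>x. if x = y then 1 else 0)" using spanned_point by blast
  qed
  moreover have "(\<Sum>y\<in>{s..t}. if x = y then 1 else 0) = ind s t x" for x
    by (simp add: ind_def)
  ultimately show ?thesis by simp
qed

lemma euler_later: "\<lbrakk>r \<in> {1..n}; q \<in> {1..n}; r < q\<rbrakk> \<Longrightarrow> ind (a r) (b r) (a q) = ind (a r) (b r) (Suc (b q))"
  using exc_pair_euler pair interval by meson

text \<open>An interval orthogonal to all members after position \<open>k\<close> is a combination of the first
  \<open>k\<close> members, by triangularity of the Euler form.\<close>

lemma euler_zero:
  assumes st: "1 \<le> s" "s \<le> t" "t \<le> n"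
    and later: "\<And>q. \<lbrakk>q \<in> {1..n}; k < q\<rbrakk> \<Longrightarrow> ind s t (a q) = ind s t (Suc (b q))"
    and z: "\<And>q. \<lbrakk>q \<in> {1..n}; q \<le> k\<rbrakk> \<Longrightarrow> z (a q) = (z (Suc (b q)) :: int)"
  shows "z s = z (Suc t)"
proof -
  obtain c where c: "\<And>x. ind s t x = (\<Sum>q\<in>{1..n}. c q * ind (a q) (b q) x)"
    using spanned_ind[OF st(1,3)] unfolding spanned_def by blast
  \<comment> \<open>Pairing the expansion with the q-th member, from the last one downwards: smaller
    indices contribute 0 by exceptionality, larger ones already have coefficient 0, and the q-th
    member pairs to 1 with itself.\<close>
  have c0: "c q = 0" if "q \<in> {1..n}" "k < q" for q
    using that
  proof (induction "n - q" arbitrary: q rule: less_induct)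
    case less
    have "(\<Sum>r\<in>{1..n}. c r * (ind (a r) (b r) (a q) - ind (a r) (b r) (Suc (b q)))) = ind s t (a q) - ind s t (Suc (b q))"
      unfolding c by (simp add: right_diff_distrib sum_subtractf)
    also have "\<dots> = 0" using later less.prems by simp
    also have "(\<Sum>r\<in>{1..n}. c r * (ind (a r) (b r) (a q) - ind (a r) (b r) (Suc (b q)))) =
        (\<Sum>r\<in>{1..n}. if r = q then c q else 0)"
    proof (rule sum.cong[OF refl])
      fix r assume r: "r \<in> {1..n}"
      consider "r < q" | "r = q" | "q < r" by linarith
      then show "c r * (ind (a r) (b r) (a q) - ind (a r) (b r) (Suc (b q))) = (if r = q then c q else 0)"
      proof cases
        case 1
        then show ?thesis using euler_later[OF r less.prems(1)] by simp
      next
        case 2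
        then show ?thesis using interval[OF r] by (simp add: ind_def)
      next
        case 3
        then have "c r = 0" using r less.prems by (intro less.hyps) auto
        then show ?thesis using 3 by simp
      qed
    qed
    finally show ?case using less.prems(1) by simp
  qed
  \<comment> \<open>Telescoping against the indicator exhibits the Euler form as linear in its first
    argument.\<close>
  have tele: "(\<Sum>x\<in>{1..n}. ind u v x * (z x - z (Suc x))) = z u - z (Suc v)"
    if "1 \<le> u" "u \<le> v" "v \<le> n" for u v
  proof -
    have "(\<Sum>x\<in>{1..n}. ind u v x * (z x - z (Suc x))) = (\<Sum>x\<in>{u..v}. z x - z (Suc x))"
      using that by (intro sum.mono_neutral_cong_right) (auto simp: ind_def)
    also have "\<dots> = - (\<Sum>x\<in>{u..v}. z (Suc x) - z x)" by (simp flip: sum_negf)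
    finally show ?thesis using sum_Suc_diff[of u v z] that by simp
  qed
  have "z s - z (Suc t) = (\<Sum>x\<in>{1..n}. \<Sum>q\<in>{1..n}. c q * (ind (a q) (b q) x * (z x - z (Suc x))))"
    using tele[OF st] by (simp add: c sum_distrib_right mult.assoc)
  also have "\<dots> = (\<Sum>q\<in>{1..n}. c q * (\<Sum>x\<in>{1..n}. ind (a q) (b q) x * (z x - z (Suc x))))"
    by (subst sum.swap) (simp add: sum_distrib_left)
  also have "\<dots> = (\<Sum>q\<in>{1..n}. c q * (z (a q) - z (Suc (b q))))"
    using tele interval by (intro sum.cong) auto
  also have "\<dots> = 0"
  proof (rule sum.neutral, rule ballI)
    fix q assume q: "q \<in> {1..n}"
    show "c q * (z (a q) - z (Suc (b q))) = 0"
      using c0[OF q] z[OF q] by (cases "q \<le> k") auto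
  qed
  finally show ?thesis by simp
qed

text \<open>The tiles lying between \<open>x\<close> and \<open>y\<close> abut, so the value is
  carried across one root at a time.\<close>

lemma root_boundary_constant:
  assumes "x = 1 \<or> (\<exists>j. T.child j 0 \<and> a j = x)" "x \<le> y" "y = Suc n \<or> (\<exists>j. T.child j 0 \<and> a j = y)"
    and const: "\<And>r. \<lbrakk>T.child r 0; x \<le> a r; b r < y\<rbrakk> \<Longrightarrow> z (a r) = z (Suc (b r))"
  shows "z x = z y"
  using assms(2-4)
proof (induction y rule: less_induct)
  case (less y)
  show ?case
  proof (cases "x = y")
    case False
    have x1: "1 \<le> x" using assms(1) interval sub_nonzero[OF T.child_sub] by blast
    have yn: "y \<le> Suc n" using less.prems(2) interval sub_nonzero[OF T.child_sub] by (metis le_SucI le_trans order_refl)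
    obtain r where r: "T.child r 0" "a r \<le> y - 1" "y - 1 \<le> b r"
      by (rule root_cover[of "y - 1"]) (use False less.prems(1) x1 yn in auto)
    have R: "1 \<le> a r" "a r \<le> b r" "b r \<le> n" using interval sub_nonzero[OF T.child_sub[OF r(1)]] by auto
    have "b r < y" using less.prems(2)
    proof
      assume "\<exists>j. T.child j 0 \<and> a j = y"
      then obtain j where j: "T.child j 0" "a j = y" by blast
      then have "j \<noteq> r" using r(2) x1 less.prems(1) by auto
      then show ?thesis using roots_disjoint[OF j(1) r(1)] j(2) r interval[OF sub_nonzero[OF T.child_sub[OF j(1)]]] False less.prems(1)
        by auto
    qed (use R in simp)
    then have y: "Suc (b r) = y" using r False x1 less.prems(1) by linarith
    have xa: "x \<le> a r" using assms(1)
    proof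
      assume "\<exists>j. T.child j 0 \<and> a j = x"
      then obtain j where j: "T.child j 0" "a j = x" by blast
      show ?thesis
      proof (cases "j = r")
        case False
        then show ?thesis using roots_disjoint[OF j(1) r(1)] j(2) y less.prems(1) \<open>x \<noteq> y\<close>
          interval[OF sub_nonzero[OF T.child_sub[OF j(1)]]] by auto
      qed (use j in simp)
    qed (use R in simp)
    have "z x = z (a r)"
    proof (rule less.IH)
      show "a r = Suc n \<or> (\<exists>j. T.child j 0 \<and> a j = a r)" using r(1) by blast
      fix s assume s: "T.child s 0" "x \<le> a s" "b s < a r"
      then have "b s < y" using y R by simp
      then show "z (a s) = z (Suc (b s))" by (rule less.prems(3)[OF s(1,2)])
    qed (use xa y R in auto)
    also have "\<dots> = z y" using less.prems(3)[OF r(1) xa \<open>b r < y\<close>] y by simp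
    finally show ?thesis .
  qed simp
qed

end

section \<open>Comparing the tilings of a dual pair\<close>

locale dual_pair = E: exceptional n a b + G: exceptional n c d for n a b c d +
  assumes cross: "\<lbrakk>i \<in> {1..n}; j \<in> {1..n}\<rbrakk> \<Longrightarrow>
    ind (c (Suc n - j)) (d (Suc n - j)) (a i) \<noteq> ind (c (Suc n - j)) (d (Suc n - j)) (Suc (b i)) \<longleftrightarrow> i = j"
begin

text \<open>A tile of the second sequence containing just one endpoint of the chord of E_j is
  crossed by it and so is S_j. If b j = n, the endpoint n + 1 lies in no tile, and the tile over a j
  qualifies. If b j < n and S_j were a tile, the tile over the endpoint that S_j misses would be
  crossed as well.\<close>

lemma projective_iff_root:
  assumes j: "j \<in> {1..n}"
  shows "b j = n \<longleftrightarrow> G.T.child (Suc n - j) 0"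
proof
  have cover: "\<exists>i\<in>{1..n}. G.T.child (Suc n - i) 0 \<and> c (Suc n - i) \<le> x \<and> x \<le> d (Suc n - i)"
    if x: "x \<in> {1..n}" for x
  proof -
    obtain r where r: "G.T.child r 0" "c r \<le> x" "x \<le> d r" by (rule G.root_cover[OF x])
    have "r \<in> {1..n}" using G.sub_nonzero[OF G.T.child_sub[OF r(1)]] .
    then show ?thesis using r by (intro bexI[of _ "Suc n - r"]) auto
  qed
  have E: "a j \<in> {1..n}" "a j \<le> b j" "b j \<le> n" using E.interval[OF j] by auto
  have dn: "d (Suc n - i) \<le> n" if "i \<in> {1..n}" for i using G.interval[of "Suc n - i"] Suc_diff_le[of i n] that by auto
  show "G.T.child (Suc n - j) 0" if bj: "b j = n"
  proof -
    obtain i where i: "i \<in> {1..n}" "G.T.child (Suc n - i) 0" "c (Suc n - i) \<le> a j" "a j \<le> d (Suc n - i)"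
      using cover[OF E(1)] by blast
    then have "j = i" using cross[OF j i(1)] dn[OF i(1)] bj by (simp add: ind_def)
    then show ?thesis using i by simp
  qed
  show "b j = n" if root: "G.T.child (Suc n - j) 0"
  proof (rule ccontr)
    assume "b j \<noteq> n"
    then have n: "a j \<in> {1..n}" "Suc (b j) \<in> {1..n}" using E by auto
    \<comment> \<open>\<open>x\<close> is the endpoint inside S_j and \<open>y\<close> the one
      outside; either end of the chord may play either part.\<close>
    have one: False if xy: "x \<in> {1..n}" "y \<in> {1..n}" "{x, y} = {a j, Suc (b j)}"
      "ind (c (Suc n - j)) (d (Suc n - j)) x = 1" "ind (c (Suc n - j)) (d (Suc n - j)) y = 0" for x y
    proof -
      obtain i where i: "i \<in> {1..n}" "G.T.child (Suc n - i) 0" "c (Suc n - i) \<le> y" "y \<le> d (Suc n - i)"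
        using cover[OF xy(2)] by blast
      have "i \<noteq> j" using i xy(5) by (auto simp: ind_def)
      then have "Suc n - i \<noteq> Suc n - j" using i(1) j by auto
      then have "d (Suc n - i) < c (Suc n - j) \<or> d (Suc n - j) < c (Suc n - i)"
        using G.roots_disjoint[OF i(2) root] by simp
      then have "ind (c (Suc n - i)) (d (Suc n - i)) x = 0"
        using xy(4) by (auto simp: ind_def split: if_splits)
      moreover have "ind (c (Suc n - i)) (d (Suc n - i)) y = 1" using i by (simp add: ind_def)
      ultimately show False using cross[OF j i(1)] xy(3) \<open>i \<noteq> j\<close> by (auto simp: doubleton_eq_iff)
    qed
    have "ind (c (Suc n - j)) (d (Suc n - j)) (a j) \<noteq> ind (c (Suc n - j)) (d (Suc n - j)) (Suc (b j))"
      using cross[OF j j] by simp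
    moreover have "ind s t x = 0 \<or> ind s t x = 1" for s t x by (simp add: ind_def)
    ultimately show False using one[OF n] one[OF n(2,1)] by (metis insert_commute)
  qed
qed

text \<open>The indicator of S_j is 0 at n + 1 and takes equal values at both ends of every root
  chord of the first sequence except that of E_j. So its value at 1 is nonzero exactly if E_j is one
  of the tiles.\<close>

lemma root_iff_injective:
  assumes j: "j \<in> {1..n}"
  shows "E.T.child j 0 \<longleftrightarrow> c (Suc n - j) = 1"
proof
  let ?z = "ind (c (Suc n - j)) (d (Suc n - j))"
  have S: "1 \<le> c (Suc n - j)" "c (Suc n - j) \<le> d (Suc n - j)" "d (Suc n - j) \<le> n"
    using G.interval[of "Suc n - j"] Suc_diff_le[of j n] j by auto
  have const: "?z (a r) = ?z (Suc (b r))" if "E.T.child r 0" "r \<noteq> j" for r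
    using cross[OF E.sub_nonzero[OF E.T.child_sub[OF that(1)]] j] that(2) by blast
  have zn: "?z (Suc n) = 0" using S by (simp add: ind_def)
  show "c (Suc n - j) = 1" if root: "E.T.child j 0"
  proof -
    have E: "1 \<le> a j" "a j \<le> b j" "b j \<le> n" using E.interval[OF j] by auto
    have "?z 1 = ?z (a j)"
    proof (rule E.root_boundary_constant)
      fix r assume r: "E.T.child r 0" "b r < a j"
      then have "r \<noteq> j" using E by auto
      then show "?z (a r) = ?z (Suc (b r))" by (rule const[OF r(1)])
    qed (use root E in auto)
    moreover have "?z (Suc (b j)) = ?z (Suc n)"
    proof (cases "b j = n")
      case False
      obtain r where r: "E.T.child r 0" "a r \<le> Suc (b j)" "Suc (b j) \<le> b r"
        by (rule E.root_cover[of "Suc (b j)"]) (use False E in auto)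
      then have "r \<noteq> j" by auto
      then have "a r = Suc (b j)" using E.roots_disjoint[OF r(1) root] r E by auto
      show ?thesis
      proof (rule E.root_boundary_constant)
        fix s assume s: "E.T.child s 0" "Suc (b j) \<le> a s"
        then have "s \<noteq> j" using E by auto
        then show "?z (a s) = ?z (Suc (b s))" by (rule const[OF s(1)])
      qed (use r(1) \<open>a r = Suc (b j)\<close> E in auto)
    qed simp
    moreover have "?z (a j) \<noteq> ?z (Suc (b j))" using cross[OF j j] by simp
    ultimately have "?z 1 \<noteq> 0" using zn by simp
    then show ?thesis using S by (simp add: ind_def split: if_splits)
  qed
  show "E.T.child j 0" if c1: "c (Suc n - j) = 1"
  proof (rule ccontr)
    assume no: "\<not> E.T.child j 0"
    have "?z 1 = ?z (Suc n)"
      by (rule E.root_boundary_constant) (use const no in auto)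
    then show False using zn c1 S by (simp add: ind_def)
  qed
qed

end

text \<open>\<open>X k\<close> are the iterated sequences: the \<open>k\<close>-th step moves a new member to the front.
  Exceptionality alone forces the final members to be dual to the initial ones.\<close>

lemma garside_dual_pair:
  assumes exc: "\<And>k. k < n \<Longrightarrow> exc_intervals n (X k) (Y k)"
    and shift: "\<And>k p. \<lbrakk>Suc k < n; 1 \<le> p; p \<le> Suc k\<rbrakk> \<Longrightarrow> X (Suc k) (Suc p) = X k p \<and> Y (Suc k) (Suc p) = Y k p"
    and tail: "\<And>k p. \<lbrakk>Suc k < n; Suc (Suc k) < p; p \<le> n\<rbrakk> \<Longrightarrow> X (Suc k) p = X k p \<and> Y (Suc k) p = Y k p"
    and n: "n \<ge> 1"
  shows "dual_pair n (X 0) (Y 0) (X (n - 1)) (Y (n - 1))"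
proof -
  have ex: "exceptional n (X k) (Y k)" if "k < n" for k
    using exc[OF that] by unfold_locales
  \<comment> \<open>The first k + 1 entries of X k are the members so far placed in front, the
    newest first. S_j is the first entry of X (j - 1); in particular S_1 is E_1.\<close>
  have front: "X k p = X (Suc k - p) 1 \<and> Y k p = Y (Suc k - p) 1" if "k < n" "1 \<le> p" "p \<le> Suc k" for k p
    using that
  proof (induction k arbitrary: p)
    case (Suc k)
    show ?case
    proof (cases "p = 1")
      case False
      then obtain q where q: "p = Suc q" "1 \<le> q" "q \<le> Suc k" using Suc.prems by (cases p) auto
      then show ?thesis using Suc.IH[of q] shift[of k q] Suc.prems by simp
    qed simp
  qed (simp add: le_Suc_eq)
  have rest: "X k p = X 0 p \<and> Y k p = Y 0 p" if "k < n" "Suc k < p" "p \<le> n" for k p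
    using that
  proof (induction k)
    case (Suc k)
    then show ?case using tail[of k p] by simp
  qed simp
  interpret E: exceptional n "X 0" "Y 0" using ex n by simp
  have final: "X (n - 1) (Suc n - j) = X (j - 1) 1 \<and> Y (n - 1) (Suc n - j) = Y (j - 1) 1" if "j \<in> {1..n}" for j
    using front[of "n - 1" "Suc n - j"] that by (auto simp: Suc_diff_le)
  let ?z = "\<lambda>j. ind (X (j - 1) 1) (Y (j - 1) 1)"
  have zero: "?z j (X 0 i) = ?z j (Suc (Y 0 i))" if i: "i \<in> {1..n}" and j: "j \<in> {1..n}" and ij: "i \<noteq> j" for i j
  proof (cases "j < i")
    \<comment> \<open>E_i is still at its original position when S_j appears in front of it.\<close>
    case True
    interpret H: exceptional n "X (j - 1)" "Y (j - 1)" using ex[of "j - 1"] j by auto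
    have "X (j - 1) i = X 0 i" "Y (j - 1) i = Y 0 i" using rest[of "j - 1" i] True i j by auto
    then show ?thesis using H.euler_later[of 1 i] True i j by auto
  next
    case False
    then obtain k where k: "j = Suc (Suc k)" "i \<le> Suc k" using ij i j
      by (metis One_nat_def Suc_le_D atLeastAtMost_iff le_neq_implies_less less_Suc_eq_le not_less order_le_less_trans zero_less_Suc Suc_pred not_less_eq)
    interpret H: exceptional n "X k" "Y k" using ex k j by simp
    interpret H': exceptional n "X (Suc k)" "Y (Suc k)" using ex k j by simp
    \<comment> \<open>E_i is orthogonal to the untouched members behind position k + 1, hence a
      combination of the first k + 1 entries of X k. In X (k + 1) these stand behind S_j, so they
      pair to 0 with it.\<close>
    show ?thesis
    proof (rule H.euler_zero[where k = "Suc k"])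
      fix q assume q: "q \<in> {1..n}" "Suc k < q"
      then have "X k q = X 0 q" "Y k q = Y 0 q" using rest[of k q] k j by auto
      then show "ind (X 0 i) (Y 0 i) (X k q) = ind (X 0 i) (Y 0 i) (Suc (Y k q))"
        using E.euler_later[OF i q(1)] k(2) q(2) by simp
    next
      fix q assume q: "q \<in> {1..n}" "q \<le> Suc k"
      then have "X (Suc k) (Suc q) = X k q" "Y (Suc k) (Suc q) = Y k q" using shift[of k q] k j by auto
      then show "?z j (X k q) = ?z j (Suc (Y k q))"
        using H'.euler_later[of 1 "Suc q"] k j q by simp
    qed (use E.interval[OF i] in auto)
  qed
  have nonzero: "?z j (X 0 j) \<noteq> ?z j (Suc (Y 0 j))" if j: "j \<in> {1..n}" for j
  proof
    assume "?z j (X 0 j) = ?z j (Suc (Y 0 j))"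
    then have *: "?z j (X 0 i) = ?z j (Suc (Y 0 i))" if "i \<in> {1..n}" for i using zero[OF that j] by (cases "i = j") auto
    interpret H: exceptional n "X (j - 1)" "Y (j - 1)" using ex[of "j - 1"] j by auto
    have I: "1 \<le> X (j - 1) 1" "X (j - 1) 1 \<le> Y (j - 1) 1" "Y (j - 1) 1 \<le> n" using H.interval[of 1] n by auto
    \<comment> \<open>The assumed vanishing makes every member of the spanning sequence pair to 0
      with S_j, hence also S_j itself, although <S_j, S_j> = 1.\<close>
    have "?z j (X (j - 1) 1) = ?z j (Suc (Y (j - 1) 1))"
      by (rule E.euler_zero[where k = n]) (use I * in auto)
    then show False using I by (simp add: ind_def)
  qed
  have "exceptional n (X (n - 1)) (Y (n - 1))" using ex n by simp
  then show ?thesis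
    unfolding dual_pair_def dual_pair_axioms_def
    using E.exceptional_axioms final zero nonzero by metis
qed

section \<open>Hom and Ext between interval representations\<close>

text \<open>Structure maps are nonzero rather than 1, so that every representation isomorphic to an
  interval module qualifies.\<close>

definition interval_rep :: "nat \<Rightarrow> 'k::field qrep \<Rightarrow> nat \<Rightarrow> nat \<Rightarrow> bool" where
  "interval_rep n M a b \<longleftrightarrow> is_rep n M \<and> 1 \<le> a \<and> a \<le> b \<and> b \<le> n \<and>
     (\<forall>i\<in>{1..n}. vdim M i = (if a \<le> i \<and> i \<le> b then 1 else 0)) \<and>
     (\<forall>i. a \<le> i \<and> i < b \<longrightarrow> vmap M i $$ (0, 0) \<noteq> 0)"

lemma is_repD: "\<lbrakk>is_rep n M; 1 \<le> i; i < n\<rbrakk> \<Longrightarrow> vmap M i \<in> carrier_mat (vdim M (Suc i)) (vdim M i)"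
  by (simp add: is_rep_def)

lemma is_homD:
  assumes "is_hom n M N f"
  shows "\<lbrakk>1 \<le> i; i \<le> n\<rbrakk> \<Longrightarrow> f i \<in> carrier_mat (vdim N i) (vdim M i)"
    and "\<lbrakk>1 \<le> i; i < n\<rbrakk> \<Longrightarrow> f (Suc i) * vmap M i = vmap N i * f i"
  using assms by (auto simp: is_hom_def)

lemma interval_repD:
  assumes "interval_rep n M a b"
  shows "is_rep n M" "1 \<le> a" "a \<le> b" "b \<le> n"
    and "\<lbrakk>1 \<le> i; i \<le> n\<rbrakk> \<Longrightarrow> vdim M i = (if a \<le> i \<and> i \<le> b then 1 else 0)"
    and "\<lbrakk>a \<le> i; i < b\<rbrakk> \<Longrightarrow> vmap M i $$ (0, 0) \<noteq> 0"
  using assms by (auto simp: interval_rep_def)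

lemma index_mult_mat_1:
  fixes A B :: "'k::field mat"
  assumes "A \<in> carrier_mat r 1" "B \<in> carrier_mat 1 c" "i < r" "j < c"
  shows "(A * B) $$ (i, j) = A $$ (i, 0) * B $$ (0, j)"
  using assms by (simp add: scalar_prod_def)

lemma index_mult_mat_0:
  fixes A B :: "'k::field mat"
  assumes "A \<in> carrier_mat r 0" "B \<in> carrier_mat 0 c" "i < r" "j < c"
  shows "(A * B) $$ (i, j) = 0"
  using assms by (simp add: scalar_prod_def)

lemma interval_hom_exists:
  fixes M N :: "'k::field qrep"
  assumes M: "interval_rep n M a b" and N: "interval_rep n N c d"
    and le: "c \<le> a" "a \<le> d" "d \<le> b"
  shows "\<not> Hom_zero n M N"
proof
  assume zero: "Hom_zero n M N"
  note m = interval_repD[OF M] and k = interval_repD[OF N]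
  \<comment> \<open>Solves the commutation equations along the overlap [a, d], starting from 1 at
    a.\<close>
  define x where "x i = (\<Prod>j\<in>{a..<i}. vmap N j $$ (0, 0) / vmap M j $$ (0, 0))" for i
  define f where "f i = (if a \<le> i \<and> i \<le> d then mat 1 1 (\<lambda>_. x i) else 0\<^sub>m (vdim N i) (vdim M i))" for i
  have carr: "f i \<in> carrier_mat (vdim N i) (vdim M i)" if "1 \<le> i" "i \<le> n" for i
    using m(5)[OF that] k(5)[OF that] le by (simp add: f_def)
  have "f (Suc i) * vmap M i = vmap N i * f i" if i: "1 \<le> i" "i < n" for i
  proof (rule eq_matI)
    show "dim_row (f (Suc i) * vmap M i) = dim_row (vmap N i * f i)"
      "dim_col (f (Suc i) * vmap M i) = dim_col (vmap N i * f i)"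
      using carr[of i] carr[of "Suc i"] is_repD[OF m(1) i] is_repD[OF k(1) i] i by auto
    fix p q assume "p < dim_row (vmap N i * f i)" "q < dim_col (vmap N i * f i)"
    then have "p < vdim N (Suc i)" "q < vdim M i"
      using carr[of i] is_repD[OF k(1) i] i by auto
    then have in1: "c \<le> Suc i" "Suc i \<le> d" "a \<le> i" "p = 0" "q = 0"
      using k(5)[of "Suc i"] m(5)[of i] i by (auto split: if_splits)
    then have dims: "vdim N i = 1" "vdim M i = 1" "vdim N (Suc i) = 1" "vdim M (Suc i) = 1"
      using le i m(5)[of i] m(5)[of "Suc i"] k(5)[of i] k(5)[of "Suc i"] by auto
    have "x (Suc i) * vmap M i $$ (0, 0) = vmap N i $$ (0, 0) * x i"
      using in1 le m(6)[of i] by (simp add: x_def)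
    moreover have "(f (Suc i) * vmap M i) $$ (0, 0) = x (Suc i) * vmap M i $$ (0, 0)"
      using index_mult_mat_1[of "f (Suc i)" 1 "vmap M i" 1 0 0] carr[of "Suc i"] is_repD[OF m(1) i] dims i in1
      by (simp add: f_def)
    moreover have "(vmap N i * f i) $$ (0, 0) = vmap N i $$ (0, 0) * x i"
      using index_mult_mat_1[of "vmap N i" 1 "f i" 1 0 0] carr[of i] is_repD[OF k(1) i] dims i in1
      by (simp add: f_def)
    ultimately show "(f (Suc i) * vmap M i) $$ (p, q) = (vmap N i * f i) $$ (p, q)" using in1 by simp
  qed
  then have "is_hom n M N f" using carr by (simp add: is_hom_def)
  then have "f a = 0\<^sub>m (vdim N a) (vdim M a)" using zero m(2-4) by (simp add: Hom_zero_def)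
  then have "f a $$ (0, 0) = 0" using m(5)[of a] k(5)[of a] m(2-4) k(2-4) le by simp
  then show False using le by (simp add: f_def x_def)
qed

text \<open>On the overlap, one vanishing component forces the others to vanish. If a < c, the
  square from c - 1, where \<open>N\<close> is zero, kills the first component; otherwise b < d, and
  the square at b, where \<open>M\<close> ends, kills the last.\<close>

lemma interval_hom_zero:
  fixes M N :: "'k::field qrep"
  assumes M: "interval_rep n M a b" and N: "interval_rep n N c d"
    and no: "\<not> (c \<le> a \<and> a \<le> d \<and> d \<le> b)"
  shows "Hom_zero n M N"
  unfolding Hom_zero_def
proof (intro allI impI ballI)
  fix f i assume f: "is_hom n M N f" and i: "i \<in> {1..n}"
  note m = interval_repD[OF M] and k = interval_repD[OF N]
  note carr = is_homD(1)[OF f]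
  have comm: "f (Suc j) $$ (0, 0) * vmap M j $$ (0, 0) = vmap N j $$ (0, 0) * f j $$ (0, 0)"
    if "a \<le> j" "c \<le> j" "j < b" "j < d" for j
  proof -
    have j: "1 \<le> j" "j < n" using that m by auto
    have dims: "vdim N j = 1" "vdim M j = 1" "vdim N (Suc j) = 1" "vdim M (Suc j) = 1"
      using that j m(5)[of j] m(5)[of "Suc j"] k(5)[of j] k(5)[of "Suc j"] by auto
    show ?thesis
      using is_homD(2)[OF f j] index_mult_mat_1[of "f (Suc j)" 1 "vmap M j" 1 0 0]
        index_mult_mat_1[of "vmap N j" 1 "f j" 1 0 0] carr[of j] carr[of "Suc j"]
        is_repD[OF m(1) j] is_repD[OF k(1) j] dims j by simp
  qed
  have zero: "f j $$ (0, 0) = 0" if j: "a \<le> j" "j \<le> b" "c \<le> j" "j \<le> d" for j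
  proof (cases "a < c")
    case True
    obtain e where e: "c = Suc e" "a \<le> e" using True by (cases c) auto
    have e1: "1 \<le> e" "e < n" using e m j k by auto
    have dims: "vdim N e = 0" "vdim M e = 1" "vdim N (Suc e) = 1" "vdim M (Suc e) = 1"
      using e e1 j m(5)[of e] m(5)[of "Suc e"] k(5)[of e] k(5)[of "Suc e"] by auto
    have "f (Suc e) $$ (0, 0) * vmap M e $$ (0, 0) = 0"
      using is_homD(2)[OF f e1] index_mult_mat_1[of "f (Suc e)" 1 "vmap M e" 1 0 0]
        index_mult_mat_0[of "vmap N e" 1 "f e" 1 0 0] carr[of e] carr[of "Suc e"]
        is_repD[OF m(1) e1] is_repD[OF k(1) e1] dims e1 by simp
    then have "f c $$ (0, 0) = 0" using m(6)[of e] e j by simp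
    with j(3) show ?thesis using j(2,4)
    proof (induction j rule: dec_induct)
      case (step l)
      then show ?case using comm[of l] m(6)[of l] True by auto
    qed simp
  next
    case False
    then have bd: "b < d" using no j by auto
    have b1: "1 \<le> b" "b < n" using m k bd by auto
    have dims: "vdim N b = 1" "vdim M b = 1" "vdim N (Suc b) = 1" "vdim M (Suc b) = 0"
      using bd b1 j m(5)[of b] m(5)[of "Suc b"] k(5)[of b] k(5)[of "Suc b"] by auto
    have "vmap N b $$ (0, 0) * f b $$ (0, 0) = 0"
      using is_homD(2)[OF f b1] index_mult_mat_0[of "f (Suc b)" 1 "vmap M b" 1 0 0]
        index_mult_mat_1[of "vmap N b" 1 "f b" 1 0 0] carr[of b] carr[of "Suc b"]
        is_repD[OF m(1) b1] is_repD[OF k(1) b1] dims b1 by simp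
    then have "f b $$ (0, 0) = 0" using k(6)[of b] bd j by simp
    with j(2) show ?thesis using j(1,3)
    proof (induction rule: inc_induct)
      case (step l)
      then show ?case using comm[of l] k(6)[of l] bd by auto
    qed simp
  qed
  show "f i = 0\<^sub>m (vdim N i) (vdim M i)"
  proof (rule eq_matI)
    fix p q assume "p < dim_row (0\<^sub>m (vdim N i) (vdim M i) :: 'k mat)" "q < dim_col (0\<^sub>m (vdim N i) (vdim M i) :: 'k mat)"
    then show "f i $$ (p, q) = 0\<^sub>m (vdim N i) (vdim M i) $$ (p, q)"
      using zero[of i] m(5)[of i] k(5)[of i] i by (auto split: if_splits)
  qed (use carr[of i] i in auto)
qed

section \<open>Extensions and the splitting equation\<close>

definition extension_rep :: "'k::field qrep \<Rightarrow> 'k qrep \<Rightarrow> (nat \<Rightarrow> 'k mat) \<Rightarrow> 'k qrep" where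
  "extension_rep N M \<gamma> =
     \<lparr> vdim = (\<lambda>i. vdim N i + vdim M i),
       vmap = (\<lambda>i. mat (vdim N (Suc i) + vdim M (Suc i)) (vdim N i + vdim M i) (\<lambda>(r, k).
         if r < vdim N (Suc i)
         then if k < vdim N i then vmap N i $$ (r, k) else \<gamma> i $$ (r, k - vdim N i)
         else if k < vdim N i then 0 else vmap M i $$ (r - vdim N (Suc i), k - vdim N i))) \<rparr>"

definition emb :: "nat \<Rightarrow> nat \<Rightarrow> 'k::field mat" where
  "emb p q = mat (p + q) p (\<lambda>(r, k). if r = k then 1 else 0)"

definition prj :: "nat \<Rightarrow> nat \<Rightarrow> 'k::field mat" where
  "prj p q = mat q (p + q) (\<lambda>(r, k). if k = p + r then 1 else 0)"

lemma sum_if_eq_1: "(\<Sum>l = 0..<m. (if (r::nat) = l then (1::'k::field) else 0) * g l) = (if r < m then g r else 0)"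
  by (simp add: if_distrib[of "\<lambda>x. x * _"] cong: if_cong)

lemma sum_if_eq_2: "(\<Sum>l = 0..<m. g l * (if l = (r::nat) then (1::'k::field) else 0)) = (if r < m then g r else 0)"
  by (simp add: if_distrib[of "\<lambda>x. _ * x"] cong: if_cong)

lemma emb_mult_vec: "v \<in> carrier_vec p \<Longrightarrow> emb p q *\<^sub>v v = vec (p + q) (\<lambda>r. if r < p then v $ r else 0)"
  by (rule eq_vecI) (auto simp: emb_def scalar_prod_def sum_if_eq_1)

lemma prj_mult_vec: "v \<in> carrier_vec (p + q) \<Longrightarrow> prj p q *\<^sub>v v = vec q (\<lambda>r. v $ (p + r))"
  by (rule eq_vecI) (auto simp: prj_def scalar_prod_def if_distrib[of "\<lambda>x. x * _"] cong: if_cong)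

text \<open>The quiver has no relations, so any family \<gamma> of upper right blocks defines an
  extension.\<close>

lemma short_exact_extension:
  fixes M N :: "'k::field qrep" and \<gamma> :: "nat \<Rightarrow> 'k mat"
  assumes M: "is_rep n M" and N: "is_rep n N"
  defines "X \<equiv> extension_rep N M \<gamma>"
  shows "is_rep n X" and "short_exact n N (\<lambda>i. emb (vdim N i) (vdim M i)) X (\<lambda>i. prj (vdim N i) (vdim M i)) M"
proof -
  have X: "vdim X i = vdim N i + vdim M i" for i by (simp add: X_def extension_rep_def)
  have eX: "vmap X i \<in> carrier_mat (vdim X (Suc i)) (vdim X i)" for i by (simp add: X_def extension_rep_def)
  then show "is_rep n X" by (simp add: is_rep_def)
  have f: "is_hom n N X (\<lambda>i. emb (vdim N i) (vdim M i))"
    unfolding is_hom_def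
  proof (intro conjI ballI)
    fix i assume "i \<in> {1..<n}"
    then have i: "vmap N i \<in> carrier_mat (vdim N (Suc i)) (vdim N i)" using N by (simp add: is_rep_def)
    show "emb (vdim N (Suc i)) (vdim M (Suc i)) * vmap N i = vmap X i * emb (vdim N i) (vdim M i)"
    proof (rule eq_matI)
      fix r k assume "r < dim_row (vmap X i * emb (vdim N i) (vdim M i))" "k < dim_col (vmap X i * emb (vdim N i) (vdim M i) :: 'k mat)"
      then have rk: "r < vdim N (Suc i) + vdim M (Suc i)" "k < vdim N i" using eX[of i] X by (auto simp: emb_def)
      show "(emb (vdim N (Suc i)) (vdim M (Suc i)) * vmap N i) $$ (r, k) = (vmap X i * emb (vdim N i) (vdim M i)) $$ (r, k)"
        using rk i by (simp add: emb_def X_def extension_rep_def scalar_prod_def sum_if_eq_1 sum_if_eq_2)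
    qed (use i eX[of i] X in \<open>auto simp: emb_def\<close>)
  qed (simp add: emb_def X)
  have g: "is_hom n X M (\<lambda>i. prj (vdim N i) (vdim M i))"
    unfolding is_hom_def
  proof (intro conjI ballI)
    fix i assume "i \<in> {1..<n}"
    then have i: "vmap M i \<in> carrier_mat (vdim M (Suc i)) (vdim M i)" using M by (simp add: is_rep_def)
    show "prj (vdim N (Suc i)) (vdim M (Suc i)) * vmap X i = vmap M i * prj (vdim N i) (vdim M i)"
    proof (rule eq_matI)
      fix r k assume "r < dim_row (vmap M i * prj (vdim N i) (vdim M i))" "k < dim_col (vmap M i * prj (vdim N i) (vdim M i) :: 'k mat)"
      then have rk: "r < vdim M (Suc i)" "k < vdim N i + vdim M i" using i by (auto simp: prj_def)
      have "(\<Sum>l = 0..<vdim M i. vmap M i $$ (r, l) * (if k = vdim N i + l then 1 else 0)) =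
          (if k < vdim N i then 0 else vmap M i $$ (r, k - vdim N i))"
      proof (cases "k < vdim N i")
        case False
        then have "(k = vdim N i + l) = (l = k - vdim N i)" for l by auto
        then show ?thesis using False rk by (simp add: sum_if_eq_2)
      qed (auto intro!: sum.neutral)
      then show "(prj (vdim N (Suc i)) (vdim M (Suc i)) * vmap X i) $$ (r, k) = (vmap M i * prj (vdim N i) (vdim M i)) $$ (r, k)"
        using rk i
        by (simp add: prj_def X_def extension_rep_def scalar_prod_def if_distrib[of "\<lambda>x. x * _"] cong: if_cong)
    qed (use i eX[of i] X in \<open>auto simp: prj_def\<close>)
  qed (simp add: prj_def X)
  show "short_exact n N (\<lambda>i. emb (vdim N i) (vdim M i)) X (\<lambda>i. prj (vdim N i) (vdim M i)) M"
    unfolding short_exact_def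
  proof (intro conjI f g ballI)
    fix i
    let ?p = "vdim N i" and ?q = "vdim M i"
    show "inj_on (\<lambda>v. emb ?p ?q *\<^sub>v v) (carrier_vec ?p :: 'k vec set)"
    proof (rule inj_onI)
      fix u v :: "'k vec" assume uv: "u \<in> carrier_vec ?p" "v \<in> carrier_vec ?p" "emb ?p ?q *\<^sub>v u = emb ?p ?q *\<^sub>v v"
      show "u = v"
      proof (rule eq_vecI)
        fix r assume "r < dim_vec v"
        then have "r < ?p" using uv by simp
        have "(emb ?p ?q *\<^sub>v u) $ r = (emb ?p ?q *\<^sub>v v) $ r" by (simp only: uv(3))
        then show "u $ r = v $ r" using \<open>r < ?p\<close> unfolding emb_mult_vec[OF uv(1)] emb_mult_vec[OF uv(2)] by simp
      qed (use uv in simp)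
    qed
    show "(\<lambda>v. emb ?p ?q *\<^sub>v v) ` carrier_vec ?p = mat_kernel (prj ?p ?q :: 'k mat)"
    proof (intro equalityI subsetI)
      fix w :: "'k vec" assume "w \<in> (\<lambda>v. emb ?p ?q *\<^sub>v v) ` carrier_vec ?p"
      then obtain v where v: "v \<in> carrier_vec ?p" "w = emb ?p ?q *\<^sub>v v" by blast
      show "w \<in> mat_kernel (prj ?p ?q)"
        unfolding mat_kernel_def using v
        by (auto simp: emb_mult_vec prj_mult_vec prj_def[THEN arg_cong, of dim_col] prj_def[THEN arg_cong, of dim_row])
    next
      fix w :: "'k vec" assume w: "w \<in> mat_kernel (prj ?p ?q)"
      then have wc: "w \<in> carrier_vec (?p + ?q)" "prj ?p ?q *\<^sub>v w = 0\<^sub>v ?q" by (auto simp: mat_kernel_def prj_def)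
      have z: "w $ (?p + r) = 0" if "r < ?q" for r
      proof -
        have "(prj ?p ?q *\<^sub>v w) $ r = 0\<^sub>v ?q $ r" by (simp only: wc(2))
        then show ?thesis using that unfolding prj_mult_vec[OF wc(1)] by simp
      qed
      have "w = emb ?p ?q *\<^sub>v vec ?p (\<lambda>r. w $ r)"
      proof (rule eq_vecI)
        fix r assume "r < dim_vec (emb ?p ?q *\<^sub>v vec ?p (\<lambda>r. w $ r))"
        then show "w $ r = (emb ?p ?q *\<^sub>v vec ?p (\<lambda>r. w $ r)) $ r"
          using z[of "r - ?p"] by (auto simp: emb_mult_vec)
      qed (use wc in \<open>simp add: emb_mult_vec\<close>)
      then show "w \<in> (\<lambda>v. emb ?p ?q *\<^sub>v v) ` carrier_vec ?p" by auto
    qed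
    show "(\<lambda>v. prj ?p ?q *\<^sub>v v) ` carrier_vec (vdim X i) = (carrier_vec ?q :: 'k vec set)"
    proof (intro equalityI subsetI)
      fix w :: "'k vec" assume w: "w \<in> carrier_vec ?q"
      then have "w = prj ?p ?q *\<^sub>v vec (?p + ?q) (\<lambda>r. w $ (r - ?p))"
        by (intro eq_vecI) (auto simp: prj_mult_vec)
      then show "w \<in> (\<lambda>v. prj ?p ?q *\<^sub>v v) ` carrier_vec (vdim X i)" by (auto simp: X)
    qed (auto simp: prj_mult_vec X)
  qed
qed

text \<open>In block form a splitting is a column with lower block 1 and upper block
  \<open>h\<close>; compatibility with the arrows is the displayed equation, which says that
  \<gamma> is a coboundary.\<close>

lemma Ext1_zero_cocycle:
  fixes M N :: "'k::field qrep"
  assumes M: "is_rep n M" and N: "is_rep n N" and ext: "Ext1_zero n M N"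
    and \<gamma>: "\<And>i. \<lbrakk>1 \<le> i; i < n\<rbrakk> \<Longrightarrow> \<gamma> i \<in> carrier_mat (vdim N (Suc i)) (vdim M i)"
  obtains h where "\<And>i. \<lbrakk>1 \<le> i; i \<le> n\<rbrakk> \<Longrightarrow> h i \<in> carrier_mat (vdim N i) (vdim M i)"
    "\<And>i. \<lbrakk>1 \<le> i; i < n\<rbrakk> \<Longrightarrow> h (Suc i) * vmap M i = vmap N i * h i + \<gamma> i"
proof -
  define X where "X = extension_rep N M \<gamma>"
  have X: "vdim X i = vdim N i + vdim M i" for i by (simp add: X_def extension_rep_def)
  obtain s where s: "is_hom n M X s" "\<And>i. i \<in> {1..n} \<Longrightarrow> prj (vdim N i) (vdim M i) * s i = 1\<^sub>m (vdim M i)"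
    using ext short_exact_extension[OF M N] unfolding Ext1_zero_def X_def by blast
  define h where "h i = mat (vdim N i) (vdim M i) (\<lambda>(r, k). s i $$ (r, k))" for i
  have low: "s i $$ (vdim N i + r, k) = (if r = k then 1 else 0)"
    if "1 \<le> i" "i \<le> n" "r < vdim M i" "k < vdim M i" for i r k
    using arg_cong[OF s(2)[of i], of "\<lambda>A. A $$ (r, k)"] is_homD(1)[OF s(1), of i] that X[of i]
    by (simp add: prj_def scalar_prod_def if_distrib[of "\<lambda>x. x * _"] cong: if_cong)
  have "h (Suc i) * vmap M i = vmap N i * h i + \<gamma> i" if i: "1 \<le> i" "i < n" for i
  proof (rule eq_matI)
    note c = is_repD[OF M i] is_repD[OF N i] \<gamma>[OF i]
    show "dim_row (h (Suc i) * vmap M i) = dim_row (vmap N i * h i + \<gamma> i)"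
      "dim_col (h (Suc i) * vmap M i) = dim_col (vmap N i * h i + \<gamma> i)"
      using c by (auto simp: h_def)
    fix r k assume "r < dim_row (vmap N i * h i + \<gamma> i)" "k < dim_col (vmap N i * h i + \<gamma> i)"
    then have rk: "r < vdim N (Suc i)" "k < vdim M i" using c by auto
    have sc: "s i \<in> carrier_mat (vdim N i + vdim M i) (vdim M i)"
      "s (Suc i) \<in> carrier_mat (vdim N (Suc i) + vdim M (Suc i)) (vdim M (Suc i))"
      using is_homD(1)[OF s(1), of i] is_homD(1)[OF s(1), of "Suc i"] X i by auto
    have split: "(\<Sum>l = 0..<vdim N i + vdim M i. g l) = (\<Sum>l = 0..<vdim N i. g l) + (\<Sum>l = 0..<vdim M i. g (vdim N i + l))"
      for g :: "nat \<Rightarrow> 'k"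
    proof -
      have "(\<Sum>l = vdim N i..<vdim N i + vdim M i. g l) = (\<Sum>l = 0..<vdim M i. g (vdim N i + l))"
        using sum.shift_bounds_nat_ivl[of g 0 "vdim N i" "vdim M i"] by (simp add: add.commute)
      then show ?thesis using sum.atLeastLessThan_concat[of 0 "vdim N i" "vdim N i + vdim M i" g] by simp
    qed
    have vX: "vmap X i $$ (r, l) = (if l < vdim N i then vmap N i $$ (r, l) else \<gamma> i $$ (r, l - vdim N i))"
      if "l < vdim N i + vdim M i" for l
      using rk that by (simp add: X_def extension_rep_def)
    have Xc: "vmap X i \<in> carrier_mat (vdim N (Suc i) + vdim M (Suc i)) (vdim N i + vdim M i)"
      by (simp add: X_def extension_rep_def)
    have "(h (Suc i) * vmap M i) $$ (r, k) = (s (Suc i) * vmap M i) $$ (r, k)"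
      using rk c sc by (simp add: h_def scalar_prod_def)
    also have "\<dots> = (vmap X i * s i) $$ (r, k)" using is_homD(2)[OF s(1) i] by simp
    also have "\<dots> = (\<Sum>l = 0..<vdim N i + vdim M i. vmap X i $$ (r, l) * s i $$ (l, k))"
      using rk sc Xc by (simp add: scalar_prod_def)
    also have "\<dots> = (\<Sum>l = 0..<vdim N i. vmap N i $$ (r, l) * s i $$ (l, k)) +
        (\<Sum>l = 0..<vdim M i. \<gamma> i $$ (r, l) * (if l = k then 1 else 0))"
      unfolding split using vX low rk i by (intro arg_cong2[of _ _ _ _ "(+)"] sum.cong) auto
    also have "\<dots> = (vmap N i * h i + \<gamma> i) $$ (r, k)"
      using rk c by (simp add: h_def scalar_prod_def sum_if_eq_2)
    finally show "(h (Suc i) * vmap M i) $$ (r, k) = (vmap N i * h i + \<gamma> i) $$ (r, k)" .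
  qed
  moreover have "h i \<in> carrier_mat (vdim N i) (vdim M i)" for i by (simp add: h_def)
  ultimately show thesis using that by blast
qed

lemma interval_ext_nonzero:
  fixes M N :: "'k::field qrep"
  assumes M: "interval_rep n M a b" and N: "interval_rep n N c d"
    and le: "a < c" "c \<le> Suc b" "Suc b \<le> d"
  shows "\<not> Ext1_zero n M N"
proof
  assume ext: "Ext1_zero n M N"
  note m = interval_repD[OF M] and k = interval_repD[OF N]
  \<comment> \<open>The cocycle lives on the arrow leaving b, where \<open>M\<close> stops and
    \<open>N\<close> continues. There the splitting equation demands that
    \<open>vmap N b * h b\<close> be -1.\<close>
  define \<gamma> :: "nat \<Rightarrow> 'k mat" where
    "\<gamma> i = (if i = b then mat (vdim N (Suc i)) (vdim M i) (\<lambda>_. 1) else 0\<^sub>m (vdim N (Suc i)) (vdim M i))" for i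
  have "\<gamma> i \<in> carrier_mat (vdim N (Suc i)) (vdim M i)" for i by (simp add: \<gamma>_def)
  then obtain h where h: "\<And>i. \<lbrakk>1 \<le> i; i \<le> n\<rbrakk> \<Longrightarrow> h i \<in> carrier_mat (vdim N i) (vdim M i)"
    "\<And>i. \<lbrakk>1 \<le> i; i < n\<rbrakk> \<Longrightarrow> h (Suc i) * vmap M i = vmap N i * h i + \<gamma> i"
    using Ext1_zero_cocycle[OF m(1) k(1) ext] by metis
  have b: "1 \<le> b" "b < n" using m k le by auto
  have dims: "vdim M b = 1" "vdim M (Suc b) = 0" "vdim N (Suc b) = 1"
    using b le m(2-4) m(5)[of b] m(5)[of "Suc b"] k(5)[of "Suc b"] by auto
  have top: "(vmap N b * h b) $$ (0, 0) + 1 = 0"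
    using arg_cong[OF h(2)[OF b], of "\<lambda>A. A $$ (0, 0)"] index_mult_mat_0[of "h (Suc b)" 1 "vmap M b" 1 0 0]
      h(1)[of b] h(1)[of "Suc b"] is_repD[OF m(1) b] is_repD[OF k(1) b] b dims by (simp add: \<gamma>_def)
  show False
  proof (cases "c = Suc b")
    case True
    then have "vdim N b = 0" using k(5)[of b] b by simp
    then have "(vmap N b * h b) $$ (0, 0) = 0"
      using index_mult_mat_0[of "vmap N b" 1 "h b" 1 0 0] h(1)[of b] is_repD[OF k(1) b] b dims by simp
    then show False using top by simp
  next
    case False
    then have cb: "c \<le> b" using le by simp
    obtain e where e: "c = Suc e" "a \<le> e" using le by (cases c) auto
    \<comment> \<open>\<open>N\<close> starts at c while \<open>M\<close> is already present at c -
      1, so the square there kills the first component; the next squares carry the zero to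
      b.\<close>
    have "h j $$ (0, 0) = 0" if "c \<le> j" "j \<le> b" for j
      using that
    proof (induction j rule: dec_induct)
      case base
      have e1: "1 \<le> e" "e < n" using e m cb by auto
      have dims: "vdim N e = 0" "vdim M e = 1" "vdim N (Suc e) = 1" "vdim M (Suc e) = 1"
        using e e1 cb le m(5)[of e] m(5)[of "Suc e"] k(3) k(5)[of e] k(5)[of "Suc e"] by auto
      have "h (Suc e) $$ (0, 0) * vmap M e $$ (0, 0) = 0"
        using arg_cong[OF h(2)[OF e1], of "\<lambda>A. A $$ (0, 0)"] index_mult_mat_1[of "h (Suc e)" 1 "vmap M e" 1 0 0]
          index_mult_mat_0[of "vmap N e" 1 "h e" 1 0 0] h(1)[of e] h(1)[of "Suc e"]
          is_repD[OF m(1) e1] is_repD[OF k(1) e1] dims e1 e cb by (simp add: \<gamma>_def)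
      then show ?case using m(6)[of e] e cb by simp
    next
      case (step l)
      have l1: "1 \<le> l" "l < n" using step m e by auto
      have dims: "vdim N l = 1" "vdim M l = 1" "vdim N (Suc l) = 1" "vdim M (Suc l) = 1"
        using l1 step le e m(5)[of l] m(5)[of "Suc l"] k(5)[of l] k(5)[of "Suc l"] by auto
      have "h (Suc l) $$ (0, 0) * vmap M l $$ (0, 0) = vmap N l $$ (0, 0) * h l $$ (0, 0)"
        using arg_cong[OF h(2)[OF l1], of "\<lambda>A. A $$ (0, 0)"] index_mult_mat_1[of "h (Suc l)" 1 "vmap M l" 1 0 0]
          index_mult_mat_1[of "vmap N l" 1 "h l" 1 0 0] h(1)[of l] h(1)[of "Suc l"]
          is_repD[OF m(1) l1] is_repD[OF k(1) l1] dims l1 step by (simp add: \<gamma>_def)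
      then show ?case using step m(6)[of l] e by simp
    qed
    then have "h b $$ (0, 0) = 0" using cb by simp
    moreover have "vdim N b = 1" using k(5)[of b] b cb le by simp
    ultimately have "(vmap N b * h b) $$ (0, 0) = 0"
      using index_mult_mat_1[of "vmap N b" 1 "h b" 1 0 0] h(1)[of b] is_repD[OF k(1) b] b dims by simp
    then show False using top by simp
  qed
qed

lemma mult_mat_zero_vec: "A \<in> carrier_mat r c \<Longrightarrow> A *\<^sub>v 0\<^sub>v c = (0\<^sub>v r :: 'k::field vec)"
  by (intro eq_vecI) (auto simp: scalar_prod_def)

text \<open>Lift the top generator of \<open>M\<close>, push it along the quiver, and correct the lift by an
  element of \<open>N\<close> so that it dies after position \<open>b\<close>.\<close>

lemma Ext1_zero_interval:
  fixes M N :: "'k::field qrep"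
  assumes M: "interval_rep n M a b" and N: "is_rep n N"
    and solve: "\<And>y. \<lbrakk>b < n; y \<in> carrier_vec (vdim N (Suc b))\<rbrakk> \<Longrightarrow>
      \<exists>h. (\<forall>i\<in>{a..Suc b}. h i \<in> carrier_vec (vdim N i)) \<and>
        (\<forall>i\<in>{a..b}. h (Suc i) = vmap N i *\<^sub>v h i) \<and> h (Suc b) = y"
  shows "Ext1_zero n M N"
  unfolding Ext1_zero_def
proof (intro allI impI, elim conjE)
  fix X f g assume X: "is_rep n X" and se: "short_exact n N f X g M"
  note m = interval_repD[OF M]
  have f: "is_hom n N X f" and g: "is_hom n X M g" using se by (auto simp: short_exact_def)
  have ker: "(\<lambda>v. f i *\<^sub>v v) ` carrier_vec (vdim N i) = mat_kernel (g i)"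
    and sur: "(\<lambda>v. g i *\<^sub>v v) ` carrier_vec (vdim X i) = carrier_vec (vdim M i)"
    if "1 \<le> i" "i \<le> n" for i
    using se that by (auto simp: short_exact_def)
  \<comment> \<open>The coordinate at i of the generator pushed forward from a; dividing by it later
    normalizes the splitting.\<close>
  define \<mu> where "\<mu> i = (\<Prod>j\<in>{a..<i}. vmap M j $$ (0, 0))" for i
  have \<mu>0: "\<mu> i \<noteq> 0" if "i \<le> b" for i
    unfolding \<mu>_def using m(6) that by (simp add: prod_zero_iff)
  have \<mu>S: "\<mu> (Suc i) = \<mu> i * vmap M i $$ (0, 0)" if "a \<le> i" for i
    using that by (simp add: \<mu>_def)
  define gen where "gen i = vec (vdim M i) (\<lambda>_. \<mu> i)" for i
  have a1: "1 \<le> a" "a \<le> n" using m by auto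
  have "gen a \<in> carrier_vec (vdim M a)" by (simp add: gen_def)
  then obtain x0 where x0: "x0 \<in> carrier_vec (vdim X a)" "g a *\<^sub>v x0 = gen a"
    using sur[OF a1] by (metis (no_types, lifting) imageE)
  define x where "x i = rec_nat x0 (\<lambda>k v. vmap X (a + k) *\<^sub>v v) (i - a)" for i
  have xa: "x a = x0" by (simp add: x_def)
  have xS: "x (Suc i) = vmap X i *\<^sub>v x i" if "a \<le> i" for i
    using that by (simp add: x_def Suc_diff_le)
  have xc: "x i \<in> carrier_vec (vdim X i)" if "a \<le> i" "i \<le> n" for i
    using that
  proof (induction i rule: dec_induct)
    case (step i)
    then show ?case using is_repD[OF X, of i] a1 xS[of i] by auto
  qed (use xa x0 in simp)
  have xg: "g i *\<^sub>v x i = gen i" if "a \<le> i" "i \<le> b" for i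
    using that
  proof (induction i rule: dec_induct)
    case (step i)
    have i: "1 \<le> i" "i < n" using step a1 m(4) by auto
    have dims: "vdim M i = 1" "vdim M (Suc i) = 1" using m(5)[of i] m(5)[of "Suc i"] step i by auto
    have "g (Suc i) *\<^sub>v x (Suc i) = (g (Suc i) * vmap X i) *\<^sub>v x i"
      using is_homD(1)[OF g, of "Suc i"] is_repD[OF X i] xc[of i] step i by (simp add: xS)
    also have "\<dots> = vmap M i *\<^sub>v (g i *\<^sub>v x i)"
      using is_homD(1)[OF g, of i] is_homD(2)[OF g i] is_repD[OF m(1) i] xc[of i] step i by simp
    also have "\<dots> = gen (Suc i)"
      using is_repD[OF m(1) i] step \<mu>S[of i] dims
      by (intro eq_vecI) (auto simp: gen_def scalar_prod_def)
    finally show ?case .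
  qed (use xa x0 in simp)
  obtain h where hc: "\<And>i. \<lbrakk>a \<le> i; i \<le> Suc b; i \<le> n\<rbrakk> \<Longrightarrow> h i \<in> carrier_vec (vdim N i)"
    and hS: "\<And>i. \<lbrakk>a \<le> i; i \<le> b; i < n\<rbrakk> \<Longrightarrow> h (Suc i) = vmap N i *\<^sub>v h i"
    and hb: "b < n \<Longrightarrow> f (Suc b) *\<^sub>v h (Suc b) = x (Suc b)"
  proof (cases "b < n")
    case True
    have b1: "1 \<le> Suc b" "Suc b \<le> n" using True by auto
    have "vdim M (Suc b) = 0" using m(5)[OF b1] by simp
    \<comment> \<open>\<open>M\<close> is zero at b + 1, so the pushed lift lands in the image of
      \<open>N\<close>.\<close>
    then have "x (Suc b) \<in> mat_kernel (g (Suc b))"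
      using xc[of "Suc b"] is_homD(1)[OF g b1] m(3) b1
      by (intro mat_kernelI[of _ 0 "vdim X (Suc b)"]) auto
    then obtain y where y: "y \<in> carrier_vec (vdim N (Suc b))" "x (Suc b) = f (Suc b) *\<^sub>v y"
      using ker[OF b1] by blast
    obtain h where "\<forall>i\<in>{a..Suc b}. h i \<in> carrier_vec (vdim N i)"
      "\<forall>i\<in>{a..b}. h (Suc i) = vmap N i *\<^sub>v h i" "h (Suc b) = y" using solve[OF True y(1)] by blast
    then show thesis by (intro that[of h]) (use y in auto)
  next
    case False
    \<comment> \<open>No arrow leaves n, so the lift does not have to die and the correction is
      0.\<close>
    then have "b = n" using m by simp
    show thesis
      by (rule that[of "\<lambda>i. 0\<^sub>v (vdim N i)"])
        (use \<open>b = n\<close> mult_mat_zero_vec[OF is_repD[OF N]] a1 in auto)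
  qed
  define w where "w i = x i - f i *\<^sub>v h i" for i
  have fc: "f i *\<^sub>v h i \<in> carrier_vec (vdim X i)" if "a \<le> i" "i \<le> Suc b" "i \<le> n" for i
    using is_homD(1)[OF f, of i] hc[OF that] that a1 by auto
  have wc: "w i \<in> carrier_vec (vdim X i)" if "a \<le> i" "i \<le> Suc b" "i \<le> n" for i
    using xc[of i] fc[OF that] that by (simp add: w_def)
  have wS: "vmap X i *\<^sub>v w i = w (Suc i)" if "a \<le> i" "i \<le> b" "i < n" for i
  proof -
    have i: "1 \<le> i" "i < n" using that a1 by auto
    have "vmap X i *\<^sub>v w i = x (Suc i) - vmap X i *\<^sub>v (f i *\<^sub>v h i)"
      using xS[of i] xc[of i] fc[of i] is_repD[OF X i] that by (simp add: w_def mult_minus_distrib_mat_vec)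
    also have "vmap X i *\<^sub>v (f i *\<^sub>v h i) = (vmap X i * f i) *\<^sub>v h i"
      using is_repD[OF X i] is_homD(1)[OF f, of i] hc[of i] i that by simp
    also have "\<dots> = f (Suc i) *\<^sub>v h (Suc i)"
      using is_homD(2)[OF f i, symmetric] is_repD[OF N i] is_homD(1)[OF f, of "Suc i"] hc[of i] i that hS[of i] by simp
    finally show ?thesis by (simp add: w_def)
  qed
  have wb: "w (Suc b) = 0\<^sub>v (vdim X (Suc b))" if "b < n"
    using hb[OF that] xc[of "Suc b"] that m(3) by (simp add: w_def)
  have wg: "g i *\<^sub>v w i = gen i" if "a \<le> i" "i \<le> b" for i
  proof -
    have i: "1 \<le> i" "i \<le> n" using that a1 m by auto
    have "f i *\<^sub>v h i \<in> mat_kernel (g i)" using ker[OF i] hc[of i] that i by auto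
    then have "g i *\<^sub>v (f i *\<^sub>v h i) = 0\<^sub>v (vdim M i)"
      using is_homD(1)[OF g i] by (auto simp: mat_kernel_def)
    then show ?thesis
      using is_homD(1)[OF g i] xc[of i] fc[of i] xg[of i] that i
      by (simp add: w_def mult_minus_distrib_mat_vec[where nr = "vdim M i" and nc = "vdim X i"] gen_def)
  qed
  define s where "s i = mat (vdim X i) (vdim M i) (\<lambda>(r, k). w i $ r / \<mu> i)" for i
  have sc: "s i \<in> carrier_mat (vdim X i) (vdim M i)" for i by (simp add: s_def)
  have "is_hom n M X s"
    unfolding is_hom_def
  proof (intro conjI ballI)
    fix i assume "i \<in> {1..<n}"
    then have i: "1 \<le> i" "i < n" by auto
    note c = is_repD[OF m(1) i] is_repD[OF X i]
    show "s (Suc i) * vmap M i = vmap X i * s i"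
    proof (rule eq_matI)
      fix r k assume "r < dim_row (vmap X i * s i)" "k < dim_col (vmap X i * s i)"
      then have rk: "r < vdim X (Suc i)" "k < vdim M i" using c sc[of i] by auto
      then have ab: "a \<le> i" "i \<le> b" "k = 0" "vdim M i = 1" using m(5)[of i] i by (auto split: if_splits)
      have "(vmap X i * s i) $$ (r, 0) = (\<Sum>l = 0..<vdim X i. vmap X i $$ (r, l) * (w i $ l / \<mu> i))"
        using rk c ab by (simp add: s_def scalar_prod_def)
      also have "\<dots> = (vmap X i *\<^sub>v w i) $ r / \<mu> i"
        using rk c wc[of i] ab i by (simp add: scalar_prod_def sum_divide_distrib)
      also have "\<dots> = w (Suc i) $ r / \<mu> i" using wS[of i] ab i by simp
      also have "\<dots> = (s (Suc i) * vmap M i) $$ (r, 0)"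
      proof (cases "i = b")
        case True
        then have "vdim M (Suc i) = 0" using m(5)[of "Suc i"] i by simp
        then show ?thesis using index_mult_mat_0[of "s (Suc i)" _ "vmap M i" 1 r 0] sc[of "Suc i"] c ab rk wb i True
          by simp
      next
        case False
        then have "vdim M (Suc i) = 1" using m(5)[of "Suc i"] i ab by simp
        then show ?thesis
          using index_mult_mat_1[of "s (Suc i)" "vdim X (Suc i)" "vmap M i" 1 r 0] sc[of "Suc i"] c ab rk \<mu>S[of i] m(6)[of i] False
          by (simp add: s_def)
      qed
      finally show "(s (Suc i) * vmap M i) $$ (r, k) = (vmap X i * s i) $$ (r, k)" using ab by simp
    qed (use c sc[of i] sc[of "Suc i"] in auto)
  qed (rule sc)
  moreover have "g i * s i = 1\<^sub>m (vdim M i)" if "i \<in> {1..n}" for i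
  proof (rule eq_matI)
    have i: "1 \<le> i" "i \<le> n" using that by auto
    note c = is_homD(1)[OF g i] sc[of i]
    fix r k assume "r < dim_row (1\<^sub>m (vdim M i) :: 'k mat)" "k < dim_col (1\<^sub>m (vdim M i) :: 'k mat)"
    then have ab: "a \<le> i" "i \<le> b" "k = 0" "r = 0" "vdim M i = 1" using m(5)[of i] i by (auto split: if_splits)
    have "(g i * s i) $$ (0, 0) = (\<Sum>l = 0..<vdim X i. g i $$ (0, l) * (w i $ l / \<mu> i))"
      using c ab by (simp add: s_def scalar_prod_def)
    also have "\<dots> = (g i *\<^sub>v w i) $ 0 / \<mu> i"
      using c wc[of i] ab i by (simp add: scalar_prod_def sum_divide_distrib)
    also have "\<dots> = 1" using wg[of i] ab \<mu>0[of i] by (simp add: gen_def)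
    finally show "(g i * s i) $$ (r, k) = 1\<^sub>m (vdim M i) $$ (r, k)" using ab by simp
  qed (use is_homD(1)[OF g] sc that in auto)
  ultimately show "\<exists>s. is_hom n M X s \<and> (\<forall>i\<in>{1..n}. g i * s i = 1\<^sub>m (vdim M i))" by blast
qed

lemma interval_ext_zero:
  fixes M N :: "'k::field qrep"
  assumes M: "interval_rep n M a b" and N: "interval_rep n N c d"
    and no: "\<not> (a < c \<and> c \<le> Suc b \<and> Suc b \<le> d)"
  shows "Ext1_zero n M N"
proof (rule Ext1_zero_interval[OF M interval_repD(1)[OF N]])
  note m = interval_repD[OF M] and k = interval_repD[OF N]
  fix y :: "'k vec" assume b: "b < n" and y: "y \<in> carrier_vec (vdim N (Suc b))"
  show "\<exists>h. (\<forall>i\<in>{a..Suc b}. h i \<in> carrier_vec (vdim N i)) \<and>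
    (\<forall>i\<in>{a..b}. h (Suc i) = vmap N i *\<^sub>v h i) \<and> h (Suc b) = y"
  proof (cases "c \<le> Suc b \<and> Suc b \<le> d")
    case False
    then have "vdim N (Suc b) = 0" using k(5)[of "Suc b"] b by auto
    moreover have "vmap N i *\<^sub>v 0\<^sub>v (vdim N i) = 0\<^sub>v (vdim N (Suc i))" if "i \<in> {a..b}" for i
      using mult_mat_zero_vec[OF is_repD[OF k(1), of i]] that m b by auto
    ultimately show ?thesis using y by (intro exI[of _ "\<lambda>i. 0\<^sub>v (vdim N i)"]) auto
  next
    case True
    \<comment> \<open>With the Ext configuration excluded, \<open>N\<close> is present on all of
      [a, b + 1]; its maps there are invertible and \<open>y\<close> can be pulled back.\<close>
    then have ca: "c \<le> a" using no by auto
    have dims: "vdim N i = 1" if "i \<in> {a..Suc b}" for i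
      using k(5)[of i] that ca True m b by auto
    define \<nu> where "\<nu> i = (\<Prod>j\<in>{a..<i}. vmap N j $$ (0, 0))" for i
    have \<nu>0: "\<nu> (Suc b) \<noteq> 0"
      unfolding \<nu>_def using k(6) ca True by (simp add: prod_zero_iff)
    have "vec 1 (\<lambda>_. y $ 0 * \<nu> (Suc i) / \<nu> (Suc b)) = vmap N i *\<^sub>v vec 1 (\<lambda>_. y $ 0 * \<nu> i / \<nu> (Suc b))"
      if "i \<in> {a..b}" for i
      using is_repD[OF k(1), of i] that m b dims[of i] dims[of "Suc i"]
      by (intro eq_vecI) (auto simp: scalar_prod_def \<nu>_def)
    moreover have "vec 1 (\<lambda>_. y $ 0 * \<nu> (Suc b) / \<nu> (Suc b)) = y"
      using y dims[of "Suc b"] \<nu>0 m by (intro eq_vecI) auto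
    ultimately show ?thesis using dims
      by (intro exI[of _ "\<lambda>i. vec 1 (\<lambda>_. y $ 0 * \<nu> i / \<nu> (Suc b))"]) auto
  qed
qed

section \<open>Interval representations are indecomposable\<close>

lemma inverse_dims:
  fixes f g :: "'k::field mat"
  assumes f: "f \<in> carrier_mat s m" and g: "g \<in> carrier_mat m s" and "g * f = 1\<^sub>m m" "f * g = 1\<^sub>m s" "m \<le> 1"
  shows "s = m"
proof (cases "m = 0")
  case True
  have "s = 0"
  proof (rule ccontr)
    assume "s \<noteq> 0"
    then have "(f * g) $$ (0, 0) = 0" using f g True by (intro index_mult_mat_0) auto
    then show False using assms(4) \<open>s \<noteq> 0\<close> by simp
  qed
  then show ?thesis using True by simp
next
  case False
  then have m: "m = 1" using assms(5) by simp
  have "s \<noteq> 0"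
  proof
    assume "s = 0"
    then have "(g * f) $$ (0, 0) = 0" using f g m by (intro index_mult_mat_0) auto
    then show False using assms(3) m by simp
  qed
  moreover have "\<not> 1 < s"
  proof
    assume s: "1 < s"
    \<comment> \<open>A column times a row has rank at most one and cannot be an identity of size
      two or more.\<close>
    have e: "f $$ (i, 0) * g $$ (0, j) = (if i = j then 1 else 0)" if "i < s" "j < s" for i j
      using index_mult_mat_1[of f s g s i j] f g m assms(4) that by simp
    have "f $$ (0, 0) \<noteq> 0" using e[of 0 0] s by auto
    moreover have "g $$ (0, 1) \<noteq> 0" using e[of 1 1] s by auto
    ultimately show False using e[of 0 1] s by simp
  qed
  ultimately show ?thesis using m by simp
qed

text \<open>At each position of [a, b] exactly one summand has dimension 1. If this summand changed
  between i and i + 1, the map of the direct sum would be zero there, whereas that of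
  \<open>M\<close> is not.\<close>

lemma interval_indecomposable:
  fixes M :: "'k::field qrep"
  assumes M: "interval_rep n M a b"
  shows "indecomposable_rep n M"
  unfolding indecomposable_rep_def
proof (intro conjI allI impI)
  note m = interval_repD[OF M]
  show "is_rep n M" by (rule m(1))
  show "\<not> is_zero_rep n M"
    unfolding is_zero_rep_def using m(2-4) m(5)[of a] by (auto intro!: bexI[of _ a])
  fix A B :: "'k qrep" assume "is_rep n A \<and> is_rep n B \<and> iso_rep n M (direct_sum_rep A B)"
  then obtain f g where A: "is_rep n A" and B: "is_rep n B"
    and f: "is_hom n M (direct_sum_rep A B) f" and g: "is_hom n (direct_sum_rep A B) M g"
    and inv: "\<And>i. i \<in> {1..n} \<Longrightarrow> g i * f i = 1\<^sub>m (vdim M i) \<and> f i * g i = 1\<^sub>m (vdim (direct_sum_rep A B) i)"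
    unfolding iso_rep_def by blast
  have D: "vdim (direct_sum_rep A B) i = vdim A i + vdim B i" for i by (simp add: direct_sum_rep_def)
  have dims: "vdim A i + vdim B i = vdim M i" if "1 \<le> i" "i \<le> n" for i
    using inverse_dims[of "f i" "vdim A i + vdim B i" "vdim M i" "g i"] is_homD(1)[OF f that] is_homD(1)[OF g that]
      inv[of i] that D m(5)[OF that] by simp
  have same: "vdim A (Suc i) = vdim A i" if i: "a \<le> i" "i < b" for i
  proof (rule ccontr)
    assume ne: "vdim A (Suc i) \<noteq> vdim A i"
    have i1: "1 \<le> i" "i < n" "1 \<le> Suc i" "Suc i \<le> n" using i m by auto
    have M1: "vdim M i = 1" "vdim M (Suc i) = 1" using m(5)[of i] m(5)[of "Suc i"] i i1 by auto
    then have s: "vdim A i + vdim B i = 1" "vdim A (Suc i) + vdim B (Suc i) = 1"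
      using dims[of i] dims[of "Suc i"] i1 by auto
    have dc: "vmap (direct_sum_rep A B) i \<in> carrier_mat 1 1"
      using is_repD[OF A i1(1,2)] is_repD[OF B i1(1,2)] s by (auto simp: direct_sum_rep_def)
    have z: "vmap (direct_sum_rep A B) i $$ (0, 0) = 0"
      using is_repD[OF A i1(1,2)] is_repD[OF B i1(1,2)] s ne by (auto simp: direct_sum_rep_def)
    have fc: "f i \<in> carrier_mat 1 1" "f (Suc i) \<in> carrier_mat 1 1" "g (Suc i) \<in> carrier_mat 1 1"
      using is_homD(1)[OF f, of i] is_homD(1)[OF f i1(3,4)] is_homD(1)[OF g i1(3,4)] i1 D s M1 by auto
    have "f (Suc i) $$ (0, 0) * vmap M i $$ (0, 0) = vmap (direct_sum_rep A B) i $$ (0, 0) * f i $$ (0, 0)"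
      using is_homD(2)[OF f i1(1,2)] index_mult_mat_1[OF fc(2), of "vmap M i" 1 0 0]
        index_mult_mat_1[OF dc fc(1), of 0 0] is_repD[OF m(1) i1(1,2)] M1 by simp
    then have "f (Suc i) $$ (0, 0) = 0" using z m(6)[OF i] by simp
    then have "(g (Suc i) * f (Suc i)) $$ (0, 0) = 0" using index_mult_mat_1[OF fc(3,2), of 0 0] by simp
    then show False using inv[of "Suc i"] i1 M1 by simp
  qed
  have const: "vdim A i = vdim A a" if "a \<le> i" "i \<le> b" for i
    using that by (induction i rule: dec_induct) (auto simp: same)
  have out: "vdim A i = 0 \<and> vdim B i = 0" if "1 \<le> i" "i \<le> n" "\<not> (a \<le> i \<and> i \<le> b)" for i
    using dims[of i] m(5)[of i] that by auto
  show "is_zero_rep n A \<or> is_zero_rep n B"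
  proof (cases "vdim A a = 0")
    case True
    then show ?thesis using const out unfolding is_zero_rep_def by (metis atLeastAtMost_iff)
  next
    case False
    have "vdim B i = 0" if "i \<in> {1..n}" for i
    proof (cases "a \<le> i \<and> i \<le> b")
      case True
      then show ?thesis using const[of i] dims[of i] m(5)[of i] that False by auto
    qed (use out that in auto)
    then show ?thesis by (simp add: is_zero_rep_def)
  qed
qed

section \<open>Indecomposable representations are intervals\<close>

text \<open>The columns of \<open>Q\<close> other than \<open>v\<close> span the kernel of \<open>\<phi>\<close>; \<open>skip\<close> enumerates the indices
  other than a pivot \<open>k\<close> of \<open>\<phi>\<close>.\<close>

lemma adapted_basis:
  fixes v \<phi> :: "'k::field mat"
  assumes v: "v \<in> carrier_mat m 1" and \<phi>: "\<phi> \<in> carrier_mat 1 m" and one: "\<phi> * v = 1\<^sub>m 1"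
  obtains P Q where "P \<in> carrier_mat m m" "Q \<in> carrier_mat m m" "P * Q = 1\<^sub>m m" "Q * P = 1\<^sub>m m"
    "\<And>r. r < m \<Longrightarrow> Q $$ (r, 0) = v $$ (r, 0)" "\<And>k. k < m \<Longrightarrow> P $$ (0, k) = \<phi> $$ (0, k)" "m > 0"
proof -
  have sum1: "(\<Sum>l = 0..<m. \<phi> $$ (0, l) * v $$ (l, 0)) = 1"
    using arg_cong[OF one, of "\<lambda>A. A $$ (0, 0)"] v \<phi> by (simp add: scalar_prod_def)
  obtain k where k: "k < m" "\<phi> $$ (0, k) \<noteq> 0"
  proof -
    have "\<exists>k<m. \<phi> $$ (0, k) \<noteq> 0"
    proof (rule ccontr)
      assume "\<not> ?thesis"
      then have "(\<Sum>l = 0..<m. \<phi> $$ (0, l) * v $$ (l, 0)) = 0" by (intro sum.neutral) auto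
      then show False using sum1 by simp
    qed
    then show thesis using that by blast
  qed
  define skip where "skip t = (if t < k then t else Suc t)" for t
  have skip: "skip t \<noteq> k" for t by (simp add: skip_def)
  have skip_less: "skip (i - 1) < m" if "0 < i" "i < m" for i using that k by (auto simp: skip_def)
  have skip_inj: "skip (i - 1) = skip (j - 1) \<longleftrightarrow> i = j" if "0 < i" "0 < j" for i j
    using that by (auto simp: skip_def)
  \<comment> \<open>Coordinates in the basis given by \<open>Q\<close>: \<phi> for the vector v, and
    for the rest the entries of x - \<phi>(x) v at the indices other than \<open>k\<close>.\<close>
  define P where "P = mat m m (\<lambda>(i, j). if i = 0 then \<phi> $$ (0, j)
    else (if skip (i - 1) = j then 1 else 0) - v $$ (skip (i - 1), 0) * \<phi> $$ (0, j))"
  define Q where "Q = mat m m (\<lambda>(i, j). if j = 0 then v $$ (i, 0)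
    else (if i = skip (j - 1) then 1 else 0) - (if i = k then \<phi> $$ (0, skip (j - 1)) / \<phi> $$ (0, k) else 0))"
  have PQ_c: "P \<in> carrier_mat m m" "Q \<in> carrier_mat m m" by (auto simp: P_def Q_def)
  have \<phi>Q: "(\<Sum>l = 0..<m. \<phi> $$ (0, l) * Q $$ (l, j)) = (if j = 0 then 1 else 0)" if j: "j < m" for j
  proof (cases "j = 0")
    case True
    then show ?thesis using sum1 j by (simp add: Q_def)
  next
    case False
    have "(\<Sum>l = 0..<m. \<phi> $$ (0, l) * Q $$ (l, j)) =
        (\<Sum>l = 0..<m. \<phi> $$ (0, l) * (if l = skip (j - 1) then 1 else 0)) -
        (\<Sum>l = 0..<m. \<phi> $$ (0, l) * (if l = k then \<phi> $$ (0, skip (j - 1)) / \<phi> $$ (0, k) else 0))"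
      using False j by (simp add: Q_def right_diff_distrib flip: sum_subtractf)
    also have "(\<Sum>l = 0..<m. \<phi> $$ (0, l) * (if l = skip (j - 1) then 1 else 0)) = \<phi> $$ (0, skip (j - 1))"
      using skip_less[of j] False j by (simp add: sum_if_eq_2)
    also have "(\<Sum>l = 0..<m. \<phi> $$ (0, l) * (if l = k then \<phi> $$ (0, skip (j - 1)) / \<phi> $$ (0, k) else 0)) = \<phi> $$ (0, skip (j - 1))"
      using k by (simp add: if_distrib[of "\<lambda>x. _ * x"] cong: if_cong)
    finally show ?thesis using False by simp
  qed
  have PQ: "P * Q = 1\<^sub>m m"
  proof (rule eq_matI)
    fix i j assume "i < dim_row (1\<^sub>m m :: 'k mat)" "j < dim_col (1\<^sub>m m :: 'k mat)"
    then have ij: "i < m" "j < m" by auto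
    have "(P * Q) $$ (i, j) = (\<Sum>l = 0..<m. P $$ (i, l) * Q $$ (l, j))"
      using ij PQ_c by (simp add: scalar_prod_def)
    also have "\<dots> = (if i = j then 1 else 0)"
    proof (cases "i = 0")
      case True
      then have "(\<Sum>l = 0..<m. P $$ (i, l) * Q $$ (l, j)) = (\<Sum>l = 0..<m. \<phi> $$ (0, l) * Q $$ (l, j))"
        using ij by (simp add: P_def)
      then show ?thesis using \<phi>Q[OF ij(2)] True by auto
    next
      case False
      let ?s = "skip (i - 1)"
      have s: "?s < m" using skip_less False ij by simp
      have "(\<Sum>l = 0..<m. P $$ (i, l) * Q $$ (l, j)) =
          (\<Sum>l = 0..<m. (if ?s = l then 1 else 0) * Q $$ (l, j)) - v $$ (?s, 0) * (\<Sum>l = 0..<m. \<phi> $$ (0, l) * Q $$ (l, j))"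
        using False ij by (simp add: P_def left_diff_distrib sum_subtractf sum_distrib_left mult.assoc)
      also have "\<dots> = Q $$ (?s, j) - v $$ (?s, 0) * (if j = 0 then 1 else 0)"
        using s \<phi>Q[OF ij(2)] by (simp add: sum_if_eq_1)
      also have "\<dots> = (if i = j then 1 else 0)"
        using s ij skip[of "i - 1"] skip_inj[of i j] False by (auto simp: Q_def)
      finally show ?thesis .
    qed
    finally show "(P * Q) $$ (i, j) = 1\<^sub>m m $$ (i, j)" using ij by simp
  qed (auto simp: P_def Q_def)
  have "Q * P = 1\<^sub>m m" by (rule mat_mult_left_right_inverse[OF PQ_c PQ])
  then show thesis
    by (rule that[OF PQ_c PQ]) (use k in \<open>auto simp: P_def Q_def\<close>)
qed

text \<open>Any representation has a thin interval summand: take a vector at the first nonzero position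
  \<open>a\<close> which survives as long as possible, to \<open>b\<close> say, and pull back to the interval a functional
  not vanishing on its image at \<open>b\<close>.\<close>

lemma thin_vectors:
  fixes M :: "'k::field qrep"
  assumes M: "is_rep n M" and nz: "\<not> is_zero_rep n M"
  obtains a b v \<phi> where "1 \<le> a" "a \<le> b" "b \<le> n" "\<And>i. \<lbrakk>1 \<le> i; i < a\<rbrakk> \<Longrightarrow> vdim M i = 0"
    "\<And>i. \<lbrakk>a \<le> i; i \<le> b\<rbrakk> \<Longrightarrow> v i \<in> carrier_mat (vdim M i) 1"
    "\<And>i. \<lbrakk>a \<le> i; i \<le> b\<rbrakk> \<Longrightarrow> \<phi> i \<in> carrier_mat 1 (vdim M i)"
    "\<And>i. \<lbrakk>a \<le> i; i \<le> b\<rbrakk> \<Longrightarrow> \<phi> i * v i = 1\<^sub>m 1"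
    "\<And>i. \<lbrakk>a \<le> i; i < b\<rbrakk> \<Longrightarrow> vmap M i * v i = v (Suc i)"
    "\<And>i. \<lbrakk>a \<le> i; i < b\<rbrakk> \<Longrightarrow> \<phi> (Suc i) * vmap M i = \<phi> i"
    "b < n \<Longrightarrow> vmap M b * v b = 0\<^sub>m (vdim M (Suc b)) 1"
proof -
  define a where "a = (LEAST i. 1 \<le> i \<and> i \<le> n \<and> vdim M i \<noteq> 0)"
  have "\<exists>i. 1 \<le> i \<and> i \<le> n \<and> vdim M i \<noteq> 0" using nz by (auto simp: is_zero_rep_def)
  from LeastI_ex[OF this] have a: "1 \<le> a" "a \<le> n" "vdim M a \<noteq> 0" unfolding a_def by blast+
  have below: "vdim M i = 0" if "1 \<le> i" "i < a" for i
    using not_less_Least[of i "\<lambda>i. 1 \<le> i \<and> i \<le> n \<and> vdim M i \<noteq> 0"] that a(2) unfolding a_def[symmetric] by auto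
  \<comment> \<open>The composite of the structure maps from a to i.\<close>
  define P where "P i = rec_nat (1\<^sub>m (vdim M a)) (\<lambda>k A. vmap M (a + k) * A) (i - a)" for i
  have Pa: "P a = 1\<^sub>m (vdim M a)" by (simp add: P_def)
  have PS: "P (Suc i) = vmap M i * P i" if "a \<le> i" for i
    using that by (simp add: P_def Suc_diff_le)
  have Pc: "P i \<in> carrier_mat (vdim M i) (vdim M a)" if "a \<le> i" "i \<le> n" for i
    using that
  proof (induction i rule: dec_induct)
    case (step i)
    then show ?case using is_repD[OF M, of i] a by (auto simp: PS)
  qed (simp add: Pa)
  define S where "S = {i \<in> {a..n}. P i \<noteq> 0\<^sub>m (vdim M i) (vdim M a)}"
  have "a \<in> S"
  proof -
    have "(1\<^sub>m (vdim M a) :: 'k mat) $$ (0, 0) \<noteq> 0\<^sub>m (vdim M a) (vdim M a) $$ (0, 0)" using a(3) by simp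
    then show ?thesis using a unfolding S_def Pa[symmetric] by (metis (mono_tags, lifting) Pa atLeastAtMost_iff mem_Collect_eq order_refl)
  qed
  have finS: "finite S" by (simp add: S_def)
  define b where "b = Max S"
  have bS: "b \<in> S" unfolding b_def using finS \<open>a \<in> S\<close> by (intro Max_in) auto
  then have b: "a \<le> b" "b \<le> n" "P b \<noteq> 0\<^sub>m (vdim M b) (vdim M a)" by (auto simp: S_def)
  have Pend: "P (Suc b) = 0\<^sub>m (vdim M (Suc b)) (vdim M a)" if "b < n"
  proof (rule ccontr)
    assume "\<not> ?thesis"
    then have "Suc b \<in> S" using that b(1) by (simp add: S_def)
    then show False using Max_ge[OF finS] unfolding b_def[symmetric] by fastforce
  qed
  obtain r c where rc: "r < vdim M b" "c < vdim M a" "P b $$ (r, c) \<noteq> 0"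
    using b Pc[OF b(1,2)] by (metis (no_types, lifting) carrier_matD eq_matI index_zero_mat)
  \<comment> \<open>A basis vector detected by a nonzero entry of \<open>P b\<close>. Its image dies
    at b + 1 because the whole composite does.\<close>
  define e where "e = mat (vdim M a) 1 (\<lambda>(i, j). if i = c then (1::'k) else 0)"
  define v where "v i = P i * e" for i
  have ec: "e \<in> carrier_mat (vdim M a) 1" by (simp add: e_def)
  have vc: "v i \<in> carrier_mat (vdim M i) 1" if "a \<le> i" "i \<le> n" for i
    using Pc[OF that] ec by (simp add: v_def)
  have vS: "vmap M i * v i = v (Suc i)" if "a \<le> i" "i < n" for i
    using that a Pc[of i] is_repD[OF M, of i] ec
    by (simp add: v_def PS assoc_mult_mat[of "vmap M i" "vdim M (Suc i)" "vdim M i" "P i" "vdim M a" e 1])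
  have vb: "v b $$ (r, 0) = P b $$ (r, c)"
    using rc Pc[OF b(1,2)] by (simp add: v_def e_def scalar_prod_def sum_if_eq_2)
  \<comment> \<open>The r-th coordinate, scaled to take the value 1 on v b.\<close>
  define \<phi>b where "\<phi>b = mat 1 (vdim M b) (\<lambda>(i, j). if j = r then 1 / P b $$ (r, c) else 0)"
  define \<phi> where "\<phi> i = rec_nat \<phi>b (\<lambda>k \<psi>. \<psi> * vmap M (b - Suc k)) (b - i)" for i
  have \<phi>_b: "\<phi> b = \<phi>b" by (simp add: \<phi>_def)
  have \<phi>S: "\<phi> (Suc i) * vmap M i = \<phi> i" if "i < b" for i
  proof -
    have "b - i = Suc (b - Suc i)" "b - Suc (b - Suc i) = i" using that by auto
    then show ?thesis by (simp add: \<phi>_def)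
  qed
  have \<phi>c: "\<phi> i \<in> carrier_mat 1 (vdim M i)" if "i \<le> b" "a \<le> i" for i
    using that
  proof (induction rule: inc_induct)
    case (step i)
    then have "\<phi> (Suc i) \<in> carrier_mat 1 (vdim M (Suc i))" "vmap M i \<in> carrier_mat (vdim M (Suc i)) (vdim M i)"
      using is_repD[OF M, of i] a b by auto
    then show ?case unfolding \<phi>S[OF step(2), symmetric] by (rule mult_carrier_mat)
  qed (simp add: \<phi>_b \<phi>b_def)
  have one: "\<phi> i * v i = 1\<^sub>m 1" if "i \<le> b" "a \<le> i" for i
    using that
  proof (induction rule: inc_induct)
    case base
    have "(\<phi>b * v b) $$ (0, 0) = (\<Sum>l = 0..<vdim M b. (if l = r then 1 / P b $$ (r, c) else 0) * v b $$ (l, 0))"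
      using vc[OF b(1,2)] by (simp add: \<phi>b_def scalar_prod_def)
    also have "\<dots> = 1" using rc vb by (simp add: if_distrib[of "\<lambda>x. x * _"] cong: if_cong)
    finally show ?case using vc[OF b(1,2)] by (intro eq_matI) (auto simp: \<phi>_b \<phi>b_def)
  next
    case (step i)
    have i: "1 \<le> i" "i < n" "a \<le> i" "i < b" using step a b by auto
    have "\<phi> i * v i = \<phi> (Suc i) * (vmap M i * v i)"
      unfolding \<phi>S[OF i(4), symmetric]
      by (rule assoc_mult_mat[OF \<phi>c[of "Suc i"] is_repD[OF M i(1,2)] vc[of i]]) (use i in auto)
    then show ?case using vS[OF i(3,2)] step by simp
  qed
  show thesis
  proof (rule that[of a b v \<phi>])
    show "vmap M b * v b = 0\<^sub>m (vdim M (Suc b)) 1" if "b < n"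
      using vS[OF b(1) that] Pend[OF that] ec by (simp add: v_def)
  qed (use a b below vc vS \<phi>c \<phi>S one in auto)
qed

text \<open>In the adapted bases the thin part spanned by v splits off with complement the kernel of
  \<phi>; indecomposability leaves no room for the complement.\<close>

lemma indecomposable_interval:
  fixes M :: "'k::field qrep"
  assumes ind: "indecomposable_rep n M"
  obtains a b where "interval_rep n M a b"
proof -
  have M: "is_rep n M" and nz: "\<not> is_zero_rep n M" using ind by (auto simp: indecomposable_rep_def)
  show thesis
  proof (rule thin_vectors[OF M nz])
    fix a b v \<phi>
    assume ab: "1 \<le> a" "a \<le> b" "b \<le> n"
      and below: "\<And>i. \<lbrakk>1 \<le> i; i < a\<rbrakk> \<Longrightarrow> vdim M i = 0"
      and v: "\<And>i. \<lbrakk>a \<le> i; i \<le> b\<rbrakk> \<Longrightarrow> v i \<in> carrier_mat (vdim M i) 1"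
      and \<phi>: "\<And>i. \<lbrakk>a \<le> i; i \<le> b\<rbrakk> \<Longrightarrow> \<phi> i \<in> carrier_mat 1 (vdim M i)"
      and one: "\<And>i. \<lbrakk>a \<le> i; i \<le> b\<rbrakk> \<Longrightarrow> \<phi> i * v i = 1\<^sub>m 1"
      and vS: "\<And>i. \<lbrakk>a \<le> i; i < b\<rbrakk> \<Longrightarrow> vmap M i * v i = v (Suc i)"
      and \<phi>S: "\<And>i. \<lbrakk>a \<le> i; i < b\<rbrakk> \<Longrightarrow> \<phi> (Suc i) * vmap M i = \<phi> i"
      and vb: "b < n \<Longrightarrow> vmap M b * v b = 0\<^sub>m (vdim M (Suc b)) 1"
    define R where "R i P Q \<longleftrightarrow> P \<in> carrier_mat (vdim M i) (vdim M i) \<and> Q \<in> carrier_mat (vdim M i) (vdim M i) \<and>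
        P * Q = 1\<^sub>m (vdim M i) \<and> Q * P = 1\<^sub>m (vdim M i) \<and>
        (a \<le> i \<and> i \<le> b \<longrightarrow> 0 < vdim M i \<and> (\<forall>r<vdim M i. Q $$ (r, 0) = v i $$ (r, 0)) \<and>
          (\<forall>k<vdim M i. P $$ (0, k) = \<phi> i $$ (0, k)))" for i P Q
    have "\<exists>P Q. R i P Q" for i
    proof (cases "a \<le> i \<and> i \<le> b")
      case True
      then have i: "a \<le> i" "i \<le> b" by auto
      show ?thesis
        by (rule adapted_basis[OF v[OF i] \<phi>[OF i] one[OF i]]) (use R_def in blast)
    next
      case False
      then have "R i (1\<^sub>m (vdim M i)) (1\<^sub>m (vdim M i))" by (auto simp: R_def)
      then show ?thesis by blast
    qed
    then obtain P Q where R: "\<And>i. R i (P i) (Q i)" by metis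
    have Pc: "P i \<in> carrier_mat (vdim M i) (vdim M i)" and Qc: "Q i \<in> carrier_mat (vdim M i) (vdim M i)"
      and PQ: "P i * Q i = 1\<^sub>m (vdim M i)" and QP: "Q i * P i = 1\<^sub>m (vdim M i)" for i
      using R[of i] by (auto simp: R_def)
    have pos: "0 < vdim M i" and Q0: "r < vdim M i \<Longrightarrow> Q i $$ (r, 0) = v i $$ (r, 0)"
      and P0: "r < vdim M i \<Longrightarrow> P i $$ (0, r) = \<phi> i $$ (0, r)" if "a \<le> i" "i \<le> b" for i r
      using R[of i] that by (auto simp: R_def)
    define C where "C i = P (Suc i) * vmap M i * Q i" for i
    define d where "d i = (if a \<le> i \<and> i \<le> b then 1 else 0 :: nat)" for i
    define A :: "'k qrep" where "A = \<lparr> vdim = d, vmap = (\<lambda>i. mat (d (Suc i)) (d i) (\<lambda>_. 1)) \<rparr>"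
    define B where "B = \<lparr> vdim = (\<lambda>i. vdim M i - d i),
      vmap = (\<lambda>i. mat (vdim M (Suc i) - d (Suc i)) (vdim M i - d i) (\<lambda>(r, k). C i $$ (r + d (Suc i), k + d i))) \<rparr>"
    have A: "is_rep n A" and B: "is_rep n B" by (auto simp: is_rep_def A_def B_def)
    have d_le: "d i \<le> vdim M i" for i using pos[of i] by (auto simp: d_def)
    have D: "vdim (direct_sum_rep A B) i = vdim M i" for i
      using d_le[of i] by (simp add: direct_sum_rep_def A_def B_def)
    have Cc: "C i \<in> carrier_mat (vdim M (Suc i)) (vdim M i)" if "1 \<le> i" "i < n" for i
      using Pc[of "Suc i"] Qc[of i] is_repD[OF M that] by (auto simp: C_def)
    \<comment> \<open>The first column records how v moves along the arrow, including its death
      after b.\<close>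
    have C_col: "C i $$ (r, 0) = (if i < b \<and> r = 0 then 1 else 0)"
      if i: "1 \<le> i" "i < n" "a \<le> i" "i \<le> b" and r: "r < vdim M (Suc i)" for i r
    proof -
      note c = is_repD[OF M i(1,2)] Pc[of "Suc i"] Qc[of i] v[OF i(3,4)]
      have pi: "0 < vdim M i" using pos i by simp
      have "C i $$ (r, 0) = (P (Suc i) * vmap M i * v i) $$ (r, 0)"
        using c r pi Q0[OF i(3,4)] by (simp add: C_def scalar_prod_def)
      also have "P (Suc i) * vmap M i * v i = P (Suc i) * (vmap M i * v i)"
        using c by (intro assoc_mult_mat) auto
      also have "(P (Suc i) * (vmap M i * v i)) $$ (r, 0) = (if i < b \<and> r = 0 then 1 else 0)"
      proof (cases "i < b")
        case True
        have s: "a \<le> Suc i" "Suc i \<le> b" using True i by auto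
        have "(P (Suc i) * (vmap M i * v i)) $$ (r, 0) = (P (Suc i) * Q (Suc i)) $$ (r, 0)"
          using c r pos[OF s] Q0[OF s] v[OF s] Qc[of "Suc i"] vS[OF i(3) True] by (simp add: scalar_prod_def)
        then show ?thesis using PQ r pos[OF s] True by simp
      next
        case False
        then have "i = b" using i by simp
        then show ?thesis using vb i r c by (simp add: scalar_prod_def)
      qed
      finally show ?thesis .
    qed
    \<comment> \<open>The first row records how \<phi> is pulled back. At i = b the thin summand has
      no row in the target, whence i < b.\<close>
    have C_row: "C i $$ (0, k) = (if k = 0 then 1 else 0)"
      if i: "1 \<le> i" "i < n" "a \<le> i" "i < b" and k: "k < vdim M i" for i k
    proof -
      have s: "a \<le> Suc i" "Suc i \<le> b" "i \<le> b" using i by auto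
      note c = is_repD[OF M i(1,2)] Pc[of "Suc i"] Qc[of i] \<phi>[OF s(1,2)] \<phi>[OF i(3) s(3)]
      have "C i = P (Suc i) * (vmap M i * Q i)" unfolding C_def using c by (intro assoc_mult_mat) auto
      then have "C i $$ (0, k) = (\<phi> (Suc i) * (vmap M i * Q i)) $$ (0, k)"
        using c k pos[OF s(1,2)] P0[OF s(1,2)] by (simp add: scalar_prod_def)
      also have "\<phi> (Suc i) * (vmap M i * Q i) = \<phi> i * Q i"
        unfolding \<phi>S[OF i(3,4), symmetric] using c by (intro assoc_mult_mat[symmetric]) auto
      also have "(\<phi> i * Q i) $$ (0, k) = (P i * Q i) $$ (0, k)"
        using c k pos[OF i(3) s(3)] P0[OF i(3) s(3)] Pc[of i] by (simp add: scalar_prod_def)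
      finally show ?thesis using PQ k pos[OF i(3) s(3)] by simp
    qed
    have C_D: "C i = vmap (direct_sum_rep A B) i" if i: "1 \<le> i" "i < n" for i
    proof (rule eq_matI)
      have dims: "dim_row (vmap (direct_sum_rep A B) i) = vdim M (Suc i)" "dim_col (vmap (direct_sum_rep A B) i) = vdim M i"
        using d_le[of i] d_le[of "Suc i"] by (auto simp: direct_sum_rep_def A_def B_def)
      then show "dim_row (C i) = dim_row (vmap (direct_sum_rep A B) i)" "dim_col (C i) = dim_col (vmap (direct_sum_rep A B) i)"
        using Cc[OF i] by auto
      fix r k assume "r < dim_row (vmap (direct_sum_rep A B) i)" "k < dim_col (vmap (direct_sum_rep A B) i)"
      then have rk: "r < vdim M (Suc i)" "k < vdim M i" using dims by auto
      \<comment> \<open>Before a there are no columns to compare, since \<open>M\<close> is zero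
        there.\<close>
      then have "a \<le> i" using below[of i] i by (cases "i < a") auto
      then have dS: "d (Suc i) = (if i < b then 1 else 0)" "d i = (if i \<le> b then 1 else 0)" by (auto simp: d_def)
      have "vmap (direct_sum_rep A B) i $$ (r, k) =
          (if r < d (Suc i) then if k < d i then 1 else 0 else if k < d i then 0 else C i $$ (r, k))"
        using rk d_le[of i] d_le[of "Suc i"] by (auto simp: direct_sum_rep_def A_def B_def)
      also have "\<dots> = C i $$ (r, k)"
        using C_col[OF i \<open>a \<le> i\<close> _ rk(1)] C_row[OF i \<open>a \<le> i\<close> _ rk(2)] dS by (auto split: if_splits)
      finally show "C i $$ (r, k) = vmap (direct_sum_rep A B) i $$ (r, k)" by simp
    qed
    have "is_hom n M (direct_sum_rep A B) P"
      unfolding is_hom_def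
    proof (intro conjI ballI)
      fix i assume "i \<in> {1..<n}"
      then have i: "1 \<le> i" "i < n" by auto
      have "vmap (direct_sum_rep A B) i * P i = (P (Suc i) * vmap M i) * (Q i * P i)"
        unfolding C_D[OF i, symmetric] C_def
        using is_repD[OF M i] Pc[of "Suc i"] Qc[of i] Pc[of i] by (intro assoc_mult_mat) auto
      then show "P (Suc i) * vmap M i = vmap (direct_sum_rep A B) i * P i"
        using QP[of i] is_repD[OF M i] Pc[of "Suc i"] by simp
    qed (use Pc D in auto)
    moreover have "is_hom n (direct_sum_rep A B) M Q"
      unfolding is_hom_def
    proof (intro conjI ballI)
      fix i assume "i \<in> {1..<n}"
      then have i: "1 \<le> i" "i < n" by auto
      note c = is_repD[OF M i] Pc[of "Suc i"] Qc[of i] Qc[of "Suc i"]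
      have "Q (Suc i) * vmap (direct_sum_rep A B) i = Q (Suc i) * (P (Suc i) * (vmap M i * Q i))"
        unfolding C_D[OF i, symmetric] C_def using c by (subst assoc_mult_mat) auto
      also have "\<dots> = (Q (Suc i) * P (Suc i)) * (vmap M i * Q i)"
        using c by (intro assoc_mult_mat[symmetric]) auto
      finally show "Q (Suc i) * vmap (direct_sum_rep A B) i = vmap M i * Q i"
        using QP c by simp
    qed (use Qc D in auto)
    ultimately have "iso_rep n M (direct_sum_rep A B)"
      unfolding iso_rep_def using PQ QP D by auto
    then have "is_zero_rep n A \<or> is_zero_rep n B" using ind A B by (auto simp: indecomposable_rep_def)
    moreover have "\<not> is_zero_rep n A"
      using ab by (auto simp: is_zero_rep_def A_def d_def intro!: bexI[of _ a])
    ultimately have "is_zero_rep n B" by blast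
    then have "vdim M i = d i" if "1 \<le> i" "i \<le> n" for i
      using that d_le[of i] by (auto simp: is_zero_rep_def B_def intro: le_antisym)
    then have dim: "vdim M i = (if a \<le> i \<and> i \<le> b then 1 else 0)" if "1 \<le> i" "i \<le> n" for i
      using that by (simp add: d_def)
    have "vmap M i $$ (0, 0) \<noteq> 0" if i: "a \<le> i" "i < b" for i
    proof
      assume z: "vmap M i $$ (0, 0) = 0"
      have i1: "1 \<le> i" "i < n" "a \<le> Suc i" "Suc i \<le> b" "i \<le> b" using i ab by auto
      have dims: "vdim M i = 1" "vdim M (Suc i) = 1" using dim[of i] dim[of "Suc i"] i i1 by auto
      have "\<phi> i $$ (0, 0) = 0"
        using \<phi>S[OF i] index_mult_mat_1[of "\<phi> (Suc i)" 1 "vmap M i" 1 0 0] \<phi>[OF i1(3,4)] is_repD[OF M i1(1,2)] dims z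
        by simp
      then have "(\<phi> i * v i) $$ (0, 0) = 0"
        using index_mult_mat_1[of "\<phi> i" 1 "v i" 1 0 0] \<phi>[OF i(1) i1(5)] v[OF i(1) i1(5)] dims by simp
      then show False using one[OF i(1) i1(5)] by simp
    qed
    then have "interval_rep n M a b" using M ab dim by (simp add: interval_rep_def)
    then show thesis by (rule that)
  qed
qed

section \<open>Braid group action\<close>

definition thin_rep :: "nat \<Rightarrow> nat \<Rightarrow> 'k::field qrep" where
  "thin_rep a b = \<lparr> vdim = (\<lambda>i. if a \<le> i \<and> i \<le> b then 1 else 0),
     vmap = (\<lambda>i. mat (if a \<le> Suc i \<and> Suc i \<le> b then 1 else 0) (if a \<le> i \<and> i \<le> b then 1 else 0) (\<lambda>_. 1)) \<rparr>"

lemma interval_rep_thin: "\<lbrakk>1 \<le> a; a \<le> b; b \<le> n\<rbrakk> \<Longrightarrow> interval_rep n (thin_rep a b) a b"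
  by (auto simp: interval_rep_def is_rep_def thin_rep_def)

lemma supp_interval_rep: "interval_rep n M a b \<Longrightarrow> supp_rep n M = {a..b}"
  by (auto simp: interval_rep_def supp_rep_def split: if_splits)

lemma interval_rep_unique:
  assumes "interval_rep n M a b" "interval_rep n M c d"
  shows "a = c \<and> b = d"
  using supp_interval_rep[OF assms(1)] supp_interval_rep[OF assms(2)] interval_repD(3)[OF assms(1)]
  by (simp add: Icc_eq_Icc)

definition realizes :: "nat \<Rightarrow> (nat \<Rightarrow> 'k::field qrep) \<Rightarrow> (nat \<Rightarrow> nat) \<Rightarrow> (nat \<Rightarrow> nat) \<Rightarrow> bool" where
  "realizes n E a b \<longleftrightarrow> (\<forall>i\<in>{1..n}. interval_rep n (E i) (a i) (b i))"

lemma realizesD: "\<lbrakk>realizes n E a b; i \<in> {1..n}\<rbrakk> \<Longrightarrow> interval_rep n (E i) (a i) (b i)"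
  by (simp add: realizes_def)

lemma complete_exceptional_iff:
  assumes R: "realizes n E a b"
  shows "complete_exceptional n E \<longleftrightarrow> exc_intervals n a b"
proof -
  note I = realizesD[OF R]
  have pair: "Hom_zero n (E j) (E i) \<and> Ext1_zero n (E j) (E i) \<longleftrightarrow> exc_pair (a i) (b i) (a j) (b j)"
    if "i \<in> {1..n}" "j \<in> {1..n}" for i j
    using interval_hom_exists[OF I[OF that(2)] I[OF that(1)]] interval_hom_zero[OF I[OF that(2)] I[OF that(1)]]
      interval_ext_nonzero[OF I[OF that(2)] I[OF that(1)]] interval_ext_zero[OF I[OF that(2)] I[OF that(1)]]
    unfolding exc_pair_def by blast
  have "is_rep n (E i) \<and> rigid_rep n (E i) \<and> indecomposable_rep n (E i)" if "i \<in> {1..n}" for i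
    using interval_repD(1)[OF I[OF that]] interval_ext_zero[OF I[OF that] I[OF that]]
      interval_indecomposable[OF I[OF that]] by (auto simp: rigid_rep_def)
  moreover have "1 \<le> a i \<and> a i \<le> b i \<and> b i \<le> n" if "i \<in> {1..n}" for i
    using interval_repD[OF I[OF that]] by simp
  ultimately show ?thesis
    unfolding complete_exceptional_def exc_intervals_def using pair by simp
qed

lemma complete_exceptional_realizes:
  assumes E: "complete_exceptional n E"
  obtains a b where "realizes n E a b" "exc_intervals n a b"
proof -
  have "\<exists>a b. interval_rep n (E i) a b" if "i \<in> {1..n}" for i
    using E that indecomposable_interval unfolding complete_exceptional_def by metis
  then obtain a b where "realizes n E a b" unfolding realizes_def by metis
  then show thesis using that complete_exceptional_iff E by blast
qed

lemma forest_of_realizes: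
  assumes "realizes n E a b"
  shows "forest_of n E = interval_forest n a b"
proof -
  have "supp_rep n (E i) = {a i..b i}" if "i \<in> {1..n}" for i
    using supp_interval_rep[OF realizesD[OF assms that]] .
  then show ?thesis unfolding forest_of_def interval_forest_def by auto
qed

lemma exc_intervals_realized:
  assumes "exc_intervals n a b"
  shows "realizes n (\<lambda>i. thin_rep (a i) (b i) :: 'k::field qrep) a b"
  using assms interval_rep_thin unfolding realizes_def exc_intervals_def by blast

text \<open>\<open>inv_into\<close> may return any sequence with this forest, but injectivity fixes
  its intervals.\<close>

lemma seq_of_interval_forest:
  assumes ab: "exc_intervals n a b"
  shows "realizes n (seq_of_forest n (interval_forest n a b) :: nat \<Rightarrow> 'k::field qrep) a b"
proof -
  let ?E = "seq_of_forest n (interval_forest n a b) :: nat \<Rightarrow> 'k qrep"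
  let ?T = "\<lambda>i. thin_rep (a i) (b i) :: 'k qrep"
  have T: "realizes n ?T a b" by (rule exc_intervals_realized[OF ab])
  then have "complete_exceptional n ?T" using complete_exceptional_iff ab by blast
  then have F: "interval_forest n a b \<in> forest_of n ` {E :: nat \<Rightarrow> 'k qrep. complete_exceptional n E}"
    unfolding forest_of_realizes[OF T, symmetric] by (intro imageI) simp
  have E: "forest_of n ?E = interval_forest n a b"
    unfolding seq_of_forest_def by (rule f_inv_into_f[OF F])
  have "complete_exceptional n ?E" using inv_into_into[OF F] unfolding seq_of_forest_def by simp
  then obtain a' b' where ab': "realizes n ?E a' b'" "exc_intervals n a' b'"
    by (rule complete_exceptional_realizes)
  then have "interval_forest n a' b' = interval_forest n a b" using forest_of_realizes[OF ab'(1)] E by simp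
  then have "a' i = a i \<and> b' i = b i" if "i \<in> {1..n}" for i
    using interval_forest_inj[OF ab'(2) ab _ that] by simp
  then show ?thesis using ab'(1) by (auto simp: realizes_def)
qed

text \<open>Entry \<open>i\<close> of the result stays unspecified: it comes from
  \<open>SOME\<close>, and only exceptionality of the whole sequence is recorded about it.\<close>

lemma braid_forest_intervals:
  assumes ab: "exc_intervals n a b" and i: "1 \<le> i" "i < n"
  obtains a' b' where "exc_intervals n a' b'"
    "braid_forest TYPE('k::field) n i (interval_forest n a b) = interval_forest n a' b'"
    "a' (Suc i) = a i \<and> b' (Suc i) = b i"
    "\<forall>p\<in>{1..n}. p \<noteq> i \<and> p \<noteq> Suc i \<longrightarrow> a' p = a p \<and> b' p = b p"
proof -
  define E where "E = (seq_of_forest n (interval_forest n a b) :: nat \<Rightarrow> 'k qrep)"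
  have E: "realizes n E a b" unfolding E_def by (rule seq_of_interval_forest[OF ab])
  obtain x y where xy: "exc_intervals n (a(i := x, Suc i := a i)) (b(i := y, Suc i := b i))"
    by (rule mutation_exists[OF ab i])
  have "realizes n (E(i := thin_rep x y, Suc i := E i)) (a(i := x, Suc i := a i)) (b(i := y, Suc i := b i))"
    using realizesD[OF E] realizesD[OF exc_intervals_realized[OF xy, where 'k = 'k], of i] i
    by (auto simp: realizes_def)
  then have "complete_exceptional n (E(i := thin_rep x y, Suc i := E i))"
    using complete_exceptional_iff xy by blast
  then have "complete_exceptional n (braid_seq n i E)"
    unfolding braid_seq_def Let_def by (rule someI)
  then obtain a' b' where ab': "realizes n (braid_seq n i E) a' b'" "exc_intervals n a' b'"
    by (rule complete_exceptional_realizes)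
  have B: "braid_seq n i E (Suc i) = E i" "\<And>p. \<lbrakk>p \<noteq> i; p \<noteq> Suc i\<rbrakk> \<Longrightarrow> braid_seq n i E p = E p"
    by (auto simp: braid_seq_def Let_def)
  show thesis
  proof (rule that[OF ab'(2)])
    show "braid_forest TYPE('k) n i (interval_forest n a b) = interval_forest n a' b'"
      unfolding braid_forest_def E_def[symmetric] by (rule forest_of_realizes[OF ab'(1)])
    show "a' (Suc i) = a i \<and> b' (Suc i) = b i"
      using interval_rep_unique[OF realizesD[OF ab'(1), of "Suc i", unfolded B(1)] realizesD[OF E, of i]] i by simp
    have "a' p = a p \<and> b' p = b p" if "p \<in> {1..n}" "p \<noteq> i" "p \<noteq> Suc i" for p
      using interval_rep_unique[OF realizesD[OF ab'(1) that(1), unfolded B(2)[OF that(2,3)]] realizesD[OF E that(1)]] .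
    then show "\<forall>p\<in>{1..n}. p \<noteq> i \<and> p \<noteq> Suc i \<longrightarrow> a' p = a p \<and> b' p = b p" by blast
  qed
qed

lemma delta_forest_intervals:
  assumes ab: "exc_intervals n a b" and k: "k < n"
  shows "\<exists>a' b'. exc_intervals n a' b' \<and>
    delta_forest TYPE('k::field) n k (interval_forest n a b) = interval_forest n a' b' \<and>
    (\<forall>p\<in>{1..k}. a' (Suc p) = a p \<and> b' (Suc p) = b p) \<and>
    (\<forall>p\<in>{1..n}. Suc k < p \<longrightarrow> a' p = a p \<and> b' p = b p)"
proof -
  \<comment> \<open>Generalized to the partial product of the generators from m to k. The rightmost
    factor acts first, so m decreases, and the travelling entry sits at position m.\<close>
  have "\<exists>a' b'. exc_intervals n a' b' \<and>
    foldr (\<circ>) (map (braid_forest TYPE('k) n) [m..<Suc k]) id (interval_forest n a b) = interval_forest n a' b' \<and>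
    (\<forall>p\<in>{m..k}. a' (Suc p) = a p \<and> b' (Suc p) = b p) \<and>
    (\<forall>p\<in>{1..n}. p \<notin> {m..Suc k} \<longrightarrow> a' p = a p \<and> b' p = b p)" if "m \<le> Suc k" "1 \<le> m" for m
    using that
  proof (induction rule: inc_induct)
    case base
    show ?case using ab by (intro exI[of _ a] exI[of _ b]) auto
  next
    case (step m)
    have "1 \<le> Suc m" by simp
    from step.IH[OF this] obtain a' b' where ab': "exc_intervals n a' b'"
      "foldr (\<circ>) (map (braid_forest TYPE('k) n) [Suc m..<Suc k]) id (interval_forest n a b) = interval_forest n a' b'"
      "\<forall>p\<in>{Suc m..k}. a' (Suc p) = a p \<and> b' (Suc p) = b p"
      "\<forall>p\<in>{1..n}. p \<notin> {Suc m..Suc k} \<longrightarrow> a' p = a p \<and> b' p = b p" by blast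
    have m: "1 \<le> m" "m < n" "m \<le> k" using step k by auto
    obtain c d where cd: "exc_intervals n c d"
      "braid_forest TYPE('k) n m (interval_forest n a' b') = interval_forest n c d"
      "c (Suc m) = a' m \<and> d (Suc m) = b' m"
      "\<forall>p\<in>{1..n}. p \<noteq> m \<and> p \<noteq> Suc m \<longrightarrow> c p = a' p \<and> d p = b' p"
      using braid_forest_intervals[OF ab'(1) m(1,2), where 'k = 'k] by blast
    have "foldr (\<circ>) (map (braid_forest TYPE('k) n) [m..<Suc k]) id (interval_forest n a b) = interval_forest n c d"
      using m(3) ab'(2) cd(2) by (simp add: upt_conv_Cons del: upt_Suc)
    moreover have "c (Suc p) = a p \<and> d (Suc p) = b p" if "p \<in> {m..k}" for p
    proof (cases "p = m")
      case True
      then show ?thesis using cd(3) ab'(4) m by auto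
    next
      case False
      then show ?thesis using cd(4) ab'(3) that k by auto
    qed
    moreover have "c p = a p \<and> d p = b p" if "p \<in> {1..n}" "p \<notin> {m..Suc k}" for p
      using cd(4) ab'(4) that m by auto
    ultimately show ?case using cd(1) by blast
  qed
  from this[of 1] show ?thesis unfolding delta_forest_def by fastforce
qed

lemma garside_forest_intervals:
  assumes ab: "exc_intervals n a b" and n: "n \<ge> 1"
  obtains c d where "dual_pair n a b c d"
    "garside_forest TYPE('k::field) n (interval_forest n a b) = interval_forest n c d"
proof -
  define part where "part k = foldr (\<circ>) (map (delta_forest TYPE('k) n) (rev [1..<Suc k])) id (interval_forest n a b)" for k
  have part_Suc: "part (Suc k) = delta_forest TYPE('k) n (Suc k) (part k)" for k
    by (simp add: part_def)
  \<comment> \<open>The bounds by n void the requirements past the last stage, so that a choice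
    exists for every k.\<close>
  define P where "P k x \<longleftrightarrow> (k < n \<longrightarrow> exc_intervals n (fst x) (snd x) \<and>
      part k = interval_forest n (fst x) (snd x)) \<and> (k = 0 \<longrightarrow> x = (a, b))" for k x
  define Q where "Q k x y \<longleftrightarrow> (Suc k < n \<longrightarrow>
    (\<forall>p\<in>{1..Suc k}. fst y (Suc p) = fst x p \<and> snd y (Suc p) = snd x p) \<and>
    (\<forall>p\<in>{1..n}. Suc (Suc k) < p \<longrightarrow> fst y p = fst x p \<and> snd y p = snd x p))"
    for k and x y :: "(nat \<Rightarrow> nat) \<times> (nat \<Rightarrow> nat)"
  have "\<exists>f. \<forall>k. P k (f k) \<and> Q k (f k) (f (Suc k))"
  proof (rule dependent_nat_choice)
    show "\<exists>x. P 0 x" using ab by (intro exI[of _ "(a, b)"]) (simp add: P_def part_def)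
    fix x k assume x: "P k x"
    show "\<exists>y. P (Suc k) y \<and> Q k x y"
    proof (cases "Suc k < n")
      case True
      then have "exc_intervals n (fst x) (snd x)" "part k = interval_forest n (fst x) (snd x)" using x by (auto simp: P_def)
      from delta_forest_intervals[OF this(1) True, where 'k = 'k] this(2)
      obtain a' b' where "exc_intervals n a' b'" "part (Suc k) = interval_forest n a' b'"
        "\<forall>p\<in>{1..Suc k}. a' (Suc p) = fst x p \<and> b' (Suc p) = snd x p"
        "\<forall>p\<in>{1..n}. Suc (Suc k) < p \<longrightarrow> a' p = fst x p \<and> b' p = snd x p"
        unfolding part_Suc by metis
      then show ?thesis by (intro exI[of _ "(a', b')"]) (simp add: P_def Q_def)
    qed (simp add: P_def Q_def)
  qed
  then obtain f where f: "\<And>k. P k (f k)" "\<And>k. Q k (f k) (f (Suc k))" by blast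
  have f0: "f 0 = (a, b)" using f(1)[of 0] by (simp add: P_def)
  have "dual_pair n (fst (f 0)) (snd (f 0)) (fst (f (n - 1))) (snd (f (n - 1)))"
  proof (rule garside_dual_pair[of n "\<lambda>k. fst (f k)" "\<lambda>k. snd (f k)"])
    show "exc_intervals n (fst (f k)) (snd (f k))" if "k < n" for k using f(1)[of k] that by (simp add: P_def)
    show "fst (f (Suc k)) (Suc p) = fst (f k) p \<and> snd (f (Suc k)) (Suc p) = snd (f k) p"
      if "Suc k < n" "1 \<le> p" "p \<le> Suc k" for k p using f(2)[of k] that by (simp add: Q_def)
    show "fst (f (Suc k)) p = fst (f k) p \<and> snd (f (Suc k)) p = snd (f k) p"
      if "Suc k < n" "Suc (Suc k) < p" "p \<le> n" for k p using f(2)[of k] that by (simp add: Q_def)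
  qed (rule n)
  moreover have "garside_forest TYPE('k) n (interval_forest n a b) = part (n - 1)"
    using n by (simp add: garside_forest_def part_def)
  moreover have "part (n - 1) = interval_forest n (fst (f (n - 1))) (snd (f (n - 1)))" using f(1)[of "n - 1"] n by (simp add: P_def)
  ultimately show thesis using that f0 by simp
qed

section \<open>Transfer to the vertices of the two forests\<close>

context dual_pair
begin

lemma roots_image:
  "forest_roots n (interval_forest n c d) = (\<lambda>j. n - j + 1) ` projective_vertices n (interval_forest n a b)"
proof (intro equalityI subsetI)
  fix r assume r: "r \<in> forest_roots n (interval_forest n c d)"
  then have r1: "r \<in> {1..n}" by (auto simp: forest_roots_def)
  then have "Suc n - r \<in> {1..n}" "Suc n - (Suc n - r) = r" by auto
  then have "b (Suc n - r) = n" using projective_iff_root[of "Suc n - r"] r G.roots_iff by simp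
  then show "r \<in> (\<lambda>j. n - j + 1) ` projective_vertices n (interval_forest n a b)"
    using r1 by (intro image_eqI[of _ _ "Suc n - r"]) (auto simp: E.projective_eq)
next
  fix r assume "r \<in> (\<lambda>j. n - j + 1) ` projective_vertices n (interval_forest n a b)"
  then obtain j where j: "r = n - j + 1" "j \<in> {1..n}" "b j = n" by (auto simp: E.projective_eq)
  then have "r = Suc n - j" by auto
  then show "r \<in> forest_roots n (interval_forest n c d)" using projective_iff_root j G.roots_iff by blast
qed

lemma injective_image:
  "injective_vertices n (interval_forest n c d) = (\<lambda>j. n - j + 1) ` forest_roots n (interval_forest n a b)"
proof (intro equalityI subsetI)
  fix r assume r: "r \<in> injective_vertices n (interval_forest n c d)"
  then have r1: "r \<in> {1..n}" "c r = 1" by (auto simp: G.injective_eq)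
  then have "Suc n - r \<in> {1..n}" "Suc n - (Suc n - r) = r" by auto
  then have "E.T.child (Suc n - r) 0" using root_iff_injective[of "Suc n - r"] r1 by simp
  then show "r \<in> (\<lambda>j. n - j + 1) ` forest_roots n (interval_forest n a b)"
    using r1 E.roots_iff by (intro image_eqI[of _ _ "Suc n - r"]) auto
next
  fix r assume "r \<in> (\<lambda>j. n - j + 1) ` forest_roots n (interval_forest n a b)"
  then obtain j where j: "r = n - j + 1" "E.T.child j 0" using E.roots_iff by blast
  then have j1: "j \<in> {1..n}" using E.sub_nonzero[OF E.T.child_sub] by blast
  then have "r = Suc n - j" using j by auto
  then show "r \<in> injective_vertices n (interval_forest n c d)"
    using root_iff_injective[OF j1] j j1 by (simp add: G.injective_eq) auto
qed

end

theorem proposition4p11: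
  fixes n :: nat and F :: "(nat \<times> nat) set"
  assumes "n \<ge> 1" and "rooted_forest n F"
  shows "(\<forall>J \<subseteq> {1..n}.
            projective_vertices n F = J \<longleftrightarrow>
            forest_roots n (garside_forest TYPE('k::field) n F) = (\<lambda>j. n - j + 1) ` J) \<and>
         (\<forall>R \<subseteq> {1..n}.
            forest_roots n F = R \<longleftrightarrow>
            injective_vertices n (garside_forest TYPE('k::field) n F) = (\<lambda>k. n - k + 1) ` R)"
proof -
  interpret L: labeled_forest n F by unfold_locales (rule assms(2))
  obtain c d where cd: "dual_pair n L.lft L.rgt c d" and
    G: "garside_forest TYPE('k) n (interval_forest n L.lft L.rgt) = interval_forest n c d"
    by (rule garside_forest_intervals[OF L.exc_intervals_lft_rgt assms(1)])
  interpret dual_pair n L.lft L.rgt c d by (rule cd)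
  have F: "interval_forest n L.lft L.rgt = F" by (rule L.interval_forest_lft_rgt)
  \<comment> \<open>Reflection is injective on labels, so each equality of images yields both
    directions of an equivalence.\<close>
  have inj: "inj_on (\<lambda>j. n - j + 1) {1..n}" by (rule inj_onI) auto
  have proj: "projective_vertices n F \<subseteq> {1..n}" using E.projective_eq F by auto
  have root: "forest_roots n F \<subseteq> {1..n}" by (auto simp: forest_roots_def)
  show ?thesis
    using roots_image injective_image inj_on_image_eq_iff[OF inj proj] inj_on_image_eq_iff[OF inj root]
    unfolding F G[unfolded F] by metis
qed

end
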